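(* Let $\frac12<p<1$ and let $E\subset[0,1]^2$ be the random fractal percolation set with parameter $p$. Conditioned on non-extinction (that is, on $E\neq\emptyset$), almost surely \[ \dim_{\mathrm H} V_x(E)=\dim_{\mathrm B} V_x(E)=1 \] for all $x\in\mathbb R^2\setminus E$ (simultaneously). Moreover, if $\{a_n\}$ is any sequence such that $\frac{a_n}{n^2}\to\infty$ as $n\to\infty$, then almost surely \[ N_n(V_x(E))\le a_n2^n\quad\text{for all sufficiently large } n \] for all $x\in\mathbb R^2\setminus E$.
   Context: Fractal percolation: let $0<p<1$ and $Q_0=[0,1]\times[0,1]$. Divide $Q_0$ into four closed subsquares of equal size; each is chosen with probability $p$ and dropped with probability $1-p$, independently of each other. Let $\mathcal C_1$ be the collection of chosen subsquares. Each $Q\in\mathcal C_1$ is again divided into four subsquares of equal size, each chosen with probability $p$ independently; the collection of all chosen squares at the second level is $\mathcal C_2$. Continue inductively to define $\mathcal C_n$ (consisting of squares of side length $2^{-n}$), and set $E=\bigcap_{n=1}^\infty\bigcup\{Q: Q\in\mathcal C_n\}$. The probability measure induced on the space of constructions is $\mathbf P$. Visible part: for compact $E\subset\mathbb R^2$ and $x\in\mathbb R^2\setminus E$, $V_x(E)=\{a\in E: [a,x]\cap E=\{a\}\}$, where $[a,x]$ is the closed line segment from $a$ to $x$. $N_k(A)$ is the number of (closed) dyadic squares of side length $2^{-k}$ that intersect a set $A\subset\mathbb R^2$. The upper and lower box dimensions of a bounded set $A$ are the $\limsup$ and $\liminf$ of $\log N_k(A)/\log 2^k$ as $k\to\infty$;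 $\dim_{\mathrm B}A$ denotes their common value when they coincide. $\dim_{\mathrm H}$ is Hausdorff dimension. *)

theory Defs
  imports "HOL-Probability.Probability"
begin

section \<open>Dyadic squares\<close>

definition dyadic_square :: "nat \<Rightarrow> int \<Rightarrow> int \<Rightarrow> (real \<times> real) set" where
  "dyadic_square n i j =
     {real_of_int i / 2 ^ n .. (real_of_int i + 1) / 2 ^ n} \<times>
     {real_of_int j / 2 ^ n .. (real_of_int j + 1) / 2 ^ n}"

definition dyadic_squares :: "nat \<Rightarrow> (real \<times> real) set set" where
  "dyadic_squares n = {dyadic_square n i j | i j. True}"

definition unit_square :: "(real \<times> real) set" where
  "unit_square = {0..1} \<times> {0..1}"


section \<open>Fractal percolation\<close>

text \<open>
  A construction is a function assigning to each closed dyadic square of side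
  length \<open>2^-n\<close>, \<open>n \<ge> 1\<close>, inside the unit square the outcome of its coin toss
  (\<open>True\<close> for chosen). The coins of all these squares are independent; the coin of
  a square whose parent has not been chosen is tossed as well but never looked at.
\<close>

definition percolation_squares :: "(real \<times> real) set set" where
  "percolation_squares = (\<Union>n\<in>{1..}. {Q \<in> dyadic_squares n. Q \<subseteq> unit_square})"

definition percolation :: "real \<Rightarrow> ((real \<times> real) set \<Rightarrow> bool) measure" where
  "percolation p = PiM percolation_squares (\<lambda>_. measure_pmf (bernoulli_pmf p))"

text \<open>
  The closed dyadic squares of level \<open>n + 1\<close> contained in a closed dyadic square of
  level \<open>n\<close> are precisely its four closed subsquares of half the side length.
\<close>

primrec chosen :: "((real \<times> real) set \<Rightarrow> bool) \<Rightarrow> nat \<Rightarrow> (real \<times> real) set set" where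
  "chosen \<omega> 0 = {unit_square}"
| "chosen \<omega> (Suc n) = {Q \<in> dyadic_squares (Suc n). (\<exists>Q'\<in>chosen \<omega> n. Q \<subseteq> Q') \<and> \<omega> Q}"

definition percolation_set :: "((real \<times> real) set \<Rightarrow> bool) \<Rightarrow> (real \<times> real) set" where
  "percolation_set \<omega> = (\<Inter>n\<in>{1..}. \<Union>(chosen \<omega> n))"

definition non_extinction :: "real \<Rightarrow> ((real \<times> real) set \<Rightarrow> bool) set" where
  "non_extinction p = {\<omega> \<in> space (percolation p). percolation_set \<omega> \<noteq> {}}"

text \<open>\<open>uniform_measure M A\<close> is the conditional probability \<open>B \<mapsto> M (A \<inter> B) / M A\<close>.\<close>

definition conditioned_percolation :: "real \<Rightarrow> ((real \<times> real) set \<Rightarrow> bool) measure" where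
  "conditioned_percolation p = uniform_measure (percolation p) (non_extinction p)"


section \<open>Visible part\<close>

definition visible_part :: "'a::real_vector \<Rightarrow> 'a set \<Rightarrow> 'a set" where
  "visible_part x E = {a \<in> E. closed_segment a x \<inter> E = {a}}"


section \<open>Box dimension\<close>

text \<open>
  Squares range over the whole plane. The count is finite for bounded sets, which are
  the only ones for which it is meaningful (\<open>card\<close> is 0 on infinite sets).
\<close>

definition dyadic_count :: "nat \<Rightarrow> (real \<times> real) set \<Rightarrow> nat" where
  "dyadic_count k A = card {Q \<in> dyadic_squares k. Q \<inter> A \<noteq> {}}"

definition upper_box_dim :: "(real \<times> real) set \<Rightarrow> ereal" where
  "upper_box_dim A = limsup (\<lambda>k. ereal (ln (real (dyadic_count k A)) / ln (2 ^ k)))"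

definition lower_box_dim :: "(real \<times> real) set \<Rightarrow> ereal" where
  "lower_box_dim A = liminf (\<lambda>k. ereal (ln (real (dyadic_count k A)) / ln (2 ^ k)))"

text \<open>The box dimension of \<open>A\<close> exists and equals \<open>d\<close>.\<close>

definition has_box_dim :: "(real \<times> real) set \<Rightarrow> ereal \<Rightarrow> bool" where
  "has_box_dim A d \<longleftrightarrow> lower_box_dim A = d \<and> upper_box_dim A = d"


section \<open>Hausdorff dimension\<close>

text \<open>
  The case distinction implements \<open>0^0 = 1\<close> for nonempty sets and assigns 0 to the
  empty set; \<open>0 powr 0\<close> would be 0.
\<close>

definition diam_powr :: "real \<Rightarrow> 'a::metric_space set \<Rightarrow> ennreal" where
  "diam_powr s U = (if U = {} then 0 else if s = 0 then 1 else ennreal (diameter U powr s))"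

text \<open>\<open>diameter\<close> is only meaningful on bounded sets, hence the boundedness condition.\<close>

definition hausdorff_premeasure :: "real \<Rightarrow> real \<Rightarrow> 'a::metric_space set \<Rightarrow> ennreal" where
  "hausdorff_premeasure s \<delta> A =
     Inf {(\<Sum>i. diam_powr s (U i)) | U :: nat \<Rightarrow> 'a set.
            A \<subseteq> (\<Union>i. U i) \<and> (\<forall>i. bounded (U i) \<and> diameter (U i) \<le> \<delta>)}"

definition hausdorff_outer_measure :: "real \<Rightarrow> 'a::metric_space set \<Rightarrow> ennreal" where
  "hausdorff_outer_measure s A = (SUP \<delta>\<in>{0<..}. hausdorff_premeasure s \<delta> A)"

definition hausdorff_dim :: "'a::metric_space set \<Rightarrow> ereal" where
  "hausdorff_dim A = Inf {ereal s | s. 0 \<le> s \<and> hausdorff_outer_measure s A = 0}"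

end

theory Submission
  imports Defs "HOL-Real_Asymp.Real_Asymp"
begin

text \<open>
  Since \<open>2p > 1\<close>, the number of chosen squares that a line of slope at most 1 crosses substantially
  doubles every few levels, up to a doubly exponentially small error probability (Hoeffding). Two
  digital lines with equal zeroth and first moments coincide, so at each level there are only
  polynomially many ways in which a line can meet the squares. By a union bound, with positive
  probability a square is good: it blocks all lines that cross it. The subtrees below the squares
  of one level are independent, hence with probability \<open>1 - O(n 2^-n)\<close>, for all \<open>k \<le> n\<close>, a segment
  from \<open>x\<close> to a visible point crosses only \<open>O(n)\<close> chosen squares of level \<open>k\<close>, so that at most
  \<open>O(n 2^k)\<close> squares of level \<open>k\<close> have a visible point in their middle. Every other visible square
  of level \<open>n\<close> touches the midline of an ancestor that does, or the boundary of the unit square;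
  summing over \<open>k\<close> gives \<open>O(n^2 2^n)\<close> visible squares.

  Conversely, almost surely every surviving square contains a good one. It blocks all lines from
  \<open>x\<close> with directions in some interval, and the direction is a Lipschitz function on the visible
  points, so these have positive one-dimensional Hausdorff content.
\<close>

section \<open>Independent coins\<close>

text \<open>The statement concerns all viewpoints at once, so no random event may mention
  \<open>x\<close>. Every event speaks of lines instead, which have only finitely many types at each
  level, and every exceptional null set is independent of \<open>x\<close>.

  "Substantially" is what lets the count grow. A line that clips a corner may meet few descendants.
  A line that stays in a square over a quarter of its width crosses at least
  \<open>2 ^ (r - 2)\<close> descendants of depth \<open>r\<close> in the same manner, and on
  average at least \<open>(2 * p) ^ r / 4\<close> of these are chosen. This is where
  \<open>p > 1 / 2\<close> enters. There are at most \<open>2 ^ (5 * n + 16)\<close> types at level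
  \<open>n\<close>, whereas the error at level \<open>r0 * m\<close> is
  \<open>exp (- c * 2 ^ m)\<close>, so the union bound succeeds.

  The price is that nearby lines cross a square substantially only if they pass through its middle;
  this is why visible points are first counted in the middle of their squares and the others are
  charged to ancestors. One factor \<open>n\<close> of the final bound is this sum over ancestors.
  The other is the number \<open>K * n\<close> of failing squares that makes the union bound over
  types exponentially small in \<open>n\<close> at all levels \<open>k \<le> n\<close>
  together.\<close>

text \<open>The quantifier runs over all functions, not only over the space of the product measure:
  relabelled configurations need not be \<open>undefined\<close> outside the index set, and
  dependence on the index set makes those values harmless.\<close>

definition depends_on :: "'i set \<Rightarrow> (('i \<Rightarrow> bool) \<Rightarrow> 'b) \<Rightarrow> bool" where
  "depends_on J A \<longleftrightarrow> (\<forall>\<omega> \<omega>'. (\<forall>x\<in>J. \<omega> x = \<omega>' x) \<longrightarrow> A \<omega> = A \<omega>')"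

lemma depends_onD: "depends_on J A \<Longrightarrow> (\<And>x. x \<in> J \<Longrightarrow> \<omega> x = \<omega>' x) \<Longrightarrow> A \<omega> = A \<omega>'"
  unfolding depends_on_def by blast

lemma depends_onI: "(\<And>\<omega> \<omega>'. (\<And>x. x \<in> J \<Longrightarrow> \<omega> x = \<omega>' x) \<Longrightarrow> A \<omega> = A \<omega>') \<Longrightarrow> depends_on J A"
  unfolding depends_on_def by blast

lemma depends_on_mono: "depends_on J A \<Longrightarrow> J \<subseteq> J' \<Longrightarrow> depends_on J' A"
  unfolding depends_on_def by blast

lemma depends_on_comp: "depends_on J A \<Longrightarrow> depends_on J (\<lambda>\<omega>. f (A \<omega>))"
  unfolding depends_on_def by metis

lemma depends_on_comp2:
  "depends_on J A \<Longrightarrow> depends_on J B \<Longrightarrow> depends_on J (\<lambda>\<omega>. f (A \<omega>) (B \<omega>))"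
  unfolding depends_on_def by metis

lemma depends_on_All: "(\<And>x. depends_on J (A x)) \<Longrightarrow> depends_on J (\<lambda>\<omega>. \<forall>x. A x \<omega>)"
  unfolding depends_on_def by metis

lemma depends_on_Ball: "(\<And>x. x \<in> S \<Longrightarrow> depends_on J (A x)) \<Longrightarrow> depends_on J (\<lambda>\<omega>. \<forall>x\<in>S. A x \<omega>)"
  unfolding depends_on_def by metis

locale coins =
  fixes I :: "'i set" and p :: real
  assumes p_pos: "0 < p" and p_less: "p < 1"
begin

abbreviation (input) coin :: "bool measure" where "coin \<equiv> measure_pmf (bernoulli_pmf p)"

definition M :: "('i \<Rightarrow> bool) measure" where
  "M = PiM I (\<lambda>_. coin)"

sublocale prob_space M
  unfolding M_def by (intro prob_space_PiM measure_pmf.prob_space_axioms)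

lemma space_M: "space M = (I \<rightarrow>\<^sub>E UNIV)"
  unfolding M_def by (simp add: space_PiM)

lemma coin_measurable [measurable]: "i \<in> I \<Longrightarrow> (\<lambda>\<omega>. \<omega> i) \<in> M \<rightarrow>\<^sub>M count_space UNIV"
proof -
  assume "i \<in> I"
  then have "(\<lambda>\<omega>. \<omega> i) \<in> M \<rightarrow>\<^sub>M coin"
    unfolding M_def by (rule measurable_component_singleton)
  then show ?thesis
    by (simp add: measurable_def)
qed

lemma sets_finite_dep:
  assumes "depends_on J A" "finite J" "J \<subseteq> I"
  shows "{\<omega> \<in> space M. A \<omega>} \<in> sets M"
proof -
  have eq: "{\<omega> \<in> space M. A \<omega>} = (\<Union>S\<in>{S \<in> Pow J. A (\<lambda>x. x \<in> S)}. {\<omega> \<in> space M. \<forall>x\<in>J. \<omega> x = (x \<in> S)})"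
  proof (intro set_eqI iffI)
    fix \<omega> assume w: "\<omega> \<in> {\<omega> \<in> space M. A \<omega>}"
    have "A (\<lambda>x. x \<in> {x\<in>J. \<omega> x})"
      using w depends_onD[OF assms(1), of \<omega> "\<lambda>x. x \<in> {x\<in>J. \<omega> x}"] by auto
    with w show "\<omega> \<in> (\<Union>S\<in>{S \<in> Pow J. A (\<lambda>x. x \<in> S)}. {\<omega> \<in> space M. \<forall>x\<in>J. \<omega> x = (x \<in> S)})"
      by (intro UN_I[of "{x\<in>J. \<omega> x}"]) auto
  next
    fix \<omega> assume "\<omega> \<in> (\<Union>S\<in>{S \<in> Pow J. A (\<lambda>x. x \<in> S)}. {\<omega> \<in> space M. \<forall>x\<in>J. \<omega> x = (x \<in> S)})"
    then obtain S where "A (\<lambda>x. x \<in> S)" "\<omega> \<in> space M" "\<forall>x\<in>J. \<omega> x = (x \<in> S)" by auto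
    with depends_onD[OF assms(1), of \<omega> "\<lambda>x. x \<in> S"] show "\<omega> \<in> {\<omega> \<in> space M. A \<omega>}" by auto
  qed
  have "{\<omega> \<in> space M. \<forall>x\<in>J. \<omega> x = (x \<in> S)} \<in> sets M" for S
  proof (intro sets.sets_Collect_finite_All assms(2))
    fix x assume "x \<in> J"
    then have [measurable]: "(\<lambda>\<omega>. \<omega> x) \<in> M \<rightarrow>\<^sub>M count_space UNIV"
      using assms(3) by auto
    show "{\<omega> \<in> space M. \<omega> x = (x \<in> S)} \<in> sets M" by measurable
  qed
  moreover have "finite {S \<in> Pow J. A (\<lambda>x. x \<in> S)}" using assms(2) by auto
  ultimately show ?thesis unfolding eq by (intro sets.finite_UN) auto
qed

lemma pred_finite_dep:
  assumes "depends_on J A" "finite J" "J \<subseteq> I"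
  shows "Measurable.pred M A"
  using sets_finite_dep[OF assms] by (simp add: pred_def)

lemma indep_coordinates: "indep_vars (\<lambda>_. coin) (\<lambda>i \<omega>. \<omega> i) I"
proof (cases "I = {}")
  case True
  then show ?thesis unfolding indep_vars_def indep_sets_def by auto
next
  case False
  have rv: "random_variable coin (\<lambda>\<omega>. \<omega> i)" if "i \<in> I" for i
    unfolding M_def using that by (rule measurable_component_singleton)
  have "distr M (PiM I (\<lambda>i. coin)) (\<lambda>x. \<lambda>i\<in>I. x i) = distr M M (\<lambda>x. x)"
    by (intro distr_cong) (auto simp: M_def space_PiM)
  also have "\<dots> = M" by simp
  also have "\<dots> = PiM I (\<lambda>i. distr M coin (\<lambda>\<omega>. \<omega> i))"
  proof -
    interpret product_prob_space "\<lambda>_. coin" I ..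
    show ?thesis unfolding M_def by (intro PiM_cong) (auto simp: PiM_component)
  qed
  finally show ?thesis
    using indep_vars_iff_distr_eq_PiM'[OF False rv, of "\<lambda>i. i"] by simp
qed

text \<open>
  The coordinates outside \<open>J\<close> are irrelevant, so they may be filled in arbitrarily; this
  exhibits an event depending on \<open>J\<close> as the preimage of an event of the product over \<open>J\<close>.
\<close>

definition fill :: "'i set \<Rightarrow> ('i \<Rightarrow> bool) \<Rightarrow> 'i \<Rightarrow> bool" where
  "fill J \<eta> = (\<lambda>i. if i \<in> I then if i \<in> J then \<eta> i else True else undefined)"

lemma fill_measurable:
  assumes "J \<subseteq> I"
  shows "fill J \<in> PiM J (\<lambda>_. coin) \<rightarrow>\<^sub>M M"
  unfolding M_def
proof (rule measurable_PiM_single')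
  show "\<And>i. i \<in> I \<Longrightarrow> (\<lambda>\<omega>. fill J \<omega> i) \<in> PiM J (\<lambda>_. coin) \<rightarrow>\<^sub>M coin"
  proof -
    fix i assume "i \<in> I"
    then show "(\<lambda>\<omega>. fill J \<omega> i) \<in> PiM J (\<lambda>_. coin) \<rightarrow>\<^sub>M coin"
      unfolding fill_def
      by (cases "i \<in> J") (simp_all del: measurable_pmf_measure2 measurable_pmf_measure1 add: measurable_component_singleton)
  qed
  show "fill J \<in> space (PiM J (\<lambda>_. coin)) \<rightarrow> (\<Pi>\<^sub>E i\<in>I. space coin)"
    by (auto simp: fill_def)
qed

lemma fill_agree: "J \<subseteq> I \<Longrightarrow> depends_on J A \<Longrightarrow> A (fill J (restrict (\<lambda>i. \<omega> i) J)) = A \<omega>"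
  by (rule depends_onD[of J]) (auto simp: fill_def)

text \<open>The restrictions of a configuration to \<open>J\<close> and \<open>K\<close> are
  independent; \<open>fill\<close> turns \<open>A\<close> and \<open>B\<close> into events
  \<open>A'\<close> and \<open>B'\<close> about these restrictions.\<close>

lemma prob_conj_indep:
  assumes AB: "depends_on J A" "depends_on K B" "J \<subseteq> I" "K \<subseteq> I" "J \<inter> K = {}"
    and [measurable]: "Measurable.pred M A" "Measurable.pred M B"
  shows "prob {\<omega> \<in> space M. A \<omega> \<and> B \<omega>} = prob {\<omega> \<in> space M. A \<omega>} * prob {\<omega> \<in> space M. B \<omega>}"
proof -
  have *: "indep_var (PiM J (\<lambda>_. coin)) (\<lambda>\<omega>. restrict (\<lambda>i. \<omega> i) J) (PiM K (\<lambda>_. coin)) (\<lambda>\<omega>. restrict (\<lambda>i. \<omega> i) K)"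
    using AB by (intro indep_var_restrict[OF indep_coordinates]) auto
  define A' where "A' = fill J -` {\<omega>\<in>space M. A \<omega>} \<inter> space (PiM J (\<lambda>_. coin))"
  define B' where "B' = fill K -` {\<omega>\<in>space M. B \<omega>} \<inter> space (PiM K (\<lambda>_. coin))"
  have A': "A' \<in> sets (PiM J (\<lambda>_. coin))"
    unfolding A'_def by (rule measurable_sets[OF fill_measurable[OF AB(3)]]) measurable
  have B': "B' \<in> sets (PiM K (\<lambda>_. coin))"
    unfolding B'_def by (rule measurable_sets[OF fill_measurable[OF AB(4)]]) measurable
  have fillspace: "fill J \<eta> \<in> space M" for J \<eta>
    by (auto simp: space_M fill_def)
  have eA: "restrict (\<lambda>i. \<omega> i) J \<in> A' \<longleftrightarrow> A \<omega>" for \<omega>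
    using fillspace fill_agree[OF AB(3,1)] by (auto simp: A'_def space_PiM)
  have eB: "restrict (\<lambda>i. \<omega> i) K \<in> B' \<longleftrightarrow> B \<omega>" for \<omega>
    using fillspace fill_agree[OF AB(4,2)] by (auto simp: B'_def space_PiM)
  show ?thesis
    using indep_varD[OF * A' B'] unfolding eA eB vimage_def Int_def
    by (simp add: conj_commute Collect_conj_eq eA eB mem_Times_iff)
qed

lemma prob_Ball_indep:
  assumes "finite T" "\<And>t. t \<in> T \<Longrightarrow> depends_on (K t) (A t)" "\<And>t. t \<in> T \<Longrightarrow> K t \<subseteq> I"
    "disjoint_family_on K T" "\<And>t. t \<in> T \<Longrightarrow> Measurable.pred M (A t)"
  shows "prob {\<omega> \<in> space M. \<forall>t\<in>T. A t \<omega>} = (\<Prod>t\<in>T. prob {\<omega> \<in> space M. A t \<omega>})"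
  using assms
proof (induction T rule: finite_induct)
  case empty
  then show ?case by (simp add: prob_space)
next
  case (insert t T)
  have "prob {\<omega> \<in> space M. A t \<omega> \<and> (\<forall>t\<in>T. A t \<omega>)} =
     prob {\<omega> \<in> space M. A t \<omega>} * prob {\<omega> \<in> space M. \<forall>t\<in>T. A t \<omega>}"
  proof (rule prob_conj_indep[of "K t" _ "\<Union>(K ` T)"])
    show "depends_on (\<Union>(K ` T)) (\<lambda>\<omega>. \<forall>t\<in>T. A t \<omega>)"
      by (rule depends_on_Ball) (use insert in \<open>auto intro: depends_on_mono\<close>)
    show "K t \<inter> \<Union>(K ` T) = {}"
      using insert by (auto simp: disjoint_family_on_def)
    show "Measurable.pred M (\<lambda>\<omega>. \<forall>t\<in>T. A t \<omega>)"
      using insert by (intro pred_intros_finite) auto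
  qed (use insert in auto)
  moreover have "disjoint_family_on K T"
    using insert by (auto simp: disjoint_family_on_def)
  ultimately show ?case
    using insert by simp
qed

lemma prob_all_True:
  assumes "finite J" "J \<subseteq> I"
  shows "prob {\<omega> \<in> space M. \<forall>i\<in>J. \<omega> i} = p ^ card J"
proof -
  interpret product_prob_space "\<lambda>_. coin" I ..
  have "emeasure M {\<omega> \<in> space M. \<forall>i\<in>J. \<omega> i \<in> {True}} = (\<Prod>i\<in>J. emeasure coin {True})"
    unfolding M_def using assms by (intro emeasure_PiM_Collect) auto
  also have "emeasure coin {True} = ennreal p"
    using p_pos p_less by (simp add: emeasure_pmf_single)
  finally have "emeasure M {\<omega> \<in> space M. \<forall>i\<in>J. \<omega> i} = ennreal (p ^ card J)"
    using p_pos by (simp add: prod_ennreal ennreal_power)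
  then show ?thesis using p_pos by (simp add: measure_def)
qed

lemma prob_all_False:
  assumes "finite J" "J \<subseteq> I"
  shows "prob {\<omega> \<in> space M. \<forall>i\<in>J. \<not> \<omega> i} = (1 - p) ^ card J"
proof -
  interpret product_prob_space "\<lambda>_. coin" I ..
  have "emeasure M {\<omega> \<in> space M. \<forall>i\<in>J. \<omega> i \<in> {False}} = (\<Prod>i\<in>J. emeasure coin {False})"
    unfolding M_def using assms by (intro emeasure_PiM_Collect) auto
  also have "emeasure coin {False} = ennreal (1 - p)"
    using p_pos p_less by (simp add: emeasure_pmf_single)
  finally have "emeasure M {\<omega> \<in> space M. \<forall>i\<in>J. \<not> \<omega> i} = ennreal ((1 - p) ^ card J)"
    using p_less by (simp add: prod_ennreal ennreal_power)
  then show ?thesis using p_less by (simp add: measure_def)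
qed

section \<open>Conditioning on finitely many coins, and relabelling coins\<close>

text \<open>\<open>A (X \<omega>)\<close> is an event chosen at random; as \<open>X\<close> takes
  finitely many values, splitting by its value leaves a finite union of fixed events.\<close>

lemma sets_conditional:
  assumes J: "J \<subseteq> I" "finite J" "depends_on J X" "depends_on J F"
    and fin: "finite \<T>" "\<And>\<omega>. F \<omega> \<Longrightarrow> X \<omega> \<in> \<T>"
    and A: "\<And>T. T \<in> \<T> \<Longrightarrow> Measurable.pred M (A T)"
  shows "{\<omega> \<in> space M. F \<omega> \<and> A (X \<omega>) \<omega>} \<in> events"
proof -
  have "{\<omega> \<in> space M. F \<omega> \<and> A (X \<omega>) \<omega>} = (\<Union>T\<in>\<T>. {\<omega> \<in> space M. (F \<omega> \<and> X \<omega> = T) \<and> A T \<omega>})"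
    using fin(2) by auto
  also have "\<dots> \<in> events"
  proof (intro sets.finite_UN fin(1))
    fix T assume T: "T \<in> \<T>"
    have [measurable]: "Measurable.pred M (\<lambda>\<omega>. F \<omega> \<and> X \<omega> = T)"
      by (rule pred_finite_dep[OF _ J(2,1)]) (use J in \<open>unfold depends_on_def, metis\<close>)
    note [measurable] = A[OF T]
    show "{\<omega> \<in> space M. (F \<omega> \<and> X \<omega> = T) \<and> A T \<omega>} \<in> events" by measurable
  qed
  finally show ?thesis .
qed

text \<open>
  Conditioning on the coins in \<open>J\<close>: once \<open>X\<close> is known, the event \<open>A (X \<omega>)\<close> only involves
  the remaining coins.
\<close>

lemma prob_conditional_le:
  assumes J: "J \<subseteq> I" "finite J" "depends_on J X" "depends_on J F"
    and fin: "finite \<T>" "\<And>\<omega>. F \<omega> \<Longrightarrow> X \<omega> \<in> \<T>"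
    and A: "\<And>T. T \<in> \<T> \<Longrightarrow> depends_on (I - J) (A T)"
      "\<And>T. T \<in> \<T> \<Longrightarrow> Measurable.pred M (A T)"
      "\<And>T. T \<in> \<T> \<Longrightarrow> prob {\<omega> \<in> space M. A T \<omega>} \<le> \<beta>"
  shows "prob {\<omega> \<in> space M. F \<omega> \<and> A (X \<omega>) \<omega>} \<le> \<beta> * prob {\<omega> \<in> space M. F \<omega>}"
proof -
  have FX: "depends_on J (\<lambda>\<omega>. F \<omega> \<and> X \<omega> = T)" for T
    using J unfolding depends_on_def by metis
  have mFX: "Measurable.pred M (\<lambda>\<omega>. F \<omega> \<and> X \<omega> = T)" for T
    by (rule pred_finite_dep[OF FX J(2,1)])
  have "{\<omega> \<in> space M. F \<omega> \<and> A (X \<omega>) \<omega>} = (\<Union>T\<in>\<T>. {\<omega> \<in> space M. (F \<omega> \<and> X \<omega> = T) \<and> A T \<omega>})"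
    using fin(2) by auto
  also have "prob \<dots> = (\<Sum>T\<in>\<T>. prob {\<omega> \<in> space M. (F \<omega> \<and> X \<omega> = T) \<and> A T \<omega>})"
  proof (rule finite_measure_finite_Union)
    show "(\<lambda>T. {\<omega> \<in> space M. (F \<omega> \<and> X \<omega> = T) \<and> A T \<omega>}) ` \<T> \<subseteq> events"
    proof safe
      fix T assume "T \<in> \<T>"
      note [measurable] = mFX A(2)[OF this]
      show "{\<omega> \<in> space M. (F \<omega> \<and> X \<omega> = T) \<and> A T \<omega>} \<in> events" by measurable
    qed
  qed (use fin(1) in \<open>auto simp: disjoint_family_on_def\<close>)
  also have "\<dots> \<le> (\<Sum>T\<in>\<T>. \<beta> * prob {\<omega> \<in> space M. F \<omega> \<and> X \<omega> = T})"
  proof (rule sum_mono)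
    fix T assume T: "T \<in> \<T>"
    have "prob {\<omega> \<in> space M. (F \<omega> \<and> X \<omega> = T) \<and> A T \<omega>} =
       prob {\<omega> \<in> space M. F \<omega> \<and> X \<omega> = T} * prob {\<omega> \<in> space M. A T \<omega>}"
      by (rule prob_conj_indep[OF FX A(1)[OF T] J(1) _ _ mFX A(2)[OF T]]) auto
    also have "\<dots> \<le> prob {\<omega> \<in> space M. F \<omega> \<and> X \<omega> = T} * \<beta>"
      using A(3)[OF T] by (intro mult_left_mono) auto
    finally show "prob {\<omega> \<in> space M. (F \<omega> \<and> X \<omega> = T) \<and> A T \<omega>} \<le> \<beta> * prob {\<omega> \<in> space M. F \<omega> \<and> X \<omega> = T}"
      by (simp add: mult.commute)
  qed
  also have "\<dots> = \<beta> * (\<Sum>T\<in>\<T>. prob {\<omega> \<in> space M. F \<omega> \<and> X \<omega> = T})"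
    by (simp add: sum_distrib_left)
  also have "(\<Sum>T\<in>\<T>. prob {\<omega> \<in> space M. F \<omega> \<and> X \<omega> = T}) = prob (\<Union>T\<in>\<T>. {\<omega> \<in> space M. F \<omega> \<and> X \<omega> = T})"
  proof (rule finite_measure_finite_Union[symmetric])
    show "(\<lambda>T. {\<omega> \<in> space M. F \<omega> \<and> X \<omega> = T}) ` \<T> \<subseteq> events"
      using mFX by (auto simp: pred_def)
  qed (use fin(1) in \<open>auto simp: disjoint_family_on_def\<close>)
  also have "(\<Union>T\<in>\<T>. {\<omega> \<in> space M. F \<omega> \<and> X \<omega> = T}) = {\<omega> \<in> space M. F \<omega>}"
    using fin(2) by auto
  finally show ?thesis .
qed

text \<open>An injective relabelling of the index set into itself preserves the product measure. It
  is applied to the embedding of a subtree and to the exchange of coordinates.\<close>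

lemma
  assumes \<sigma>: "inj_on \<sigma> I" "\<sigma> ` I \<subseteq> I" and A: "depends_on I A" "Measurable.pred M A"
  shows pred_reindex: "Measurable.pred M (\<lambda>\<omega>. A (\<lambda>i. \<omega> (\<sigma> i)))"
    and prob_reindex: "prob {\<omega> \<in> space M. A (\<lambda>i. \<omega> (\<sigma> i))} = prob {\<omega> \<in> space M. A \<omega>}"
    and AE_reindex: "(AE \<omega> in M. A \<omega>) \<Longrightarrow> (AE \<omega> in M. A (\<lambda>i. \<omega> (\<sigma> i)))"
proof -
  note [measurable] = A(2)
  have d: "distr M M (\<lambda>\<omega>. \<lambda>n\<in>I. \<omega> (\<sigma> n)) = M"
    unfolding M_def using \<sigma>
    by (intro distr_PiM_reindex[of I "\<lambda>_. coin" \<sigma> I] measure_pmf.prob_space_axioms) auto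
  have [measurable]: "(\<lambda>\<omega>. \<lambda>n\<in>I. \<omega> (\<sigma> n)) \<in> M \<rightarrow>\<^sub>M M"
    unfolding M_def using \<sigma>(2)
    by (intro measurable_restrict measurable_component_singleton) auto
  have eq: "A (\<lambda>n\<in>I. \<omega> (\<sigma> n)) = A (\<lambda>n. \<omega> (\<sigma> n))" for \<omega>
    by (rule depends_onD[OF A(1)]) auto
  have "Measurable.pred M (\<lambda>\<omega>. A (\<lambda>n\<in>I. \<omega> (\<sigma> n)))" by measurable
  then show 1: "Measurable.pred M (\<lambda>\<omega>. A (\<lambda>i. \<omega> (\<sigma> i)))" by (simp add: eq)
  have "prob {\<omega> \<in> space M. A \<omega>} = measure (distr M M (\<lambda>\<omega>. \<lambda>n\<in>I. \<omega> (\<sigma> n))) {\<omega> \<in> space M. A \<omega>}"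
    by (simp only: d)
  also have "\<dots> = prob {\<omega> \<in> space M. A (\<lambda>n\<in>I. \<omega> (\<sigma> n))}"
    using A(2) by (subst measure_distr) (auto intro!: arg_cong[of _ _ prob] simp: pred_def, simp add: space_M)
  finally show "prob {\<omega> \<in> space M. A (\<lambda>i. \<omega> (\<sigma> i))} = prob {\<omega> \<in> space M. A \<omega>}"
    by (simp add: eq)
  assume "AE \<omega> in M. A \<omega>"
  then have "AE \<omega> in distr M M (\<lambda>\<omega>. \<lambda>n\<in>I. \<omega> (\<sigma> n)). A \<omega>" by (simp only: d)
  then have "AE \<omega> in M. A (\<lambda>n\<in>I. \<omega> (\<sigma> n))" by (rule AE_distrD[rotated]) measurable
  then show "AE \<omega> in M. A (\<lambda>i. \<omega> (\<sigma> i))" by (simp add: eq)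
qed

text \<open>Independence for real variables rather than events, as Hoeffding's inequality
  requires.\<close>

lemma indep_vars_depends_on:
  fixes Y :: "'t \<Rightarrow> ('i \<Rightarrow> bool) \<Rightarrow> real"
  assumes "\<And>t. t \<in> T \<Longrightarrow> depends_on (K t) (Y t)" "\<And>t. t \<in> T \<Longrightarrow> K t \<subseteq> I"
    "disjoint_family_on K T" "\<And>t. t \<in> T \<Longrightarrow> Y t \<in> borel_measurable M"
  shows "indep_vars (\<lambda>_. borel) Y T"
proof -
  have "indep_vars (\<lambda>t. PiM (K t) (\<lambda>_. coin)) (\<lambda>t \<omega>. restrict (\<lambda>i. \<omega> i) (K t)) T"
    using assms by (intro indep_vars_restrict[OF indep_coordinates]) auto
  then have "indep_vars (\<lambda>_. borel) (\<lambda>t \<omega>. Y t (fill (K t) (restrict (\<lambda>i. \<omega> i) (K t)))) T"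
    using assms by (intro indep_vars_compose2[where Y="\<lambda>t \<eta>. Y t (fill (K t) \<eta>)"])
      (auto intro!: measurable_compose[OF fill_measurable])
  then show ?thesis
    using assms by (subst indep_vars_cong[of T T _ "\<lambda>t \<omega>. Y t (fill (K t) (restrict (\<lambda>i. \<omega> i) (K t)))"])
      (auto simp: fill_agree)
qed

end


section \<open>Digital lines\<close>

text \<open>
  Two digital lines differ with at most one sign change, at \<open>c\<close> say, so the weights
  \<open>2q - 2c + 1\<close> turn their difference into a nonnegative function with vanishing sum.
\<close>

lemma digital_line_moments:
  fixes a b a' b' :: real and N :: nat
  defines "r \<equiv> \<lambda>q::nat. \<lfloor>a * real q + b\<rfloor>" and "r' \<equiv> \<lambda>q::nat. \<lfloor>a' * real q + b'\<rfloor>"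
  assumes 0: "(\<Sum>q<N. r q) = (\<Sum>q<N. r' q)" and 1: "(\<Sum>q<N. int q * r q) = (\<Sum>q<N. int q * r' q)"
    and q: "q < N"
  shows "r q = r' q"
proof -
  have main: "\<lfloor>a * real q + b\<rfloor> = \<lfloor>a' * real q + b'\<rfloor>"
    if le: "a \<le> a'" and 0: "(\<Sum>q<N. \<lfloor>a * real q + b\<rfloor>) = (\<Sum>q<N. \<lfloor>a' * real q + b'\<rfloor>)"
      and 1: "(\<Sum>q<N. int q * \<lfloor>a * real q + b\<rfloor>) = (\<Sum>q<N. int q * \<lfloor>a' * real q + b'\<rfloor>)"
    for a b a' b' :: real
  proof -
    define d where "d q = \<lfloor>a' * real q + b'\<rfloor> - \<lfloor>a * real q + b\<rfloor>" for q :: nat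
    define g where "g q = (a' - a) * real q + (b' - b)" for q :: nat
    have g_mono: "g q \<le> g q'" if "q \<le> q'" for q q'
      unfolding g_def using le that by (intro add_right_mono mult_left_mono) auto
    have d_pos: "d q \<ge> 0" if "g q \<ge> 0" for q
      unfolding d_def using that by (simp add: g_def algebra_simps floor_mono)
    have d_neg: "d q \<le> 0" if "g q < 0" for q
      unfolding d_def using that by (simp add: g_def algebra_simps floor_mono)
    define c where "c = (if \<exists>q. g q \<ge> 0 then LEAST q. g q \<ge> 0 else N)"
    have c1: "g q < 0" if "q < c" "q < N" for q
      using that not_less_Least[of q "\<lambda>q. g q \<ge> 0"] unfolding c_def
      by (auto split: if_splits simp: not_le)
    have c2: "g q \<ge> 0" if "q \<ge> c" "q < N" for q
    proof (cases "\<exists>q. g q \<ge> 0")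
      case True
      then have "g c \<ge> 0" unfolding c_def using LeastI_ex[of "\<lambda>q. g q \<ge> 0"] by auto
      then show ?thesis using g_mono[OF that(1)] by linarith
    next
      case False
      then show ?thesis using that unfolding c_def by simp
    qed
    define w where "w q = (2 * int q - 2 * int c + 1) * d q" for q
    have w: "w q \<ge> 0" if "q < N" for q
    proof (cases "q < c")
      case True
      then show ?thesis using d_neg[OF c1[OF True that]] unfolding w_def
        by (intro mult_nonpos_nonpos) auto
    next
      case False
      then show ?thesis using d_pos[OF c2] that unfolding w_def by (intro mult_nonneg_nonneg) auto
    qed
    have "(\<Sum>q<N. w q) = 2 * (\<Sum>q<N. int q * d q) + (1 - 2 * int c) * (\<Sum>q<N. d q)"
      unfolding w_def sum_distrib_left sum.distrib[symmetric]
      by (intro sum.cong refl) (simp add: algebra_simps)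
    also have "(\<Sum>q<N. d q) = 0"
      unfolding d_def sum_subtractf using 0 by simp
    also have "(\<Sum>q<N. int q * d q) = 0"
      unfolding d_def right_diff_distrib sum_subtractf using 1 by simp
    \<comment> \<open>The weight \<open>2q - 2c + 1\<close> is odd, so it never vanishes and
      \<open>w q = 0\<close> forces \<open>d q = 0\<close>.\<close>
    finally have "w q = 0"
      using w q sum_nonneg_eq_0_iff[of "{..<N}" w] by auto
    moreover have "2 * int q - 2 * int c + 1 \<noteq> 0" by presburger
    ultimately show ?thesis by (simp add: w_def d_def)
  qed
  show ?thesis
  proof (cases "a \<le> a'")
    case True
    show ?thesis using main[OF True 0[unfolded r_def r'_def] 1[unfolded r_def r'_def]]
      unfolding r_def r'_def .
  next
    case False
    then have "a' \<le> a" by simp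
    from main[OF this 0[unfolded r_def r'_def, symmetric] 1[unfolded r_def r'_def, symmetric]]
    show ?thesis unfolding r_def r'_def by (rule sym)
  qed
qed

text \<open>
  The line \<open>y = s x + t\<close> over \<open>[0,1]\<close>, seen at level \<open>n\<close>: each of the \<open>2^n\<close> columns is cut into
  four, and \<open>row s t n q\<close> is the row of the point of the line at \<open>x = q / 2^(n+2)\<close>.
\<close>

definition row :: "real \<Rightarrow> real \<Rightarrow> nat \<Rightarrow> nat \<Rightarrow> int" where
  "row s t n q = \<lfloor>s / 4 * real q + 2 ^ n * t\<rfloor>"

text \<open>Two consecutive sample points in row \<open>j\<close> keep the line inside the square
  over a quarter of the column. The condition reads only the values of \<open>row\<close>, so lines
  with equal rows have equal hit sets.\<close>

definition hit :: "real \<Rightarrow> real \<Rightarrow> nat \<Rightarrow> (nat \<times> nat) set" where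
  "hit s t n = {(i, j). i < 2 ^ n \<and> j < 2 ^ n \<and>
     (\<exists>q<4. row s t n (4 * i + q) = int j \<and> row s t n (4 * i + q + 1) = int j)}"

text \<open>A line of slope at most 1 through a point of the unit square has its intercept in
  \<open>[-1, 2]\<close>.\<close>

definition lines :: "(real \<times> real) set" where
  "lines = {-1..1} \<times> {-2..2}"

definition hit_types :: "nat \<Rightarrow> (nat \<times> nat) set set" where
  "hit_types n = (\<lambda>(s, t). hit s t n) ` lines"

lemma hit_subset: "hit s t n \<subseteq> {..<2^n} \<times> {..<2^n}"
  by (auto simp: hit_def)

lemma finite_hit [simp]: "finite (hit s t n)"
  by (rule finite_subset[OF hit_subset]) auto

lemma row_bound:
  assumes "(s, t) \<in> lines" "q \<le> 4 * 2 ^ n"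
  shows "\<bar>row s t n q\<bar> \<le> 2 ^ (n + 2)"
proof -
  have s: "\<bar>s\<bar> \<le> 1" and t: "\<bar>t\<bar> \<le> 2" using assms by (auto simp: lines_def)
  have q: "real q \<le> 4 * 2 ^ n"
    using assms(2) by (metis of_nat_le_iff of_nat_mult of_nat_numeral of_nat_power)
  have "\<bar>s * real q\<bar> \<le> 1 * (4 * 2 ^ n)" unfolding abs_mult using s q by (intro mult_mono) auto
  moreover have "\<bar>2 ^ n * t\<bar> \<le> 2 ^ n * 2" unfolding abs_mult using t by (intro mult_mono) auto
  moreover have "(1::real) \<le> 2 ^ n" by simp
  ultimately have "- (2 ^ (n + 2)) \<le> s / 4 * real q + 2 ^ n * t" "s / 4 * real q + 2 ^ n * t \<le> 2 ^ (n + 2)"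
    by (auto simp: power_add)
  then have "- (2 ^ (n + 2)) \<le> row s t n q" "row s t n q \<le> 2 ^ (n + 2)"
    unfolding row_def by (auto simp: le_floor_iff floor_le_iff)
  then show ?thesis by auto
qed

text \<open>The rows at all sample points determine the hit set, and by
  \<open>digital_line_moments\<close> two integers determine the rows. These are at most
  \<open>2 ^ (2 * n + 5)\<close> and \<open>2 ^ (3 * n + 7)\<close> in absolute value, whence the
  exponent \<open>5 * n + 16\<close>.\<close>

lemma
  shows finite_hit_types: "finite (hit_types n)"
    and card_hit_types: "card (hit_types n) \<le> 2 ^ (5 * n + 16)"
proof -
  \<comment> \<open>The last sample point is the right end of the last column.\<close>
  define N where "N = 4 * 2 ^ n + (1::nat)"
  define m where "m = (\<lambda>(s, t). (\<Sum>q<N. row s t n q, \<Sum>q<N. int q * row s t n q))"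
  define R where "R H = (SOME l. l \<in> lines \<and> (\<lambda>(s, t). hit s t n) l = H)" for H
  have R: "R H \<in> lines \<and> (\<lambda>(s, t). hit s t n) (R H) = H" if "H \<in> hit_types n" for H
  proof -
    have "\<exists>l. l \<in> lines \<and> (\<lambda>(s, t). hit s t n) l = H" using that unfolding hit_types_def image_def by fastforce
    then show ?thesis unfolding R_def by (rule someI_ex)
  qed
  have eq: "hit s t n = hit s' t' n" if "m (s, t) = m (s', t')" for s t s' t'
  proof -
    have m1: "(\<Sum>q<N. row s t n q) = (\<Sum>q<N. row s' t' n q)"
      "(\<Sum>q<N. int q * row s t n q) = (\<Sum>q<N. int q * row s' t' n q)"
      using that unfolding m_def by simp_all
    have "row s t n q = row s' t' n q" if "q < N" for q
      unfolding row_def by (rule digital_line_moments[OF m1[unfolded row_def] that])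
    moreover have "4 * i + q < N \<and> 4 * i + q + 1 < N" if "i < 2 ^ n" "q < 4" for i q
    proof -
      have "i + 1 \<le> 2 ^ n" using that by simp
      then show ?thesis unfolding N_def using that by linarith
    qed
    ultimately have "i < 2 ^ n \<Longrightarrow> q < 4 \<Longrightarrow> row s t n (4 * i + q) = row s' t' n (4 * i + q) \<and>
        row s t n (4 * i + q + 1) = row s' t' n (4 * i + q + 1)" for i q by blast
    then show ?thesis unfolding hit_def by auto
  qed
  have inj: "inj_on (m \<circ> R) (hit_types n)"
  proof (rule inj_onI)
    fix H H' assume H: "H \<in> hit_types n" "H' \<in> hit_types n" "(m \<circ> R) H = (m \<circ> R) H'"
    obtain s t s' t' where RH: "R H = (s, t)" "R H' = (s', t')" by fastforce
    then have "m (s, t) = m (s', t')" using H(3) by simp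
    then have "hit s t n = hit s' t' n" by (rule eq)
    then show "H = H'" using R[OF H(1)] R[OF H(2)] RH by simp
  qed
  define B where "B = {-(2 ^ (2*n+5))..2 ^ (2*n+5)::int} \<times> {-(2 ^ (3*n+7))..2 ^ (3*n+7)::int}"
  have N: "int N \<le> 2 ^ (n + 3)"
  proof -
    have "(1::int) \<le> 2 ^ n" by simp
    then have "4 * 2 ^ n + 1 \<le> (8::int) * 2 ^ n" by linarith
    then show ?thesis unfolding N_def by (simp add: power_add)
  qed
  have mB: "m l \<in> B" if l: "l \<in> lines" for l
  proof -
    obtain s t where [simp]: "l = (s, t)" by (cases l)
    have r: "\<bar>row s t n q\<bar> \<le> 2 ^ (n + 2)" if "q < N" for q
      using row_bound[of s t q n] that l by (auto simp: N_def)
    have "\<bar>\<Sum>q<N. row s t n q\<bar> \<le> (\<Sum>q<N. 2 ^ (n + 2))"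
      using r by (intro order_trans[OF sum_abs] sum_mono) auto
    also have "\<dots> = int N * 2 ^ (n + 2)" by simp
    also have "\<dots> \<le> 2 ^ (n + 3) * 2 ^ (n + 2)" using N by (intro mult_right_mono) auto
    also have "\<dots> = 2 ^ (2 * n + 5)" by (simp only: power_add[symmetric]) (rule arg_cong[of _ _ "(^) 2"], simp)
    finally have 1: "\<bar>\<Sum>q<N. row s t n q\<bar> \<le> 2 ^ (2 * n + 5)" .
    have "\<bar>\<Sum>q<N. int q * row s t n q\<bar> \<le> (\<Sum>q<N. 2 ^ (n + 2) * 2 ^ (n + 2))"
    proof (intro order_trans[OF sum_abs] sum_mono)
      fix q assume q: "q \<in> {..<N}"
      then have "q \<le> 4 * 2 ^ n" by (auto simp: N_def)
      then have "int q \<le> int (4 * 2 ^ n)" by (simp only: of_nat_le_iff)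
      then have "int q \<le> 2 ^ (n + 2)" by (simp add: power_add)
      then show "\<bar>int q * row s t n q\<bar> \<le> 2 ^ (n + 2) * 2 ^ (n + 2)"
        unfolding abs_mult using r q by (intro mult_mono) auto
    qed
    also have "\<dots> = int N * (2 ^ (n + 2) * 2 ^ (n + 2))" by simp
    also have "\<dots> \<le> 2 ^ (n + 3) * (2 ^ (n + 2) * 2 ^ (n + 2))" using N by (intro mult_right_mono) auto
    also have "\<dots> = 2 ^ (3 * n + 7)" by (simp only: power_add[symmetric]) (rule arg_cong[of _ _ "(^) 2"], simp)
    finally have 2: "\<bar>\<Sum>q<N. int q * row s t n q\<bar> \<le> 2 ^ (3 * n + 7)" .
    show ?thesis using 1 2 by (auto simp: m_def B_def)
  qed
  have sub: "(m \<circ> R) ` hit_types n \<subseteq> B" using R mB by (intro image_subsetI) (simp add: comp_def del: split_paired_all)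
  have fB: "finite B" unfolding B_def by simp
  show "finite (hit_types n)" using finite_imageD[OF finite_subset[OF sub fB] inj] .
  have "card (hit_types n) = card ((m \<circ> R) ` hit_types n)" by (rule card_image[OF inj, symmetric])
  also have "\<dots> \<le> card B" by (rule card_mono[OF fB sub])
  also have "\<dots> \<le> 2 ^ (2 * n + 7) * 2 ^ (3 * n + 9)"
  proof -
    have A: "nat (2 * 2 ^ k + 1) \<le> 2 ^ l" if "l = k + 2" for k l :: nat
    proof -
      have "(1::int) \<le> 2 ^ k" by simp
      then have "2 * 2 ^ k + 1 \<le> (4::int) * 2 ^ k" by linarith
      then have "2 * 2 ^ k + 1 \<le> (2::int) ^ (k + 2)" by (simp add: power_add)
      then show ?thesis unfolding that by (simp add: nat_le_iff)
    qed
    show ?thesis unfolding B_def card_cartesian_product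
      using A[of "2*n+7" "2*n+5"] A[of "3*n+9" "3*n+7"] by (intro mult_mono) simp_all
  qed
  also have "\<dots> = 2 ^ (5 * n + 16)" by (simp only: power_add[symmetric]) (rule arg_cong[of _ _ "(^) 2"], simp)
  finally show "card (hit_types n) \<le> 2 ^ (5 * n + 16)" .
qed

section \<open>Descendants crossed by a line\<close>

text \<open>The three values are monotone with total variation at most 1/2, so at most one integer
  is crossed. This is where slopes at most 1 and four parts per column fit together.\<close>

lemma floor_three_adjacent:
  fixes A \<sigma> :: real
  assumes "\<bar>\<sigma>\<bar> \<le> 1 / 4"
  shows "\<lfloor>A\<rfloor> = \<lfloor>A + \<sigma>\<rfloor> \<or> \<lfloor>A + \<sigma>\<rfloor> = \<lfloor>A + 2 * \<sigma>\<rfloor>"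
  using assms by linarith

lemma affine_between:
  fixes c d :: real
  assumes "x \<le> y" "y \<le> z" "lo \<le> c * x + d" "lo \<le> c * z + d" "c * x + d < hi" "c * z + d < hi"
  shows "lo \<le> c * y + d \<and> c * y + d < hi"
proof (cases "c \<ge> 0")
  case True
  then have "c * x \<le> c * y" "c * y \<le> c * z" using assms by (auto intro: mult_left_mono)
  then show ?thesis using assms by linarith
next
  case False
  then have "c * y \<le> c * x" "c * z \<le> c * y" using assms by (auto intro: mult_left_mono_neg)
  then show ?thesis using assms by linarith
qed

text \<open>The quarter column over which the line stays in the square consists of
  \<open>2 ^ (r - 2)\<close> columns of level \<open>n + r\<close>. In each of them two adjacent
  sample points lie in the same fine row by \<open>floor_three_adjacent\<close>, so each contains a
  hit descendant.\<close>

lemma hit_descendants: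
  assumes "(i, j) \<in> hit s t n" "\<bar>s\<bar> \<le> 1" "2 \<le> r"
  shows "2 ^ (r - 2) \<le> card {(a, b). a < 2 ^ r \<and> b < 2 ^ r \<and> (i * 2 ^ r + a, j * 2 ^ r + b) \<in> hit s t (n + r)}"
    (is "_ \<le> card ?D")
proof -
  obtain q where q: "q < 4" "row s t n (4 * i + q) = int j" "row s t n (4 * i + q + 1) = int j"
    and ij: "i < 2 ^ n" "j < 2 ^ n"
    using assms(1) unfolding hit_def by auto
  define m where "m = r - 2"
  have r: "r = m + 2" using assms(3) m_def by simp
  have ex: "\<exists>b. (q * 2 ^ m + c, b) \<in> ?D" if c: "c < 2 ^ m" for c
  proof -
    define a where "a = q * 2 ^ m + c"
    define x where "x k = s / 4 * real (4 * (i * 2 ^ r + a) + k) + 2 ^ (n + r) * t" for k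
    have a: "a < 2 ^ r"
    proof -
      have "a < (q + 1) * 2 ^ m" using c by (simp add: a_def)
      also have "\<dots> \<le> 4 * 2 ^ m" using q by (intro mult_right_mono) auto
      finally show ?thesis by (simp add: r power_add)
    qed
    have x: "real j * 2 ^ r \<le> x k \<and> x k < (real j + 1) * 2 ^ r" if "k \<le> 4" for k
    proof -
      \<comment> \<open>The fine sample point in units of quarter columns of level \<open>n\<close>.
        It lies between \<open>4 * i + q\<close> and \<open>4 * i + q + 1\<close>, where the line is
        known to be in row \<open>j\<close>.\<close>
      define z where "z = real (4 * (i * 2 ^ r + a) + k) / 2 ^ r"
      have z: "z = 4 * real i + real q + (real c + real k / 4) / 2 ^ m"
        by (simp add: z_def a_def r power_add field_simps)
      have "real c + 1 \<le> 2 ^ m" using c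
        by (metis Suc_leI of_nat_Suc of_nat_le_iff of_nat_numeral of_nat_power add.commute)
      then have "real c + real k / 4 \<le> 2 ^ m" using that by simp
      then have z1: "z \<le> real (4 * i + q + 1)" unfolding z by (simp add: field_simps)
      have z0: "real (4 * i + q) \<le> z" unfolding z by simp
      have "real j \<le> s / 4 * z + 2 ^ n * t \<and> s / 4 * z + 2 ^ n * t < real j + 1"
      proof (rule affine_between[OF z0 z1])
        show "real j \<le> s / 4 * real (4 * i + q) + 2 ^ n * t" "s / 4 * real (4 * i + q) + 2 ^ n * t < real j + 1"
          using q(2) unfolding row_def by linarith+
        show "real j \<le> s / 4 * real (4 * i + q + 1) + 2 ^ n * t" "s / 4 * real (4 * i + q + 1) + 2 ^ n * t < real j + 1"
          using q(3) unfolding row_def by linarith+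
      qed
      moreover have "x k = (s / 4 * z + 2 ^ n * t) * 2 ^ r"
        by (simp add: x_def z_def power_add field_simps)
      ultimately show ?thesis by simp
    qed
    have x0: "\<lfloor>x k\<rfloor> = int (j * 2 ^ r + nat (\<lfloor>x k\<rfloor> - int (j * 2 ^ r))) \<and> nat (\<lfloor>x k\<rfloor> - int (j * 2 ^ r)) < 2 ^ r"
      if "k \<le> 4" for k
    proof -
      have "int (j * 2 ^ r) \<le> \<lfloor>x k\<rfloor>" using x[OF that] by (simp add: le_floor_iff)
      moreover have "\<lfloor>x k\<rfloor> < int (j * 2 ^ r) + 2 ^ r"
        using x[OF that] by (simp add: floor_less_iff algebra_simps)
      ultimately show ?thesis by (simp add: nat_less_iff)
    qed
    have "x 1 = x 0 + s / 4" "x 2 = x 0 + 2 * (s / 4)"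
      by (simp_all add: x_def algebra_simps)
    then have "\<lfloor>x 0\<rfloor> = \<lfloor>x 1\<rfloor> \<or> \<lfloor>x 1\<rfloor> = \<lfloor>x 2\<rfloor>"
      using floor_three_adjacent[of "s / 4" "x 0"] assms(2) by simp
    then have "\<exists>k<2. \<lfloor>x k\<rfloor> = \<lfloor>x (k + 1)\<rfloor>"
    proof
      assume "\<lfloor>x 0\<rfloor> = \<lfloor>x 1\<rfloor>" then show ?thesis by (intro exI[of _ 0]) simp
    next
      assume "\<lfloor>x 1\<rfloor> = \<lfloor>x 2\<rfloor>" then show ?thesis by (intro exI[of _ 1]) (simp add: numeral_2_eq_2)
    qed
    then obtain k where k: "k < 4" "\<lfloor>x k\<rfloor> = \<lfloor>x (k + 1)\<rfloor>" "k < 2"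
      by auto
    define b where "b = nat (\<lfloor>x k\<rfloor> - int (j * 2 ^ r))"
    have b: "\<lfloor>x k\<rfloor> = int (j * 2 ^ r + b)" "b < 2 ^ r" using x0[of k] k by (auto simp: b_def)
    have "i * 2 ^ r + a < 2 ^ (n + r)"
    proof -
      have "i * 2 ^ r + a < (i + 1) * 2 ^ r" using a by simp
      also have "\<dots> \<le> 2 ^ n * 2 ^ r" using ij by (intro mult_right_mono) auto
      finally show ?thesis by (simp add: power_add)
    qed
    moreover have "j * 2 ^ r + b < 2 ^ (n + r)"
    proof -
      have "j * 2 ^ r + b < (j + 1) * 2 ^ r" using b by simp
      also have "\<dots> \<le> 2 ^ n * 2 ^ r" using ij by (intro mult_right_mono) auto
      finally show ?thesis by (simp add: power_add)
    qed
    moreover have "row s t (n + r) (4 * (i * 2 ^ r + a) + k') = \<lfloor>x k'\<rfloor>" for k'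
      by (simp add: row_def x_def)
    moreover from this[of k] this[of "k + 1"]
    have "row s t (n + r) (4 * (i * 2 ^ r + a) + k) = int (j * 2 ^ r + b)"
      "row s t (n + r) (4 * (i * 2 ^ r + a) + k + 1) = int (j * 2 ^ r + b)"
      using b(1) k(2) by (simp_all only: add.assoc)
    ultimately have "(i * 2 ^ r + a, j * 2 ^ r + b) \<in> hit s t (n + r)"
      unfolding hit_def using k(1) by blast
    then show ?thesis using a b by (auto simp: a_def)
  qed
  have fin: "finite ?D" by (rule finite_subset[of _ "{..<2^r} \<times> {..<2^r}"]) auto
  \<comment> \<open>Different \<open>c\<close> give different columns, so projecting to columns
    bounds the number of descendants from below.\<close>
  have "2 ^ (r - 2) = card ((\<lambda>c. q * 2 ^ m + c) ` {..<2 ^ m})"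
    by (subst card_image) (auto simp: m_def inj_on_def)
  also have "\<dots> \<le> card (fst ` ?D)"
    using ex fin by (intro card_mono) (force intro: rev_image_eqI)+
  also have "\<dots> \<le> card ?D" by (rule card_image_le[OF fin])
  finally show ?thesis .
qed


section \<open>The percolation tree\<close>

text \<open>
  The square of level \<open>n\<close> in column \<open>i\<close> and row \<open>j\<close> is addressed by \<open>(n, i, j)\<close>. The coins below
  \<open>(k, i, j)\<close> form the configuration \<open>sh k i j \<omega>\<close>, and \<open>sw\<close> exchanges columns and rows.
\<close>

definition idx :: "(nat \<times> nat \<times> nat) set" where
  "idx = {(n, i, j). 1 \<le> n \<and> i < 2 ^ n \<and> j < 2 ^ n}"

type_synonym conf = "nat \<times> nat \<times> nat \<Rightarrow> bool"

text \<open>\<open>i div 2 ^ (n - m)\<close> is the column of the ancestor of level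
  \<open>m\<close>. The root has no coin, so \<open>m\<close> starts at 1.\<close>

definition ch_set :: "conf \<Rightarrow> nat \<Rightarrow> (nat \<times> nat) set" where
  "ch_set \<omega> n = {(i, j). i < 2 ^ n \<and> j < 2 ^ n \<and>
     (\<forall>m\<in>{1..n}. \<omega> (m, i div 2 ^ (n - m), j div 2 ^ (n - m)))}"

definition emb :: "nat \<Rightarrow> nat \<Rightarrow> nat \<Rightarrow> nat \<times> nat \<times> nat \<Rightarrow> nat \<times> nat \<times> nat" where
  "emb k i j = (\<lambda>(m, a, b). (k + m, i * 2 ^ m + a, j * 2 ^ m + b))"

definition sh :: "nat \<Rightarrow> nat \<Rightarrow> nat \<Rightarrow> conf \<Rightarrow> conf" where
  "sh k i j \<omega> = (\<lambda>x. \<omega> (emb k i j x))"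

definition flip :: "nat \<times> nat \<times> nat \<Rightarrow> nat \<times> nat \<times> nat" where
  "flip = (\<lambda>(m, a, b). (m, b, a))"

definition sw :: "conf \<Rightarrow> conf" where
  "sw \<omega> = (\<lambda>x. \<omega> (flip x))"

definition lev :: "nat \<Rightarrow> (nat \<times> nat \<times> nat) set" where
  "lev k = {(m, i, j) \<in> idx. m \<le> k}"

text \<open>As \<open>idx\<close> starts at level 1, the coin of the square \<open>(k, i, j)\<close>
  itself is left out; hence \<open>sub k i j\<close> is disjoint from \<open>lev k\<close>.\<close>

definition sub :: "nat \<Rightarrow> nat \<Rightarrow> nat \<Rightarrow> (nat \<times> nat \<times> nat) set" where
  "sub k i j = emb k i j ` idx"

lemma sw_sw [simp]: "sw (sw \<omega>) = \<omega>"
  by (auto simp: sw_def flip_def)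

lemma sw_sh: "sw (sh k i j \<omega>) = sh k j i (sw \<omega>)"
  by (auto simp: sw_def sh_def emb_def flip_def)

lemma ch_set_sw: "(i, j) \<in> ch_set (sw \<omega>) n \<longleftrightarrow> (j, i) \<in> ch_set \<omega> n"
  by (auto simp: ch_set_def sw_def flip_def)

lemma ch_set_subset: "ch_set \<omega> n \<subseteq> {..<2 ^ n} \<times> {..<2 ^ n}"
  by (auto simp: ch_set_def)

lemma finite_ch_set [simp]: "finite (ch_set \<omega> n)"
  by (rule finite_subset[OF ch_set_subset]) auto

lemma ch_set_0: "ch_set \<omega> 0 = {(0, 0)}"
  by (auto simp: ch_set_def)

lemma pow_less:
  assumes "i < 2 ^ k" "a < 2 ^ m" shows "i * 2 ^ m + a < (2::nat) ^ (k + m)"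
proof -
  have "i * 2 ^ m + a < (i + 1) * 2 ^ m" using assms by simp
  also have "\<dots> \<le> 2 ^ k * 2 ^ m" using assms by (intro mult_right_mono) auto
  finally show ?thesis by (simp add: power_add)
qed

text \<open>The branching property: ancestors of level at most \<open>k\<close> are ancestors of
  \<open>(i, j)\<close> or this square itself, and all deeper ones lie in its subtree.\<close>

lemma ch_set_sh:
  assumes a: "a < 2 ^ m" and b: "b < 2 ^ m"
  shows "(i * 2 ^ m + a, j * 2 ^ m + b) \<in> ch_set \<omega> (k + m) \<longleftrightarrow>
    (i, j) \<in> ch_set \<omega> k \<and> (a, b) \<in> ch_set (sh k i j \<omega>) m"
proof -
  have d: "(i * 2 ^ m + a) div 2 ^ m = i" if "a < 2 ^ m" for i a :: nat
    using that by simp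
  have lt: "i * 2 ^ m + a < 2 ^ (k + m) \<longleftrightarrow> i < 2 ^ k" if "a < 2 ^ m" for i a :: nat
  proof
    assume "i * 2 ^ m + a < 2 ^ (k + m)"
    then have "i * 2 ^ m + a < 2 ^ k * 2 ^ m" by (simp only: power_add)
    then have "(i * 2 ^ m + a) div 2 ^ m < 2 ^ k" by (rule less_mult_imp_div_less)
    then show "i < 2 ^ k" using d[OF that] by simp
  qed (rule pow_less[OF _ that])
  have 1: "(i * 2 ^ m + a) div 2 ^ (k + m - l) = i div 2 ^ (k - l)" if "l \<le> k" "a < 2 ^ m" for l i a :: nat
  proof -
    have "k + m - l = m + (k - l)" using that by simp
    then show ?thesis using d[OF that(2)] by (simp add: power_add div_mult2_eq)
  qed
  have 2: "(i * 2 ^ m + a) div 2 ^ (m - l) = i * 2 ^ l + a div 2 ^ (m - l)" if "l \<le> m" for l i a :: nat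
  proof -
    have "(2::nat) ^ m = 2 ^ l * 2 ^ (m - l)" using that by (simp flip: power_add)
    then have "i * 2 ^ m + a = a + (i * 2 ^ l) * 2 ^ (m - l)" by (metis add.commute mult.assoc)
    then show ?thesis
      by (metis div_mult_self1 power_not_zero zero_neq_numeral)
  qed
  have split: "{1..k + m} = {1..k} \<union> (\<lambda>l. k + l) ` {1..m}"
    by (auto simp: image_iff)
  show ?thesis
    unfolding ch_set_def mem_Collect_eq prod.case split ball_Un Set.ball_simps lt[OF a] lt[OF b]
    using a b by (auto simp: 1 2 sh_def emb_def)
qed

lemma ch_set_ancestor:
  assumes "(a, b) \<in> ch_set \<omega> (k + m)"
  shows "(a div 2 ^ m, b div 2 ^ m) \<in> ch_set \<omega> k"
  using ch_set_sh[of "a mod 2 ^ m" m "b mod 2 ^ m" "a div 2 ^ m" "b div 2 ^ m" \<omega> k] assms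
  unfolding div_mult_mod_eq by simp

lemma finite_lev [simp]: "finite (lev k)"
proof (rule finite_subset)
  have "(i::nat) < 2 ^ k" if "i < 2 ^ m" "m \<le> k" for i m
    using that power_increasing[of m k "2::nat"] by linarith
  then show "lev k \<subseteq> {..k} \<times> {..<2 ^ k} \<times> {..<2 ^ k}" by (auto simp: lev_def idx_def)
qed auto

lemma lev_subset: "lev k \<subseteq> idx"
  by (auto simp: lev_def)

lemma emb_inj: "inj (emb k i j)"
  by (auto simp: emb_def inj_def)

lemma sub_subset: "i < 2 ^ k \<Longrightarrow> j < 2 ^ k \<Longrightarrow> sub k i j \<subseteq> idx - lev k"
  using pow_less by (auto simp: sub_def emb_def idx_def lev_def)

lemma emb_into: "i < 2 ^ k \<Longrightarrow> j < 2 ^ k \<Longrightarrow> emb k i j ` idx \<subseteq> idx"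
  using sub_subset[of i k j] unfolding sub_def by blast

lemma sub_disjoint:
  assumes "sub k i j \<inter> sub k i' j' \<noteq> {}" shows "i = i' \<and> j = j'"
proof -
  obtain m a b a' b' where *: "a < 2 ^ m" "b < 2 ^ m" "a' < 2 ^ m" "b' < 2 ^ m"
    and **: "i * 2 ^ m + a = i' * 2 ^ m + a'" "j * 2 ^ m + b = j' * 2 ^ m + b'"
    using assms by (auto simp: sub_def emb_def idx_def)
  have "(i * 2 ^ m + a) div 2 ^ m = (i' * 2 ^ m + a') div 2 ^ m" using **(1) by simp
  moreover have "(j * 2 ^ m + b) div 2 ^ m = (j' * 2 ^ m + b') div 2 ^ m" using **(2) by simp
  ultimately show ?thesis using * by simp
qed

lemma depends_sh:
  assumes "depends_on idx A" shows "depends_on (sub k i j) (\<lambda>\<omega>. A (sh k i j \<omega>))"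
  by (rule depends_onI, rule depends_onD[OF assms]) (auto simp: sh_def sub_def)

lemma depends_ch_set: "depends_on (lev k) (\<lambda>\<omega>. ch_set \<omega> k)"
proof (rule depends_onI)
  fix \<omega> \<omega>' :: conf assume *: "\<And>x. x \<in> lev k \<Longrightarrow> \<omega> x = \<omega>' x"
  have "\<omega> (m, i div 2 ^ (k - m), j div 2 ^ (k - m)) = \<omega>' (m, i div 2 ^ (k - m), j div 2 ^ (k - m))"
    if "i < 2 ^ k" "j < 2 ^ k" "1 \<le> m" "m \<le> k" for i j m
  proof (rule *)
    have "i div 2 ^ (k - m) < 2 ^ m" "j div 2 ^ (k - m) < 2 ^ m"
      using that by (auto intro!: less_mult_imp_div_less simp flip: power_add)
    then show "(m, i div 2 ^ (k - m), j div 2 ^ (k - m)) \<in> lev k"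
      using that by (auto simp: lev_def idx_def)
  qed
  then show "ch_set \<omega> k = ch_set \<omega>' k" unfolding ch_set_def by auto
qed

lemma lev_mono: "k \<le> l \<Longrightarrow> lev k \<subseteq> lev l"
  by (auto simp: lev_def)

lemma depends_ch_set': "k \<le> l \<Longrightarrow> depends_on (lev l) (\<lambda>\<omega>. ch_set \<omega> k)"
  using depends_on_mono[OF depends_ch_set lev_mono] .

lemma depends_ch_set_idx: "depends_on idx (\<lambda>\<omega>. ch_set \<omega> k)"
  using depends_on_mono[OF depends_ch_set lev_subset] .

lemma flip_image: "flip ` idx \<subseteq> idx" "inj flip" "flip ` lev k = lev k"
  by (auto simp: flip_def idx_def inj_def lev_def image_iff)

lemma depends_sw: "depends_on J A \<Longrightarrow> flip ` J \<subseteq> J \<Longrightarrow> depends_on J (\<lambda>\<omega>. A (sw \<omega>))"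
proof (rule depends_onI)
  fix \<omega> \<omega>' :: conf assume "depends_on J A" and J: "flip ` J \<subseteq> J" and *: "\<And>x. x \<in> J \<Longrightarrow> \<omega> x = \<omega>' x"
  then show "A (sw \<omega>) = A (sw \<omega>')"
    by (intro depends_onD[of J A]) (simp_all only: sw_def image_subset_iff *)
qed

locale percolation_tree =
  fixes p :: real
  assumes p: "1 / 2 < p" "p < 1"

sublocale percolation_tree \<subseteq> coins idx p
  using p by unfold_locales auto

context percolation_tree
begin

lemma pred_ch_set: "Measurable.pred M (\<lambda>\<omega>. Q (ch_set \<omega> k))"
  by (rule pred_finite_dep[OF depends_on_comp[OF depends_ch_set] finite_lev lev_subset])

lemma
  assumes A: "depends_on idx A" "Measurable.pred M A" and ij: "i < 2 ^ k" "j < 2 ^ k"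
  shows pred_sh: "Measurable.pred M (\<lambda>\<omega>. A (sh k i j \<omega>))"
    and prob_sh: "prob {\<omega> \<in> space M. A (sh k i j \<omega>)} = prob {\<omega> \<in> space M. A \<omega>}"
    and AE_sh: "(AE \<omega> in M. A \<omega>) \<Longrightarrow> (AE \<omega> in M. A (sh k i j \<omega>))"
  unfolding sh_def
  by (rule pred_reindex prob_reindex AE_reindex;
      use A emb_into[OF ij] inj_on_subset[OF emb_inj] in auto)+

lemma
  assumes A: "depends_on idx A" "Measurable.pred M A"
  shows pred_sw: "Measurable.pred M (\<lambda>\<omega>. A (sw \<omega>))"
    and prob_sw: "prob {\<omega> \<in> space M. A (sw \<omega>)} = prob {\<omega> \<in> space M. A \<omega>}"
    and AE_sw: "(AE \<omega> in M. A \<omega>) \<Longrightarrow> (AE \<omega> in M. A (sw \<omega>))"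
  unfolding sw_def
  by (rule pred_reindex prob_reindex AE_reindex;
      use A flip_image inj_on_subset[OF flip_image(2)] in auto)+

section \<open>Growth of the number of chosen squares on a line\<close>

lemma prob_ch_set:
  assumes "a < 2 ^ r" "b < 2 ^ r"
  shows "prob {\<omega> \<in> space M. (a, b) \<in> ch_set \<omega> r} = p ^ r"
proof -
  define J where "J = (\<lambda>m. (m, a div 2 ^ (r - m), b div 2 ^ (r - m))) ` {1..r}"
  have "{\<omega> \<in> space M. (a, b) \<in> ch_set \<omega> r} = {\<omega> \<in> space M. \<forall>x\<in>J. \<omega> x}"
    using assms by (auto simp: ch_set_def J_def)
  moreover have "J \<subseteq> idx"
    using assms by (auto simp: J_def idx_def intro!: less_mult_imp_div_less simp flip: power_add)
  moreover have "card J = r"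
    unfolding J_def by (subst card_image) (auto simp: inj_on_def)
  moreover have "finite J" unfolding J_def by simp
  ultimately show ?thesis using prob_all_True[of J] by simp
qed

lemma expectation_card_ch_set:
  assumes "D \<subseteq> {..<2 ^ r} \<times> {..<2 ^ r}"
  shows "expectation (\<lambda>\<omega>. real (card (D \<inter> ch_set \<omega> r))) = real (card D) * p ^ r"
proof -
  have fin: "finite D" by (rule finite_subset[OF assms]) auto
  have m: "{\<omega> \<in> space M. d \<in> ch_set \<omega> r} \<in> events" for d
    using pred_ch_set[of "\<lambda>S. d \<in> S" r] by (simp add: pred_def)
  have "real (card (D \<inter> ch_set \<omega> r)) = (\<Sum>d\<in>D. indicator {\<omega> \<in> space M. d \<in> ch_set \<omega> r} \<omega>)"
    if "\<omega> \<in> space M" for \<omega>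
  proof -
    have "(\<Sum>d\<in>D. indicator {\<omega> \<in> space M. d \<in> ch_set \<omega> r} \<omega>) = (\<Sum>d\<in>D. if d \<in> ch_set \<omega> r then 1 else 0 :: real)"
      using that by (intro sum.cong) (auto simp: indicator_def)
    also have "\<dots> = real (card (D \<inter> ch_set \<omega> r))"
      using fin by (simp add: sum.If_cases)
    finally show ?thesis by simp
  qed
  then have "expectation (\<lambda>\<omega>. real (card (D \<inter> ch_set \<omega> r))) =
      expectation (\<lambda>\<omega>. \<Sum>d\<in>D. indicator {\<omega> \<in> space M. d \<in> ch_set \<omega> r} \<omega>)"
    by (intro Bochner_Integration.integral_cong) auto
  also have "\<dots> = (\<Sum>d\<in>D. prob {\<omega> \<in> space M. d \<in> ch_set \<omega> r})"
    using m by (subst Bochner_Integration.integral_sum) (auto simp: emeasure_eq_measure intro!: sum.cong)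
  also have "\<dots> = (\<Sum>d\<in>D. p ^ r)"
    using assms by (intro sum.cong refl) (auto intro!: prob_ch_set)
  finally show ?thesis by simp
qed

text \<open>The variables \<open>Y t\<close> live on disjoint subtrees, take values in
  \<open>[0, 4 ^ r]\<close> and have mean at least \<open>(2 * p) ^ r / 4 \<ge> 4\<close>. Falling
  below \<open>2 * card T\<close> is therefore a deviation of at least \<open>2 * card T\<close>
  from the mean, and Hoeffding's exponent is
  \<open>2 * (2 * card T)^2 / (card T * 16 ^ r)\<close>.\<close>

lemma growth_fixed:
  fixes Y :: "nat \<times> nat \<Rightarrow> conf \<Rightarrow> real"
  assumes r: "2 \<le> r" "16 \<le> (2 * p) ^ r"
    and T: "T \<subseteq> {..<2 ^ k} \<times> {..<2 ^ k}"
    and D: "\<And>i j. (i, j) \<in> T \<Longrightarrow> D (i, j) \<subseteq> {..<2 ^ r} \<times> {..<2 ^ r}"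
      "\<And>i j. (i, j) \<in> T \<Longrightarrow> 2 ^ (r - 2) \<le> card (D (i, j))"
  defines "Y \<equiv> \<lambda>t \<omega>. real (card (D t \<inter> ch_set (sh k (fst t) (snd t) \<omega>) r))"
  shows "prob {\<omega> \<in> space M. (\<Sum>t\<in>T. Y t \<omega>) < 2 * card T} \<le> exp (- 8 * real (card T) / 16 ^ r)"
proof (cases "T = {}")
  case True
  then show ?thesis by simp
next
  case False
  have finT: "finite T" by (rule finite_subset[OF T]) auto
  have dep: "depends_on idx (\<lambda>\<omega>. Q (ch_set \<omega> r))" for Q :: "(nat \<times> nat) set \<Rightarrow> real"
    by (rule depends_on_comp[OF depends_ch_set_idx])
  have depY: "depends_on (sub k i j) (Y (i, j))" for i j
    unfolding Y_def fst_conv snd_conv by (rule depends_sh[OF dep])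
  have Ym: "Y t \<in> borel_measurable M" if "t \<in> T" for t
  proof -
    obtain i j where t: "t = (i, j)" "i < 2 ^ k" "j < 2 ^ k" using subsetD[OF T \<open>t \<in> T\<close>] by auto
    have "Measurable.pred M (\<lambda>\<omega>. c < Y t \<omega>)" for c
      unfolding t Y_def fst_conv snd_conv
      by (rule pred_sh[OF _ _ t(2,3), where A="\<lambda>\<omega>. c < real (card (D (i, j) \<inter> ch_set \<omega> r))"])
        (auto intro!: pred_ch_set depends_on_comp[OF depends_ch_set_idx])
    then show ?thesis by (intro borel_measurableI_greater) (simp add: pred_def)
  qed
  have EY: "4 \<le> expectation (Y t)" if t: "t \<in> T" for t
  proof -
    obtain i j where ij: "t = (i, j)" "i < 2 ^ k" "j < 2 ^ k" using subsetD[OF T t] by auto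
    let ?g = "\<lambda>\<omega>. real (card (D (i, j) \<inter> ch_set \<omega> r))"
    have "expectation (Y t) = expectation ?g"
    proof -
      have fin: "integrable M g" if "g \<in> borel_measurable M" "\<And>\<omega>. \<bar>g \<omega>\<bar> \<le> real (card (D (i, j)))" for g
        using that by (intro integrable_const_bound[where B="real (card (D (i, j)))"]) auto
      have bd: "card (D (i, j) \<inter> S) \<le> card (D (i, j))" for S
        using D(1)[of i j] t ij by (intro card_mono) (auto intro: finite_subset)
      have g_m: "?g \<in> borel_measurable M"
        by (intro borel_measurableI_greater) (use pred_ch_set in \<open>simp add: pred_def\<close>)
      have fl: "(\<lambda>\<omega>. \<lambda>n\<in>idx. \<omega> (emb k i j n)) \<in> M \<rightarrow>\<^sub>M M"
        unfolding M_def using emb_into[OF ij(2,3)]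
        by (intro measurable_restrict measurable_component_singleton) auto
      \<comment> \<open>\<open>prob_sh\<close> treats events only; for the expectation, invariance
        of \<open>M\<close> under the embedding of the subtree is used directly.\<close>
      have d: "distr M M (\<lambda>\<omega>. \<lambda>n\<in>idx. \<omega> (emb k i j n)) = M"
        unfolding M_def using emb_into[OF ij(2,3)] inj_on_subset[OF emb_inj]
        by (intro distr_PiM_reindex[of idx "\<lambda>_. coin" "emb k i j" idx] measure_pmf.prob_space_axioms) auto
      have eq: "?g (\<lambda>n\<in>idx. \<omega> (emb k i j n)) = Y t \<omega>" for \<omega>
        unfolding Y_def ij fst_conv snd_conv
        by (rule depends_onD[OF dep]) (auto simp: sh_def)
      have "expectation ?g = integral\<^sup>L (distr M M (\<lambda>\<omega>. \<lambda>n\<in>idx. \<omega> (emb k i j n))) ?g"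
        by (simp only: d)
      also have "\<dots> = expectation (\<lambda>\<omega>. ?g (\<lambda>n\<in>idx. \<omega> (emb k i j n)))"
        by (rule integral_distr[OF fl g_m])
      finally show ?thesis unfolding eq by simp
    qed
    also have "\<dots> = real (card (D (i, j))) * p ^ r"
      using D(1)[of i j] t ij by (intro expectation_card_ch_set) auto
    also have "\<dots> \<ge> 2 ^ (r - 2) * p ^ r"
      using D(2)[of i j] t ij p by (intro mult_right_mono) (auto simp flip: of_nat_le_iff)
    also have "2 ^ (r - 2) * p ^ r = (2 * p) ^ r / 4"
      using r(1) by (simp add: power_mult_distrib power_diff)
    finally show ?thesis using r by simp
  qed
  have Yb: "Y t \<omega> \<in> {0..4 ^ r}" if "t \<in> T" for t \<omega>
  proof -
    obtain i j where t: "t = (i, j)" by (cases t)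
    have "card (D (i, j) \<inter> ch_set (sh k i j \<omega>) r) \<le> card ({..<2 ^ r} \<times> {..<2 ^ r} :: (nat \<times> nat) set)"
      using D(1)[of i j] that t by (intro card_mono) auto
    also have "\<dots> = 4 ^ r" by (simp flip: power_mult_distrib)
    finally have "real (card (D (i, j) \<inter> ch_set (sh k i j \<omega>) r)) \<le> real (4 ^ r)" by (simp only: of_nat_le_iff)
    then show ?thesis by (simp add: Y_def t)
  qed
  have ind: "indep_vars (\<lambda>_. borel) Y T"
  proof (rule indep_vars_depends_on[where K="\<lambda>(i, j). sub k i j"])
    show "disjoint_family_on (\<lambda>(i, j). sub k i j) T"
      unfolding disjoint_family_on_def using sub_disjoint by fastforce
    show "\<And>t. t \<in> T \<Longrightarrow> (case t of (i, j) \<Rightarrow> sub k i j) \<subseteq> idx" using sub_subset T by fastforce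
  qed (use depY Ym in auto)
  interpret H: Hoeffding_ineq M T Y "\<lambda>_. 0" "\<lambda>_. 4 ^ r" "\<Sum>t\<in>T. expectation (Y t)"
    by unfold_locales (use finT ind Yb in auto)
  have cT: "card T > 0" using finT False by (simp add: card_gt_0_iff)
  have "(\<Sum>t\<in>T. 4) \<le> (\<Sum>t\<in>T. expectation (Y t))" using EY by (intro sum_mono) auto
  then have mu: "4 * real (card T) \<le> (\<Sum>t\<in>T. expectation (Y t))" by simp
  have [measurable]: "(\<lambda>\<omega>. \<Sum>t\<in>T. Y t \<omega>) \<in> borel_measurable M"
    using Ym by (intro borel_measurable_sum) auto
  have "prob {\<omega> \<in> space M. (\<Sum>t\<in>T. Y t \<omega>) < 2 * card T} \<le>
     prob {\<omega> \<in> space M. (\<Sum>t\<in>T. Y t \<omega>) \<le> (\<Sum>t\<in>T. expectation (Y t)) - 2 * card T}"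
    by (rule finite_measure_mono) (use mu in auto)
  also have "\<dots> \<le> exp (- 2 * (2 * real (card T))\<^sup>2 / (\<Sum>t\<in>T. (4 ^ r - 0)\<^sup>2))"
    using H.Hoeffding_ineq_le[of "2 * real (card T)"] cT by simp
  also have "(\<Sum>t\<in>T. (4 ^ r - 0)\<^sup>2) = real (card T) * 16 ^ r"
    by (simp add: power2_eq_square flip: power_mult_distrib)
  also have "- 2 * (2 * real (card T))\<^sup>2 / (real (card T) * 16 ^ r) = - 8 * real (card T) / 16 ^ r"
    using cT by (simp add: power2_eq_square field_simps)
  finally show ?thesis .
qed

text \<open>The coins up to level \<open>k\<close> fix the set \<open>T\<close> of chosen squares in
  \<open>H\<close>. Given \<open>T\<close>, the subtrees below it are fresh and
  \<open>growth_fixed\<close> applies; on \<open>F\<close> the set has at least \<open>L\<close>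
  elements.\<close>

lemma growth_conditional:
  assumes r: "2 \<le> r" "16 \<le> (2 * p) ^ r"
    and H: "H \<subseteq> {..<2 ^ k} \<times> {..<2 ^ k}"
    and H': "\<And>i j. (i, j) \<in> H \<Longrightarrow>
      2 ^ (r - 2) \<le> card {(a, b). a < 2 ^ r \<and> b < 2 ^ r \<and> (i * 2 ^ r + a, j * 2 ^ r + b) \<in> H'}"
    and fH': "finite H'"
    and F: "depends_on (lev k) F" "\<And>\<omega>. F \<omega> \<Longrightarrow> L \<le> card (H \<inter> ch_set \<omega> k)"
  shows "prob {\<omega> \<in> space M. F \<omega> \<and> card (H' \<inter> ch_set \<omega> (k + r)) < 2 * card (H \<inter> ch_set \<omega> k)}
    \<le> exp (- 8 * real L / 16 ^ r) * prob {\<omega> \<in> space M. F \<omega>}"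
proof -
  define D where "D = (\<lambda>(i, j). {(a, b). a < 2 ^ r \<and> b < 2 ^ r \<and> (i * 2 ^ r + a, j * 2 ^ r + b) \<in> H'})"
  define Y where "Y t \<omega> = card (D t \<inter> ch_set (sh k (fst t) (snd t) \<omega>) r)" for t \<omega>
  define A where "A T \<omega> \<longleftrightarrow> (\<Sum>t\<in>T. Y t \<omega>) < 2 * card T" for T \<omega>
  define \<T> where "\<T> = {T. T \<subseteq> H \<and> L \<le> card T}"
  have finH: "finite H" by (rule finite_subset[OF H]) auto
  have sumY: "(\<Sum>t\<in>H \<inter> ch_set \<omega> k. Y t \<omega>) \<le> card (H' \<inter> ch_set \<omega> (k + r))" for \<omega>
  proof -
    \<comment> \<open>\<open>C t\<close> consists of the chosen descendants of \<open>t\<close> in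
      \<open>H'\<close>. Distinct squares of one level have disjoint descendants, so summing over
      \<open>t\<close> counts nothing twice.\<close>
    define C where "C = (\<lambda>(i, j). (\<lambda>(a, b). (i * 2 ^ r + a, j * 2 ^ r + b)) ` (D (i, j) \<inter> ch_set (sh k i j \<omega>) r))"
    have cC: "card (C t) = Y t \<omega>" for t
      unfolding C_def Y_def by (cases t) (auto intro!: card_image simp: inj_on_def)
    have dis: "C t \<inter> C t' = {}" if "t \<noteq> t'" for t t'
    proof (rule ccontr)
      assume "C t \<inter> C t' \<noteq> {}"
      moreover obtain i j i' j' where t: "t = (i, j)" "t' = (i', j')" by (cases t; cases t')
      ultimately obtain a b a' b' where *: "a < 2 ^ r" "b < 2 ^ r" "a' < 2 ^ r" "b' < 2 ^ r"
        and **: "i * 2 ^ r + a = i' * 2 ^ r + a'" "j * 2 ^ r + b = j' * 2 ^ r + b'"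
        by (auto simp: C_def D_def)
      have "(i * 2 ^ r + a) div 2 ^ r = (i' * 2 ^ r + a') div 2 ^ r" using **(1) by simp
      moreover have "(j * 2 ^ r + b) div 2 ^ r = (j' * 2 ^ r + b') div 2 ^ r" using **(2) by simp
      ultimately show False using * that t by simp
    qed
    have "(\<Sum>t\<in>H \<inter> ch_set \<omega> k. Y t \<omega>) = card (\<Union>(C ` (H \<inter> ch_set \<omega> k)))"
      unfolding cC[symmetric] using finH dis
      by (subst card_UN_disjoint) (auto simp: C_def)
    also have "\<dots> \<le> card (H' \<inter> ch_set \<omega> (k + r))"
      using fH' by (intro card_mono) (auto simp: C_def D_def ch_set_sh)
    finally show ?thesis .
  qed
  have depA: "depends_on (idx - lev k) (A T)" if "T \<in> \<T>" for T
  proof -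
    have "depends_on (idx - lev k) (Y t)" if "t \<in> T" for t
    proof -
      obtain i j where t: "t = (i, j)" "i < 2 ^ k" "j < 2 ^ k" using \<open>t \<in> T\<close> \<open>T \<in> \<T>\<close> subsetD[OF H, of t] by (auto simp: \<T>_def)
      show ?thesis unfolding t Y_def fst_conv snd_conv
        by (rule depends_on_mono[OF depends_sh[where A="\<lambda>\<omega>. card (D (i, j) \<inter> ch_set \<omega> r)"] sub_subset[OF t(2,3)]])
          (rule depends_on_comp[OF depends_ch_set_idx])
    qed
    then have "depends_on (idx - lev k) (\<lambda>\<omega>. \<Sum>t\<in>T. Y t \<omega>)"
      unfolding depends_on_def by (auto intro!: sum.cong)
    then show ?thesis unfolding A_def by (rule depends_on_comp)
  qed
  have mY: "Measurable.pred M (\<lambda>\<omega>. Q (Y t \<omega>))" if "t \<in> H" for t Q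
  proof -
    obtain i j where t: "t = (i, j)" "i < 2 ^ k" "j < 2 ^ k" using subsetD[OF H \<open>t \<in> H\<close>] by auto
    show ?thesis unfolding t Y_def fst_conv snd_conv
      by (rule pred_sh[OF _ _ t(2,3), where A="\<lambda>\<omega>. Q (card (D (i, j) \<inter> ch_set \<omega> r))"])
        (auto intro!: pred_ch_set depends_on_comp[OF depends_ch_set_idx])
  qed
  have mA: "Measurable.pred M (A T)" if "T \<in> \<T>" for T
  proof -
    have "Y t \<in> M \<rightarrow>\<^sub>M count_space UNIV" if "t \<in> T" for t
    proof -
      have "t \<in> H" using that \<open>T \<in> \<T>\<close> by (auto simp: \<T>_def)
      then have "Y t -` {c} \<inter> space M \<in> events" for c
        using mY[of t "\<lambda>y. y = c"] by (simp add: pred_def vimage_def Int_def conj_commute)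
      then show ?thesis by (simp add: measurable_count_space_eq_countable)
    qed
    then show ?thesis unfolding A_def by measurable
  qed
  have bound: "prob {\<omega> \<in> space M. A T \<omega>} \<le> exp (- 8 * real L / 16 ^ r)" if "T \<in> \<T>" for T
  proof -
    have T: "T \<subseteq> H" "L \<le> card T" using that by (auto simp: \<T>_def)
    have "{\<omega> \<in> space M. A T \<omega>} =
      {\<omega> \<in> space M. (\<Sum>t\<in>T. real (card (D t \<inter> ch_set (sh k (fst t) (snd t) \<omega>) r))) < 2 * card T}"
      unfolding A_def Y_def by (auto simp flip: of_nat_sum)
    also have "prob \<dots> \<le> exp (- 8 * real (card T) / 16 ^ r)"
      by (rule growth_fixed[OF r]) (use T H H' in \<open>auto simp: D_def\<close>)
    also have "\<dots> \<le> exp (- 8 * real L / 16 ^ r)"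
      using T by (auto simp: divide_simps)
    finally show ?thesis .
  qed
  have X: "depends_on (lev k) (\<lambda>\<omega>. H \<inter> ch_set \<omega> k)"
    by (rule depends_on_comp[OF depends_ch_set])
  have le: "prob {\<omega> \<in> space M. F \<omega> \<and> A (H \<inter> ch_set \<omega> k) \<omega>} \<le> exp (- 8 * real L / 16 ^ r) * prob {\<omega> \<in> space M. F \<omega>}"
    by (rule prob_conditional_le[OF lev_subset finite_lev X F(1), of \<T>])
      (use depA mA bound F(2) finH in \<open>auto simp: \<T>_def\<close>)
  show ?thesis
  proof (rule order_trans[OF finite_measure_mono le])
    show "{\<omega> \<in> space M. F \<omega> \<and> card (H' \<inter> ch_set \<omega> (k + r)) < 2 * card (H \<inter> ch_set \<omega> k)}
      \<subseteq> {\<omega> \<in> space M. F \<omega> \<and> A (H \<inter> ch_set \<omega> k) \<omega>}"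
      using sumY unfolding A_def by (auto intro: le_less_trans)
    show "{\<omega> \<in> space M. F \<omega> \<and> A (H \<inter> ch_set \<omega> k) \<omega>} \<in> events"
      by (rule sets_conditional[OF lev_subset finite_lev X F(1), of \<T>])
        (use mA F(2) finH in \<open>auto simp: \<T>_def\<close>)
  qed
qed


section \<open>Good squares have positive probability\<close>

text \<open>Such an exponent exists because \<open>2 * p > 1\<close>. The value 16 makes the mean
  growth \<open>16 / 4 = 4\<close>, twice the factor 2 that is asked for.\<close>

definition r0 :: nat where
  "r0 = (SOME r. 2 \<le> r \<and> 16 \<le> (2 * p) ^ r)"

lemma r0: "2 \<le> r0" "16 \<le> (2 * p) ^ r0"
proof -
  obtain n where n: "16 < (2 * p) ^ n" using real_arch_pow[of "2 * p" 16] p by auto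
  have "(2 * p) ^ n \<le> (2 * p) ^ (n + 2)" using p by (intro power_increasing) auto
  then have "2 \<le> n + 2 \<and> 16 \<le> (2 * p) ^ (n + 2)" using n by linarith
  then have "2 \<le> r0 \<and> 16 \<le> (2 * p) ^ r0" unfolding r0_def by (rule someI)
  then show "2 \<le> r0" "16 \<le> (2 * p) ^ r0" by auto
qed

text \<open>\<open>m\<close> counts blocks of \<open>r0\<close> levels. Only lines with at least
  \<open>2 ^ m\<close> chosen hit squares are watched: so many independent subtrees make a failure
  to double doubly exponentially unlikely in \<open>m\<close>.\<close>

definition bad :: "nat \<Rightarrow> conf \<Rightarrow> bool" where
  "bad m \<omega> \<longleftrightarrow> (\<exists>(s, t)\<in>lines.
     2 ^ m \<le> card (hit s t (r0 * m) \<inter> ch_set \<omega> (r0 * m)) \<and>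
     card (hit s t (r0 * m + r0) \<inter> ch_set \<omega> (r0 * m + r0)) < 2 * card (hit s t (r0 * m) \<inter> ch_set \<omega> (r0 * m)))"

definition full :: "nat \<Rightarrow> conf \<Rightarrow> bool" where
  "full m \<omega> \<longleftrightarrow> (\<forall>x\<in>lev (r0 * m). \<omega> x)"

text \<open>The power of 2 bounds the number of pairs of hit types at the levels
  \<open>r0 * m\<close> and \<open>r0 * m + r0\<close>; the exponential is the Hoeffding bound for
  \<open>2 ^ m\<close> squares.\<close>

definition \<beta> :: "nat \<Rightarrow> real" where
  "\<beta> m = 2 ^ (10 * r0 * (m + 1) + 32) * exp (- 8 * 2 ^ m / 16 ^ r0)"

lemma depends_full: "m \<le> m' \<Longrightarrow> depends_on (lev (r0 * m')) (full m)"
  unfolding full_def by (intro depends_onI ball_cong refl) (use lev_mono[of "r0 * m" "r0 * m'"] in auto)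

lemma depends_bad: "depends_on (lev (r0 * m + r0)) (bad m)"
proof (rule depends_onI)
  fix \<omega> \<omega>' :: conf assume *: "\<And>x. x \<in> lev (r0 * m + r0) \<Longrightarrow> \<omega> x = \<omega>' x"
  have "ch_set \<omega> (r0 * m) = ch_set \<omega>' (r0 * m)" "ch_set \<omega> (r0 * m + r0) = ch_set \<omega>' (r0 * m + r0)"
    by (rule depends_onD[OF depends_ch_set' *]; simp)+
  then show "bad m \<omega> = bad m \<omega>'" unfolding bad_def by simp
qed

lemma pred_lev: "depends_on (lev k) A \<Longrightarrow> Measurable.pred M A"
  by (rule pred_finite_dep[OF _ finite_lev lev_subset])

lemma depends_lev_idx: "depends_on (lev k) A \<Longrightarrow> depends_on idx A"
  by (rule depends_on_mono[OF _ lev_subset])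

text \<open>The factor \<open>prob {\<omega> \<in> space M. full m0 \<omega>}\<close> on the right
  matters: in \<open>bprob_pos\<close> these errors are subtracted from that very probability, which
  may be tiny.\<close>

lemma prob_bad:
  assumes "m0 \<le> m"
  shows "prob {\<omega> \<in> space M. full m0 \<omega> \<and> bad m \<omega>} \<le> \<beta> m * prob {\<omega> \<in> space M. full m0 \<omega>}"
proof -
  define c :: real where "c = exp (- 8 * 2 ^ m / 16 ^ r0)"
  define k where "k = r0 * m"
  \<comment> \<open>\<open>bad m\<close> sees a line only through its hit sets at two levels, so
    uncountably many lines reduce to finitely many pairs.\<close>
  define P where "P = (\<lambda>(s, t). (hit s t k, hit s t (k + r0))) ` lines"
  define E where "E = (\<lambda>(H, H'). {\<omega> \<in> space M. (full m0 \<omega> \<and> 2 ^ m \<le> card (H \<inter> ch_set \<omega> k)) \<and>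
      card (H' \<inter> ch_set \<omega> (k + r0)) < 2 * card (H \<inter> ch_set \<omega> k)})"
  have P: "P \<subseteq> hit_types k \<times> hit_types (k + r0)"
    by (auto simp: P_def hit_types_def)
  then have finP: "finite P"
    by (rule finite_subset) (simp add: finite_hit_types)
  have "card P \<le> card (hit_types k) * card (hit_types (k + r0))"
    using card_mono[OF _ P] finite_hit_types by (simp add: card_cartesian_product)
  also have "\<dots> \<le> 2 ^ (5 * k + 16) * 2 ^ (5 * (k + r0) + 16)"
    by (intro mult_mono card_hit_types) auto
  also have "\<dots> \<le> 2 ^ (10 * r0 * (m + 1) + 32)"
    unfolding power_add[symmetric] k_def by (intro power_increasing) (auto simp: algebra_simps)
  finally have "real (card P) \<le> real (2 ^ (10 * r0 * (m + 1) + 32))"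
    by (simp only: of_nat_le_iff)
  then have cP: "real (card P) \<le> 2 ^ (10 * r0 * (m + 1) + 32)" by simp
  have dF: "depends_on (lev k) (\<lambda>\<omega>. full m0 \<omega> \<and> 2 ^ m \<le> card (H \<inter> ch_set \<omega> k))" for H
    using depends_on_comp2[OF depends_full[OF assms] depends_on_comp[OF depends_ch_set],
      of "(\<and>)" "\<lambda>S. 2 ^ m \<le> card (H \<inter> S)"] unfolding k_def by simp
  have E: "E x \<in> events \<and> prob (E x) \<le> c * prob {\<omega> \<in> space M. full m0 \<omega>}" if x: "x \<in> P" for x
  proof -
    obtain s t where st: "(s, t) \<in> lines" "x = (hit s t k, hit s t (k + r0))"
      using x by (auto simp: P_def)
    have s: "\<bar>s\<bar> \<le> 1" using st by (auto simp: lines_def)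
    have "depends_on (lev (k + r0)) (\<lambda>\<omega>. (full m0 \<omega> \<and> 2 ^ m \<le> card (H \<inter> ch_set \<omega> k)) \<and>
      card (H' \<inter> ch_set \<omega> (k + r0)) < 2 * card (H \<inter> ch_set \<omega> k))" for H H'
    proof (rule depends_onI)
      fix \<omega> \<omega>' :: conf assume *: "\<And>x. x \<in> lev (k + r0) \<Longrightarrow> \<omega> x = \<omega>' x"
      have "ch_set \<omega> k = ch_set \<omega>' k" "ch_set \<omega> (k + r0) = ch_set \<omega>' (k + r0)"
        by (rule depends_onD[OF depends_ch_set' *]; simp)+
      moreover have "full m0 \<omega> = full m0 \<omega>'"
        by (rule depends_onD[OF depends_full[OF assms] *]) (use lev_mono[of k "k + r0"] in \<open>auto simp: k_def\<close>)
      ultimately show "((full m0 \<omega> \<and> 2 ^ m \<le> card (H \<inter> ch_set \<omega> k)) \<and>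
          card (H' \<inter> ch_set \<omega> (k + r0)) < 2 * card (H \<inter> ch_set \<omega> k)) =
        ((full m0 \<omega>' \<and> 2 ^ m \<le> card (H \<inter> ch_set \<omega>' k)) \<and>
          card (H' \<inter> ch_set \<omega>' (k + r0)) < 2 * card (H \<inter> ch_set \<omega>' k))" by simp
    qed
    then have "E x \<in> events"
      unfolding E_def using pred_lev by (auto simp: pred_def split: prod.split)
    moreover have "prob (E x) \<le> exp (- 8 * real (2 ^ m) / 16 ^ r0) *
      prob {\<omega> \<in> space M. full m0 \<omega> \<and> 2 ^ m \<le> card (hit s t k \<inter> ch_set \<omega> k)}"
      unfolding E_def st(2) prod.case
    proof (rule growth_conditional[OF r0 hit_subset _ finite_hit dF])
      show "2 ^ (r0 - 2) \<le> card {(a, b). a < 2 ^ r0 \<and> b < 2 ^ r0 \<and> (i * 2 ^ r0 + a, j * 2 ^ r0 + b) \<in> hit s t (k + r0)}"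
        if "(i, j) \<in> hit s t k" for i j
        by (rule hit_descendants[OF that s r0(1)])
    qed auto
    moreover have "prob {\<omega> \<in> space M. full m0 \<omega> \<and> 2 ^ m \<le> card (hit s t k \<inter> ch_set \<omega> k)}
      \<le> prob {\<omega> \<in> space M. full m0 \<omega>}"
      using pred_lev[OF depends_full[OF assms]] by (intro finite_measure_mono) (auto simp: pred_def)
    ultimately show ?thesis unfolding c_def
      by (auto elim!: order_trans intro!: mult_left_mono)
  qed
  have "{\<omega> \<in> space M. full m0 \<omega> \<and> bad m \<omega>} = (\<Union>x\<in>P. E x)"
    by (auto simp: P_def E_def bad_def k_def)
  then have "prob {\<omega> \<in> space M. full m0 \<omega> \<and> bad m \<omega>} \<le> (\<Sum>x\<in>P. prob (E x))"
    using E finP by (auto intro!: finite_measure_subadditive_finite)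
  also have "\<dots> \<le> (\<Sum>x\<in>P. c * prob {\<omega> \<in> space M. full m0 \<omega>})"
    using E by (intro sum_mono) auto
  also have "\<dots> = real (card P) * (c * prob {\<omega> \<in> space M. full m0 \<omega>})" by simp
  also have "\<dots> \<le> 2 ^ (10 * r0 * (m + 1) + 32) * (c * prob {\<omega> \<in> space M. full m0 \<omega>})"
    using cP by (intro mult_right_mono) (auto simp: c_def)
  finally show ?thesis by (simp add: \<beta>_def c_def)
qed

lemma summable_\<beta>: "summable \<beta>"
proof (rule summable_comparison_test_bigo)
  show "summable (\<lambda>m. norm (exp (- real m)))"
    using summable_geometric[of "exp (-1) :: real"] by (simp add: exp_of_nat_mult[symmetric])
  define a where "a = real (10 * r0) * ln 2"
  define c where "c = 8 / (16::real) ^ r0"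
  have c: "c > 0" by (simp add: c_def)
  have "\<beta> = (\<lambda>m. exp (a * real m + (a + 32 * ln 2) - c * 2 ^ m))"
  proof
    fix m
    have "(2::real) ^ (10 * r0 * (m + 1) + 32) = exp (real (10 * r0 * (m + 1) + 32) * ln 2)"
      by (subst exp_of_nat_mult) simp
    also have "\<dots> = exp (a * real m + (a + 32 * ln 2))"
      by (simp add: a_def algebra_simps)
    finally show "\<beta> m = exp (a * real m + (a + 32 * ln 2) - c * 2 ^ m)"
      by (simp add: \<beta>_def c_def exp_diff exp_minus divide_inverse)
  qed
  moreover have "(\<lambda>m. exp (a * real m + (a + 32 * ln 2) - c * 2 ^ m)) \<in> O(\<lambda>m. exp (- real m))"
    using c by real_asymp
  ultimately show "\<beta> \<in> O(\<lambda>m. exp (- real m))" by simp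
qed

text \<open>The tail is used once for each of the two orientations, so 1/4 loses half of the
  probability of \<open>full m0\<close>. The bound \<open>2 \<le> m\<close> provides enough levels
  for \<open>hit_descendants\<close> at the start of the induction in
  \<open>good_hits\<close>.\<close>

definition m0 :: nat where
  "m0 = (SOME m. 2 \<le> m \<and> (\<Sum>i. \<beta> (i + m)) \<le> 1 / 4)"

lemma m0: "2 \<le> m0" "(\<Sum>i. \<beta> (i + m0)) \<le> 1 / 4"
proof -
  obtain N where "\<forall>n\<ge>N. norm (\<Sum>i. \<beta> (i + n)) < 1 / 4"
    using suminf_exist_split[OF _ summable_\<beta>, of "1 / 4"] by auto
  then have "norm (\<Sum>i. \<beta> (i + (N + 2))) < 1 / 4" by (meson le_add1)
  then have "2 \<le> N + 2 \<and> (\<Sum>i. \<beta> (i + (N + 2))) \<le> 1 / 4" by (simp add: abs_less_iff)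
  then have "2 \<le> m0 \<and> (\<Sum>i. \<beta> (i + m0)) \<le> 1 / 4" unfolding m0_def by (rule someI)
  then show "2 \<le> m0" "(\<Sum>i. \<beta> (i + m0)) \<le> 1 / 4" by auto
qed

text \<open>\<open>full m0\<close> starts the growth, since with no coin lost the
  \<open>2 ^ m0\<close> hit squares are there; afterwards no block may be bad. Lines steeper than 1
  are covered by the condition on \<open>sw \<omega>\<close>.\<close>

definition good :: "conf \<Rightarrow> bool" where
  "good \<omega> \<longleftrightarrow> full m0 \<omega> \<and> (\<forall>i. \<not> bad (i + m0) \<omega> \<and> \<not> bad (i + m0) (sw \<omega>))"

lemma full_sw: "full m (sw \<omega>) = full m \<omega>"
proof -
  have "(\<forall>x\<in>lev (r0 * m). \<omega> (flip x)) = (\<forall>x\<in>flip ` lev (r0 * m). \<omega> x)" by simp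
  then show ?thesis unfolding full_def sw_def flip_image(3) by simp
qed

lemma good_sw: "good (sw \<omega>) = good \<omega>"
  by (auto simp: good_def full_sw)

lemma depends_bad_sw: "depends_on idx (\<lambda>\<omega>. bad m (sw \<omega>))"
  by (rule depends_sw[OF depends_lev_idx[OF depends_bad] flip_image(1)])

lemma depends_good: "depends_on idx good"
proof (rule depends_onI)
  fix \<omega> \<omega>' :: conf assume *: "\<And>x. x \<in> idx \<Longrightarrow> \<omega> x = \<omega>' x"
  have "full m0 \<omega> = full m0 \<omega>'"
    by (rule depends_onD[OF depends_lev_idx[OF depends_full[OF order_refl]] *])
  moreover have "bad m \<omega> = bad m \<omega>'" for m
    by (rule depends_onD[OF depends_lev_idx[OF depends_bad] *])
  moreover have "bad m (sw \<omega>) = bad m (sw \<omega>')" for m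
    by (rule depends_onD[OF depends_bad_sw *])
  ultimately show "good \<omega> = good \<omega>'" unfolding good_def by simp
qed

lemma pred_bad: "Measurable.pred M (bad m)"
  by (rule pred_lev[OF depends_bad])

lemma pred_bad_sw: "Measurable.pred M (\<lambda>\<omega>. bad m (sw \<omega>))"
  by (rule pred_sw[OF depends_lev_idx[OF depends_bad] pred_bad])

lemma pred_full: "Measurable.pred M (full m)"
  by (rule pred_lev[OF depends_full[OF order_refl]])

lemma pred_good [measurable]: "Measurable.pred M good"
proof -
  note [measurable] = pred_bad pred_bad_sw pred_full
  show ?thesis unfolding good_def[abs_def] by measurable
qed

definition bprob :: real where
  "bprob = prob {\<omega> \<in> space M. good \<omega>}"

text \<open>Relative to \<open>full m0\<close>, the bad events of both orientations have total
  probability at most \<open>2 * (1 / 4)\<close>, so at least half of a positive probability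
  remains.\<close>

lemma bprob_pos: "0 < bprob"
proof -
  note [measurable] = pred_bad pred_bad_sw pred_full
  define f where "f = prob {\<omega> \<in> space M. full m0 \<omega>}"
  have f: "f > 0"
    unfolding f_def full_def using prob_all_True[OF finite_lev lev_subset] p by simp
  define E where "E i = {\<omega> \<in> space M. full m0 \<omega> \<and> bad (i + m0) \<omega>} \<union>
     {\<omega> \<in> space M. full m0 \<omega> \<and> bad (i + m0) (sw \<omega>)}" for i
  have E_ev: "E i \<in> events" for i unfolding E_def by measurable
  have pE: "prob (E i) \<le> 2 * f * \<beta> (i + m0)" for i
  proof -
    have "prob {\<omega> \<in> space M. full m0 (sw \<omega>) \<and> bad (i + m0) (sw \<omega>)} = prob {\<omega> \<in> space M. full m0 \<omega> \<and> bad (i + m0) \<omega>}"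
    proof (rule prob_sw[where A="\<lambda>\<omega>. full m0 \<omega> \<and> bad (i + m0) \<omega>"])
      show "depends_on idx (\<lambda>\<omega>. full m0 \<omega> \<and> bad (i + m0) \<omega>)"
        by (rule depends_on_comp2[where f="(\<and>)", OF depends_lev_idx[OF depends_full[OF order_refl]] depends_lev_idx[OF depends_bad]])
    qed measurable
    then have 2: "prob {\<omega> \<in> space M. full m0 \<omega> \<and> bad (i + m0) (sw \<omega>)} = prob {\<omega> \<in> space M. full m0 \<omega> \<and> bad (i + m0) \<omega>}"
      by (simp only: full_sw)
    have "prob (E i) \<le> prob {\<omega> \<in> space M. full m0 \<omega> \<and> bad (i + m0) \<omega>} +
       prob {\<omega> \<in> space M. full m0 \<omega> \<and> bad (i + m0) (sw \<omega>)}"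
      unfolding E_def by (intro measure_Un_le) measurable
    then show ?thesis using 2 prob_bad[of m0 "i + m0"] by (simp add: f_def algebra_simps)
  qed
  have s\<beta>: "summable (\<lambda>i. \<beta> (i + m0))" using summable_\<beta> by (simp add: summable_iff_shift)
  then have s: "summable (\<lambda>i. 2 * f * \<beta> (i + m0))" by (rule summable_mult)
  have sE: "summable (\<lambda>i. prob (E i))" by (rule summable_comparison_test[OF _ s]) (use pE in auto)
  have "prob (\<Union>i. E i) \<le> (\<Sum>i. prob (E i))"
    by (rule finite_measure_subadditive_countably) (use E_ev sE in auto)
  also have "\<dots> \<le> (\<Sum>i. 2 * f * \<beta> (i + m0))" by (rule suminf_le[OF pE sE s])
  also have "\<dots> = 2 * f * (\<Sum>i. \<beta> (i + m0))" by (rule suminf_mult[OF s\<beta>])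
  also have "\<dots> \<le> 2 * f * (1 / 4)" using f m0 by (intro mult_left_mono) auto
  finally have 1: "prob (\<Union>i. E i) \<le> f / 2" by simp
  have "{\<omega> \<in> space M. good \<omega>} = {\<omega> \<in> space M. full m0 \<omega>} - (\<Union>i. E i)"
    by (auto simp: good_def E_def)
  then have "bprob = prob ({\<omega> \<in> space M. full m0 \<omega>} - (\<Union>i. E i))" by (simp add: bprob_def)
  also have "\<dots> = f - prob (\<Union>i. E i)"
    unfolding f_def by (rule finite_measure_Diff) (use E_ev in \<open>auto simp: E_def\<close>)
  finally show ?thesis using 1 f by linarith
qed

lemma bprob_le: "bprob \<le> 1"
  unfolding bprob_def by (rule prob_le_1)

text \<open>The chosen hit squares number at least \<open>2 ^ (i + m0)\<close>: the full levels give
  the start, and each block that is not bad doubles the count.\<close>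

lemma good_hits:
  assumes "good \<omega>" "(s, t) \<in> lines" "(0, 0) \<in> hit s t 0"
  shows "hit s t (r0 * (i + m0)) \<inter> ch_set \<omega> (r0 * (i + m0)) \<noteq> {}"
proof -
  have s: "\<bar>s\<bar> \<le> 1" using assms by (auto simp: lines_def)
  have "2 ^ (i + m0) \<le> card (hit s t (r0 * (i + m0)) \<inter> ch_set \<omega> (r0 * (i + m0)))"
  proof (induction i)
    case 0
    define n where "n = r0 * m0"
    have "2 * 2 \<le> r0 * m0" using r0 m0 by (intro mult_mono) auto
    then have n: "2 \<le> n" by (simp add: n_def)
    have all: "ch_set \<omega> n = {..<2 ^ n} \<times> {..<2 ^ n}"
    proof -
      have "\<omega> (m, i div 2 ^ (n - m), j div 2 ^ (n - m))" if "i < 2 ^ n" "j < 2 ^ n" "1 \<le> m" "m \<le> n" for i j m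
      proof -
        have "i div 2 ^ (n - m) < 2 ^ m" "j div 2 ^ (n - m) < 2 ^ m"
          using that by (auto intro!: less_mult_imp_div_less simp flip: power_add)
        then have "(m, i div 2 ^ (n - m), j div 2 ^ (n - m)) \<in> lev (r0 * m0)"
          using that by (auto simp: lev_def idx_def n_def)
        then show ?thesis using assms(1) by (auto simp: good_def full_def)
      qed
      then show ?thesis by (auto simp: ch_set_def)
    qed
    \<comment> \<open>\<open>hit_descendants\<close> yields \<open>2 ^ (n - 2)\<close> squares, and
      at least \<open>2 ^ m0\<close> are needed.\<close>
    have "m0 + 2 \<le> n"
    proof -
      have "m0 + 2 \<le> 2 * m0" using m0 by simp
      also have "\<dots> \<le> r0 * m0" using r0 by (intro mult_right_mono) auto
      finally show ?thesis by (simp add: n_def)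
    qed
    then have "(2::nat) ^ m0 \<le> 2 ^ (n - 2)" by (intro power_increasing) auto
    also have "\<dots> \<le> card {(a, b). a < 2 ^ n \<and> b < 2 ^ n \<and> (0 * 2 ^ n + a, 0 * 2 ^ n + b) \<in> hit s t (0 + n)}"
      by (rule hit_descendants[OF assms(3) s n])
    also have "\<dots> \<le> card (hit s t n \<inter> ch_set \<omega> n)"
      by (intro card_mono) (auto simp: all)
    finally show ?case by (simp add: n_def)
  next
    case (Suc i)
    have "\<not> bad (i + m0) \<omega>" using assms(1) by (simp add: good_def)
    then have "2 * card (hit s t (r0 * (i + m0)) \<inter> ch_set \<omega> (r0 * (i + m0))) \<le>
       card (hit s t (r0 * (i + m0) + r0) \<inter> ch_set \<omega> (r0 * (i + m0) + r0))"
      unfolding bad_def using assms(2) Suc by force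
    moreover have "r0 * (i + m0) + r0 = r0 * (Suc i + m0)" by (simp add: algebra_simps)
    ultimately show ?case using Suc by simp
  qed
  moreover have "(0::nat) < 2 ^ (i + m0)" by simp
  ultimately have "card (hit s t (r0 * (i + m0)) \<inter> ch_set \<omega> (r0 * (i + m0))) \<noteq> 0" by linarith
  then show ?thesis by force
qed

section \<open>Lines that meet many chosen squares but no good one\<close>

definition all_fail :: "nat \<Rightarrow> nat \<Rightarrow> (nat \<times> nat) set \<Rightarrow> conf \<Rightarrow> bool" where
  "all_fail k N S \<omega> \<longleftrightarrow> N \<le> card (S \<inter> ch_set \<omega> k) \<and> (\<forall>(i, j)\<in>S \<inter> ch_set \<omega> k. \<not> good (sh k i j \<omega>))"

text \<open>Whether \<open>(i, j)\<close> is chosen is decided by the coins up to level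
  \<open>k\<close>, whether it is good by those below it. Given the former, at least
  \<open>N\<close> independent subtrees all have to fail.\<close>

lemma
  assumes S: "S \<subseteq> {..<2 ^ k} \<times> {..<2 ^ k}"
  shows pred_all_fail: "Measurable.pred M (all_fail k N S)"
    and prob_all_fail: "prob {\<omega> \<in> space M. all_fail k N S \<omega>} \<le> (1 - bprob) ^ N"
proof -
  define A where "A T \<omega> \<longleftrightarrow> (\<forall>t\<in>T. \<not> good (sh k (fst t) (snd t) \<omega>))" for T \<omega>
  define \<T> where "\<T> = {T. T \<subseteq> S \<and> N \<le> card T}"
  have finS: "finite S" by (rule finite_subset[OF S]) auto
  have d1: "depends_on idx (\<lambda>\<omega>. \<not> good \<omega>)" by (rule depends_on_comp[OF depends_good])
  have ng: "depends_on (sub k (fst t) (snd t)) (\<lambda>\<omega>. \<not> good (sh k (fst t) (snd t) \<omega>))" for t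
    by (rule depends_sh[OF d1])
  have bd: "fst t < 2 ^ k" "snd t < 2 ^ k" if "t \<in> T" "T \<in> \<T>" for t T
  proof -
    have "t \<in> {..<2 ^ k} \<times> {..<2 ^ k}" using that S by (auto simp: \<T>_def)
    then show "fst t < 2 ^ k" "snd t < 2 ^ k" by auto
  qed
  have depA: "depends_on (idx - lev k) (A T)" if "T \<in> \<T>" for T
    unfolding A_def
    by (rule depends_on_Ball) (rule depends_on_mono[OF ng sub_subset[OF bd(1)[OF _ that] bd(2)[OF _ that]]])
  have m1: "Measurable.pred M (\<lambda>\<omega>. \<not> good (sh k (fst t) (snd t) \<omega>))" if "t \<in> T" "T \<in> \<T>" for t T
    by (rule pred_sh[OF d1 _ bd[OF that]]) measurable
  have mA: "Measurable.pred M (A T)" if "T \<in> \<T>" for T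
    unfolding A_def using m1[OF _ that] that finS finite_subset
    by (intro pred_intros_finite) (auto simp: \<T>_def)
  have pA: "prob {\<omega> \<in> space M. A T \<omega>} \<le> (1 - bprob) ^ N" if "T \<in> \<T>" for T
  proof -
    have finT: "finite T" and cT: "N \<le> card T" using that finS finite_subset by (auto simp: \<T>_def)
    have "prob {\<omega> \<in> space M. A T \<omega>} = (\<Prod>t\<in>T. prob {\<omega> \<in> space M. \<not> good (sh k (fst t) (snd t) \<omega>)})"
      unfolding A_def
    proof (rule prob_Ball_indep[OF finT ng])
      show "disjoint_family_on (\<lambda>t. sub k (fst t) (snd t)) T"
        unfolding disjoint_family_on_def using sub_disjoint by (metis prod.collapse)
    qed (use sub_subset bd[OF _ that] m1[OF _ that] in blast)+
    also have "\<dots> = (\<Prod>t\<in>T. 1 - bprob)"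
    proof (rule prod.cong[OF refl])
      fix t assume t: "t \<in> T"
      have "prob {\<omega> \<in> space M. \<not> good (sh k (fst t) (snd t) \<omega>)} = prob {\<omega> \<in> space M. \<not> good \<omega>}"
        by (rule prob_sh[OF d1 _ bd[OF t that]]) measurable
      also have "\<dots> = 1 - bprob" unfolding bprob_def by (rule prob_neg) measurable
      finally show "prob {\<omega> \<in> space M. \<not> good (sh k (fst t) (snd t) \<omega>)} = 1 - bprob" .
    qed
    also have "\<dots> = (1 - bprob) ^ card T" by simp
    also have "\<dots> \<le> (1 - bprob) ^ N" using cT bprob_pos bprob_le by (intro power_decreasing) auto
    finally show ?thesis .
  qed
  have X: "depends_on (lev k) (\<lambda>\<omega>. S \<inter> ch_set \<omega> k)"
    by (rule depends_on_comp[OF depends_ch_set])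
  have F: "depends_on (lev k) (\<lambda>\<omega>. N \<le> card (S \<inter> ch_set \<omega> k))"
    by (rule depends_on_comp[OF X])
  have eq: "all_fail k N S \<omega> = (N \<le> card (S \<inter> ch_set \<omega> k) \<and> A (S \<inter> ch_set \<omega> k) \<omega>)" for \<omega>
    unfolding all_fail_def A_def by (simp add: case_prod_beta)
  have fT: "finite \<T>" using finS by (auto simp: \<T>_def)
  have "{\<omega> \<in> space M. N \<le> card (S \<inter> ch_set \<omega> k) \<and> A (S \<inter> ch_set \<omega> k) \<omega>} \<in> events"
    by (rule sets_conditional[OF lev_subset finite_lev X F fT _ mA]) (auto simp: \<T>_def)
  then show "Measurable.pred M (all_fail k N S)" by (simp add: pred_def eq)
  have "prob {\<omega> \<in> space M. N \<le> card (S \<inter> ch_set \<omega> k) \<and> A (S \<inter> ch_set \<omega> k) \<omega>} \<le>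
    (1 - bprob) ^ N * prob {\<omega> \<in> space M. N \<le> card (S \<inter> ch_set \<omega> k)}"
    by (rule prob_conditional_le[OF lev_subset finite_lev X F fT _ depA mA pA]) (auto simp: \<T>_def)
  also have "\<dots> \<le> (1 - bprob) ^ N * 1" using bprob_le by (intro mult_left_mono) auto
  finally show "prob {\<omega> \<in> space M. all_fail k N S \<omega>} \<le> (1 - bprob) ^ N" by (simp add: eq)
qed


text \<open>The column range \<open>{c0..<c1}\<close> is there because only the part of a line
  between the viewpoint and the visible point is free of the set.\<close>

definition unblocked :: "nat \<Rightarrow> nat \<Rightarrow> conf \<Rightarrow> bool" where
  "unblocked k N \<omega> \<longleftrightarrow> (\<exists>s t c0 c1. (s, t) \<in> lines \<and> c0 \<le> 2 ^ k \<and> c1 \<le> 2 ^ k \<and>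
     all_fail k N (hit s t k \<inter> {c0..<c1} \<times> UNIV) \<omega>)"

text \<open>Union bound: at most \<open>2 ^ (5 * k + 16)\<close> hit types and
  \<open>2 ^ (k + 1)\<close> choices for each end of the column range.\<close>

lemma
  shows pred_unblocked: "Measurable.pred M (unblocked k N)"
    and prob_unblocked: "prob {\<omega> \<in> space M. unblocked k N \<omega>} \<le> 2 ^ (7 * k + 18) * (1 - bprob) ^ N"
proof -
  define P where "P = hit_types k \<times> {..2 ^ k :: nat} \<times> {..2 ^ k :: nat}"
  define E where "E = (\<lambda>(H, c0, c1). {\<omega> \<in> space M. all_fail k N (H \<inter> {c0..<c1} \<times> UNIV) \<omega>})"
  have eq: "{\<omega> \<in> space M. unblocked k N \<omega>} = (\<Union>x\<in>P. E x)"
  proof (intro set_eqI iffI)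
    fix \<omega> assume "\<omega> \<in> {\<omega> \<in> space M. unblocked k N \<omega>}"
    then obtain s t c0 c1 where *: "\<omega> \<in> space M" "(s, t) \<in> lines" "c0 \<le> 2 ^ k" "c1 \<le> 2 ^ k"
      "all_fail k N (hit s t k \<inter> {c0..<c1} \<times> UNIV) \<omega>"
      unfolding unblocked_def mem_Collect_eq by (elim conjE exE) (rule that)
    have "hit s t k \<in> hit_types k" unfolding hit_types_def using *(2) by (rule rev_image_eqI) simp
    then have "(hit s t k, c0, c1) \<in> P" using * by (simp add: P_def)
    moreover have "\<omega> \<in> E (hit s t k, c0, c1)" using * by (simp add: E_def)
    ultimately show "\<omega> \<in> (\<Union>x\<in>P. E x)" by (rule UN_I)
  next
    fix \<omega> assume "\<omega> \<in> (\<Union>x\<in>P. E x)"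
    then obtain H c0 c1 where *: "H \<in> hit_types k" "c0 \<le> 2 ^ k" "c1 \<le> 2 ^ k" "\<omega> \<in> space M"
      "all_fail k N (H \<inter> {c0..<c1} \<times> UNIV) \<omega>"
      by (auto simp: P_def E_def)
    from *(1) obtain s t where "(s, t) \<in> lines" "H = hit s t k" unfolding hit_types_def by auto
    with * have "unblocked k N \<omega>" unfolding unblocked_def by blast
    with * show "\<omega> \<in> {\<omega> \<in> space M. unblocked k N \<omega>}" by simp
  qed
  have sub: "H \<inter> {c0..<c1} \<times> UNIV \<subseteq> {..<2 ^ k} \<times> {..<2 ^ k}" if "H \<in> hit_types k" for H c0 c1
  proof -
    obtain s t where "H = hit s t k" using \<open>H \<in> hit_types k\<close> unfolding hit_types_def by auto
    then show ?thesis using hit_subset[of s t k] by auto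
  qed
  have E: "E x \<in> events \<and> prob (E x) \<le> (1 - bprob) ^ N" if "x \<in> P" for x
  proof -
    obtain H c0 c1 where x: "x = (H, c0, c1)" "H \<in> hit_types k" using \<open>x \<in> P\<close> by (auto simp: P_def)
    show ?thesis
      using pred_all_fail[OF sub[OF x(2)]] prob_all_fail[OF sub[OF x(2)]] unfolding x(1) E_def prod.case pred_def
      by blast
  qed
  have finP: "finite P" unfolding P_def using finite_hit_types by auto
  have "{\<omega> \<in> space M. unblocked k N \<omega>} \<in> events"
    unfolding eq using E finP by (intro sets.finite_UN) auto
  then show "Measurable.pred M (unblocked k N)" by (simp add: pred_def)
  have "card P \<le> 2 ^ (5 * k + 16) * (2 ^ (k + 1) * 2 ^ (k + 1))"
    unfolding P_def card_cartesian_product by (intro mult_mono card_hit_types) auto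
  also have "\<dots> = 2 ^ (7 * k + 18)"
    by (simp only: power_add[symmetric]) (rule arg_cong[of _ _ "(^) 2"], simp)
  finally have "real (card P) \<le> real (2 ^ (7 * k + 18))" by (simp only: of_nat_le_iff)
  then have cP: "real (card P) \<le> 2 ^ (7 * k + 18)" by simp
  have "prob {\<omega> \<in> space M. unblocked k N \<omega>} \<le> (\<Sum>x\<in>P. prob (E x))"
    unfolding eq using E finP by (intro finite_measure_subadditive_finite) auto
  also have "\<dots> \<le> (\<Sum>x\<in>P. (1 - bprob) ^ N)" using E by (intro sum_mono) auto
  also have "\<dots> = real (card P) * (1 - bprob) ^ N" by simp
  also have "\<dots> \<le> 2 ^ (7 * k + 18) * (1 - bprob) ^ N" using cP bprob_le by (intro mult_right_mono) auto
  finally show "prob {\<omega> \<in> space M. unblocked k N \<omega>} \<le> 2 ^ (7 * k + 18) * (1 - bprob) ^ N" .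
qed

lemma depends_all_fail: "depends_on idx (all_fail k N S)"
proof -
  have d: "depends_on idx (\<lambda>\<omega>. good (sh k i j \<omega>))" if "i < 2 ^ k" "j < 2 ^ k" for i j
    by (rule depends_on_mono[OF depends_sh[OF depends_good]]) (use sub_subset[OF that] in auto)
  have af: "all_fail k N S \<omega> = all_fail k N S \<omega>'" if *: "\<And>x. x \<in> idx \<Longrightarrow> \<omega> x = \<omega>' x" for S \<omega> \<omega>'
  proof -
    have "ch_set \<omega> k = ch_set \<omega>' k" by (rule depends_onD[OF depends_ch_set_idx *])
    moreover have "good (sh k (fst t) (snd t) \<omega>) = good (sh k (fst t) (snd t) \<omega>')" if "t \<in> ch_set \<omega>' k" for t
      using that by (intro depends_onD[OF d *]) (auto simp: ch_set_def)
    ultimately show ?thesis unfolding all_fail_def case_prod_beta by simp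
  qed
  then show ?thesis by (rule depends_onI)
qed

lemma depends_unblocked: "depends_on idx (unblocked k N)"
proof -
  have af: "all_fail k N S \<omega> = all_fail k N S \<omega>'" if *: "\<And>x. x \<in> idx \<Longrightarrow> \<omega> x = \<omega>' x" for S \<omega> \<omega>'
    by (rule depends_onD[OF depends_all_fail *])
  have "unblocked k N \<omega> = unblocked k N \<omega>'" if "\<And>x. x \<in> idx \<Longrightarrow> \<omega> x = \<omega>' x" for \<omega> \<omega>'
    unfolding unblocked_def using af[OF that] by simp
  then show ?thesis by (rule depends_onI)
qed

text \<open>The threshold \<open>K * n\<close> depends on \<open>n\<close> and not on
  \<open>k\<close>, so that at every level \<open>k \<le> n\<close> the failure probability is
  exponentially small in \<open>n\<close>; the sum over \<open>k\<close> costs a factor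
  \<open>n + 1\<close>, and Borel-Cantelli applies.\<close>

lemma AE_blocked: "\<exists>K. AE \<omega> in M. \<forall>\<^sub>F n in sequentially. \<forall>k\<le>n. \<not> unblocked k (K * n) \<omega> \<and> \<not> unblocked k (K * n) (sw \<omega>)"
proof -
  \<comment> \<open>The factor \<open>2 ^ (- 8 * n)\<close> beats the number
    \<open>2 ^ (7 * n + 18)\<close> of events and leaves the summable
    \<open>2 ^ (- n)\<close>.\<close>
  have "\<exists>K. (1 - bprob) ^ K < (1 / 2) ^ 8"
    by (rule real_arch_pow_inv) (use bprob_pos in simp_all)
  then obtain K where K: "(1 - bprob) ^ K < (1 / 2) ^ 8" ..
  define E where "E n = {\<omega> \<in> space M. \<exists>k\<le>n. unblocked k (K * n) \<omega>}" for n
  have E_ev: "E n \<in> events" for n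
  proof -
    note [measurable] = pred_unblocked
    show ?thesis unfolding E_def by measurable
  qed
  have pE: "prob (E n) \<le> real (n + 1) * 2 ^ 18 * (1 / 2) ^ n" for n
  proof -
    have "prob (E n) \<le> (\<Sum>k\<le>n. prob {\<omega> \<in> space M. unblocked k (K * n) \<omega>})"
    proof -
      have "E n = (\<Union>k\<in>{..n}. {\<omega> \<in> space M. unblocked k (K * n) \<omega>})" by (auto simp: E_def)
      then show ?thesis using pred_unblocked by (auto intro!: finite_measure_subadditive_finite simp: pred_def)
    qed
    also have "\<dots> \<le> (\<Sum>k\<le>n. 2 ^ (7 * n + 18) * (1 / 2) ^ (8 * n))"
    proof (rule sum_mono)
      fix k assume k: "k \<in> {..n}"
      have "(1 - bprob) ^ (K * n) \<le> ((1 / 2) ^ 8) ^ n"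
        unfolding power_mult using K bprob_le by (intro power_mono) auto
      moreover have "(2::real) ^ (7 * k + 18) \<le> 2 ^ (7 * n + 18)" using k by (intro power_increasing) auto
      ultimately have "2 ^ (7 * k + 18) * (1 - bprob) ^ (K * n) \<le> 2 ^ (7 * n + 18) * (1 / 2) ^ (8 * n)"
        using bprob_le by (intro mult_mono) (auto simp: power_mult)
      then show "prob {\<omega> \<in> space M. unblocked k (K * n) \<omega>} \<le> 2 ^ (7 * n + 18) * (1 / 2) ^ (8 * n)"
        using prob_unblocked[of k "K * n"] by linarith
    qed
    also have "\<dots> = real (n + 1) * (2 ^ (7 * n + 18) * (1 / 2) ^ (8 * n))" by simp
    also have "(2::real) ^ (7 * n + 18) * (1 / 2) ^ (8 * n) = 2 ^ 18 * (1 / 2) ^ n"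
    proof -
      have "(2::real) ^ (8 * n) = 2 ^ (7 * n) * 2 ^ n" by (simp flip: power_add)
      then show ?thesis by (simp add: power_add power_one_over field_simps)
    qed
    finally show ?thesis by (simp only: mult.assoc)
  qed
  have sum: "summable (\<lambda>n. real (n + 1) * 2 ^ 18 * (1 / 2) ^ n)"
  proof (rule summable_comparison_test_bigo)
    show "summable (\<lambda>n. norm ((3/4::real) ^ n))" using summable_geometric[of "3/4::real"] by simp
    show "(\<lambda>n. real (n + 1) * 2 ^ 18 * (1 / 2) ^ n) \<in> O(\<lambda>n. (3/4) ^ n)" by real_asymp
  qed
  have "AE \<omega> in M. \<forall>\<^sub>F n in sequentially. \<omega> \<in> space M - E n"
  proof (rule borel_cantelli_AE1)
    show "summable (\<lambda>n. prob (E n))" by (rule summable_comparison_test[OF _ sum]) (use pE in auto)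
  qed (use E_ev in \<open>auto simp: emeasure_eq_measure\<close>)
  then have 1: "AE \<omega> in M. \<forall>\<^sub>F n in sequentially. \<forall>k\<le>n. \<not> unblocked k (K * n) \<omega>"
    by (rule AE_mp) (auto simp: E_def elim!: eventually_mono intro!: AE_I2)
  have "AE \<omega> in M. \<forall>\<^sub>F n in sequentially. \<forall>k\<le>n. \<not> unblocked k (K * n) (sw \<omega>)"
  proof (rule AE_sw[OF _ _ 1])
    show "depends_on idx (\<lambda>\<omega>. \<forall>\<^sub>F n in sequentially. \<forall>k\<le>n. \<not> unblocked k (K * n) \<omega>)"
    proof (rule depends_onI)
      fix \<omega> \<omega>' :: conf assume "\<And>x. x \<in> idx \<Longrightarrow> \<omega> x = \<omega>' x"
      then have "unblocked k N \<omega> = unblocked k N \<omega>'" for k N by (rule depends_onD[OF depends_unblocked])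
      then show "(\<forall>\<^sub>F n in sequentially. \<forall>k\<le>n. \<not> unblocked k (K * n) \<omega>) = (\<forall>\<^sub>F n in sequentially. \<forall>k\<le>n. \<not> unblocked k (K * n) \<omega>')"
        by simp
    qed
    note [measurable] = pred_unblocked
    show "Measurable.pred M (\<lambda>\<omega>. \<forall>\<^sub>F n in sequentially. \<forall>k\<le>n. \<not> unblocked k (K * n) \<omega>)"
      unfolding eventually_sequentially by measurable
  qed
  with 1 have "AE \<omega> in M. \<forall>\<^sub>F n in sequentially. \<forall>k\<le>n. \<not> unblocked k (K * n) \<omega> \<and> \<not> unblocked k (K * n) (sw \<omega>)"
    by eventually_elim (auto elim: eventually_elim2)
  then show ?thesis ..
qed

section \<open>Surviving squares contain good squares\<close>

definition alive :: "conf \<Rightarrow> bool" where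
  "alive \<omega> \<longleftrightarrow> (\<forall>n. ch_set \<omega> n \<noteq> {})"

definition has_good :: "conf \<Rightarrow> bool" where
  "has_good \<omega> \<longleftrightarrow> (\<exists>k i j. (i, j) \<in> ch_set \<omega> k \<and> good (sh k i j \<omega>))"

lemma depends_alive: "depends_on idx alive"
  unfolding alive_def by (intro depends_on_All depends_on_comp[OF depends_ch_set_idx])

lemma pred_alive [measurable]: "Measurable.pred M alive"
proof -
  note [measurable] = pred_ch_set
  show ?thesis unfolding alive_def[abs_def] by measurable
qed

text \<open>For \<open>N = 0\<close> the size condition holds trivially; in this form measurability
  follows from that of \<open>all_fail\<close>.\<close>

lemma has_good_eq: "has_good \<omega> \<longleftrightarrow> (\<exists>k. \<not> all_fail k 0 UNIV \<omega>)"
  by (auto simp: has_good_def all_fail_def)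

lemma all_fail_UNIV: "all_fail k N UNIV \<omega> = all_fail k N ({..<2 ^ k} \<times> {..<2 ^ k}) \<omega>"
proof -
  have "UNIV \<inter> ch_set \<omega> k = ({..<2 ^ k} \<times> {..<2 ^ k}) \<inter> ch_set \<omega> k"
    using ch_set_subset by blast
  then show ?thesis unfolding all_fail_def by simp
qed

lemma pred_has_good [measurable]: "Measurable.pred M has_good"
proof -
  have [measurable]: "Measurable.pred M (\<lambda>\<omega>. all_fail k 0 ({..<2 ^ k} \<times> {..<2 ^ k}) \<omega>)" for k
    by (rule pred_all_fail) auto
  show ?thesis unfolding has_good_eq[abs_def] all_fail_UNIV by measurable
qed

lemma depends_has_good: "depends_on idx has_good"
proof (rule depends_onI)
  fix \<omega> \<omega>' :: conf assume *: "\<And>x. x \<in> idx \<Longrightarrow> \<omega> x = \<omega>' x"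
  have "all_fail k N S \<omega> = all_fail k N S \<omega>'" for k N S
    by (rule depends_onD[OF depends_all_fail *])
  then show "has_good \<omega> = has_good \<omega>'" by (simp add: has_good_eq)
qed

text \<open>
  A small nonempty generation dies out in the next step with probability at least \<open>q > 0\<close>.
  The probabilities of dying out at step \<open>k\<close> have a finite sum, so small nonempty generations
  become improbable.
\<close>

lemma prob_small_tendsto_0:
  "(\<lambda>k. prob {\<omega> \<in> space M. ch_set \<omega> k \<noteq> {} \<and> card (ch_set \<omega> k) < L}) \<longlonglongrightarrow> 0"
proof -
  note [measurable] = pred_ch_set
  \<comment> \<open>Fewer than \<open>L\<close> squares have at most \<open>4 * L\<close> child
    coins; if all of them fail, the next generation is empty.\<close>
  define q where "q = (1 - p) ^ (4 * L)"
  have q: "q > 0" using p by (simp add: q_def)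
  define e where "e k = prob {\<omega> \<in> space M. ch_set \<omega> k = {}}" for k
  define d where "d k = prob {\<omega> \<in> space M. ch_set \<omega> k \<noteq> {} \<and> card (ch_set \<omega> k) < L}" for k
  have emp: "ch_set \<omega> (Suc k) = {}" if "ch_set \<omega> k = {}" for \<omega> k
    using ch_set_ancestor[of _ _ \<omega> k 1] that by auto
  have step: "q * d k \<le> e (Suc k) - e k" for k
  proof -
    define ch where "ch t = (\<lambda>(a, b). (Suc k, fst t * 2 + a, snd t * 2 + b)) ` ({..<2} \<times> {..<2})" for t :: "nat \<times> nat"
    define A where "A T \<omega> \<longleftrightarrow> \<not> (\<forall>x\<in>\<Union>(ch ` T). \<not> \<omega> x)" for T :: "(nat \<times> nat) set" and \<omega> :: conf
    define \<T> :: "(nat \<times> nat) set set" where "\<T> = {T. T \<subseteq> {..<2 ^ k} \<times> {..<2 ^ k} \<and> card T < L}"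
    define F where "F \<omega> \<longleftrightarrow> ch_set \<omega> k \<noteq> {} \<and> card (ch_set \<omega> k) < L" for \<omega>
    have F: "depends_on (lev k) F" unfolding F_def by (rule depends_on_comp[OF depends_ch_set])
    have fin: "finite \<T>" unfolding \<T>_def by (rule finite_subset[of _ "Pow ({..<2 ^ k} \<times> {..<2 ^ k} :: (nat \<times> nat) set)"]) auto
    have fT: "finite T" if "T \<in> \<T>" for T
      using that unfolding \<T>_def by (auto intro: finite_subset)
    have ch_sub: "\<Union>(ch ` T) \<subseteq> idx - lev k" if "T \<in> \<T>" for T
    proof
      fix x assume "x \<in> \<Union>(ch ` T)"
      then obtain t a b where t: "t \<in> T" "a < 2" "b < 2" "x = (Suc k, fst t * 2 + a, snd t * 2 + b)"
        by (auto simp: ch_def)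
      moreover have "fst t < 2 ^ k" "snd t < 2 ^ k" using t that unfolding \<T>_def by auto
      ultimately show "x \<in> idx - lev k"
        using pow_less[of "fst t" k a 1] pow_less[of "snd t" k b 1] by (auto simp: idx_def lev_def)
    qed
    have fch: "finite (\<Union>(ch ` T))" if "T \<in> \<T>" for T using fT[OF that] by (auto simp: ch_def)
    have cch: "card (\<Union>(ch ` T)) \<le> 4 * L" if "T \<in> \<T>" for T
    proof -
      have "card (\<Union>(ch ` T)) \<le> (\<Sum>t\<in>T. card (ch t))" by (rule card_UN_le[OF fT[OF that]])
      also have "\<dots> \<le> (\<Sum>t\<in>T. 4)"
        unfolding ch_def by (intro sum_mono order_trans[OF card_image_le]) auto
      also have "\<dots> \<le> 4 * L" using that by (simp add: \<T>_def)
      finally show ?thesis .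
    qed
    have depA: "depends_on (\<Union>(ch ` T)) (A T)" for T
      unfolding A_def by (rule depends_onI) simp
    have mA: "Measurable.pred M (A T)" if "T \<in> \<T>" for T
      by (rule pred_finite_dep[OF depA fch[OF that]]) (use ch_sub[OF that] in auto)
    have pA: "prob {\<omega> \<in> space M. A T \<omega>} \<le> 1 - q" if "T \<in> \<T>" for T
    proof -
      have "Measurable.pred M (\<lambda>\<omega>. \<forall>x\<in>\<Union>(ch ` T). \<not> \<omega> x)"
        by (rule pred_finite_dep[OF _ fch[OF that]]) (use ch_sub[OF that] in \<open>auto simp: depends_on_def\<close>)
      then have "prob {\<omega> \<in> space M. A T \<omega>} = 1 - prob {\<omega> \<in> space M. \<forall>x\<in>\<Union>(ch ` T). \<not> \<omega> x}"
        unfolding A_def by (intro prob_neg) (simp add: pred_def)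
      also have "\<dots> = 1 - (1 - p) ^ card (\<Union>(ch ` T))"
        by (subst prob_all_False[OF fch[OF that]]) (use ch_sub[OF that] in auto)
      also have "\<dots> \<le> 1 - q"
        unfolding q_def using cch[OF that] p by (intro diff_left_mono power_decreasing) auto
      finally show ?thesis .
    qed
    have FT: "ch_set \<omega> k \<in> \<T>" if "F \<omega>" for \<omega>
      using that ch_set_subset by (auto simp: F_def \<T>_def)
    have "prob {\<omega> \<in> space M. F \<omega> \<and> A (ch_set \<omega> k) \<omega>} \<le> (1 - q) * prob {\<omega> \<in> space M. F \<omega>}"
      by (rule prob_conditional_le[OF lev_subset finite_lev depends_ch_set F fin FT depends_on_mono[OF depA ch_sub] mA pA])
    moreover have "prob {\<omega> \<in> space M. F \<omega> \<and> ch_set \<omega> (Suc k) \<noteq> {}} \<le> prob {\<omega> \<in> space M. F \<omega> \<and> A (ch_set \<omega> k) \<omega>}"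
    proof (rule finite_measure_mono)
      have "A (ch_set \<omega> k) \<omega>" if ne: "ch_set \<omega> (Suc k) \<noteq> {}" for \<omega>
      proof -
        obtain i j where ij: "(i, j) \<in> ch_set \<omega> (k + 1)" using ne by auto
        then have "\<forall>m\<in>{1..k + 1}. \<omega> (m, i div 2 ^ (k + 1 - m), j div 2 ^ (k + 1 - m))"
          unfolding ch_set_def by blast
        from bspec[OF this, of "k + 1"] have "\<omega> (Suc k, i, j)" by simp
        moreover have "(Suc k, i, j) \<in> ch (i div 2, j div 2)"
          unfolding ch_def by (rule rev_image_eqI[of "(i mod 2, j mod 2)"]) simp_all
        moreover have "(i div 2, j div 2) \<in> ch_set \<omega> k" using ch_set_ancestor[OF ij] by simp
        ultimately show ?thesis unfolding A_def by blast
      qed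
      then show "{\<omega> \<in> space M. F \<omega> \<and> ch_set \<omega> (Suc k) \<noteq> {}} \<subseteq> {\<omega> \<in> space M. F \<omega> \<and> A (ch_set \<omega> k) \<omega>}" by auto
      show "{\<omega> \<in> space M. F \<omega> \<and> A (ch_set \<omega> k) \<omega>} \<in> events"
        by (rule sets_conditional[OF lev_subset finite_lev depends_ch_set F fin FT mA])
    qed
    ultimately have 1: "prob {\<omega> \<in> space M. F \<omega> \<and> ch_set \<omega> (Suc k) \<noteq> {}} \<le> (1 - q) * d k"
      unfolding d_def F_def by simp
    have [measurable]: "Measurable.pred M F" by (rule pred_lev[OF F])
    have "d k = prob ({\<omega> \<in> space M. F \<omega> \<and> ch_set \<omega> (Suc k) \<noteq> {}} \<union> {\<omega> \<in> space M. F \<omega> \<and> ch_set \<omega> (Suc k) = {}})"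
      unfolding d_def F_def by (rule arg_cong[of _ _ prob]) auto
    also have "\<dots> = prob {\<omega> \<in> space M. F \<omega> \<and> ch_set \<omega> (Suc k) \<noteq> {}} + prob {\<omega> \<in> space M. F \<omega> \<and> ch_set \<omega> (Suc k) = {}}"
      by (intro finite_measure_Union) (measurable, auto)
    finally have 2: "q * d k \<le> prob {\<omega> \<in> space M. F \<omega> \<and> ch_set \<omega> (Suc k) = {}}"
      using 1 by (simp add: algebra_simps)
    have "prob {\<omega> \<in> space M. F \<omega> \<and> ch_set \<omega> (Suc k) = {}} + e k =
       prob ({\<omega> \<in> space M. F \<omega> \<and> ch_set \<omega> (Suc k) = {}} \<union> {\<omega> \<in> space M. ch_set \<omega> k = {}})"
      unfolding e_def by (intro finite_measure_Union[symmetric]) (measurable, auto simp: F_def)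
    also have "\<dots> \<le> e (Suc k)"
      unfolding e_def by (intro finite_measure_mono) (use emp in \<open>auto, measurable\<close>)
    finally show ?thesis using 2 by linarith
  qed
  have inc: "incseq e"
  proof (rule incseq_SucI)
    fix k show "e k \<le> e (Suc k)" unfolding e_def by (intro finite_measure_mono) (use emp in \<open>auto, measurable\<close>)
  qed
  have "convergent e"
    by (rule Bseq_monoseq_convergent) (use inc in \<open>auto simp: Bseq_def incseq_imp_monoseq e_def intro!: exI[of _ 1]\<close>)
  then obtain l where l: "e \<longlonglongrightarrow> l" by (auto simp: convergent_def)
  have "(\<lambda>k. (e (Suc k) - e k) / q) \<longlonglongrightarrow> (l - l) / q"
    using l LIMSEQ_Suc[OF l] q by (intro tendsto_intros) auto
  then have lim: "(\<lambda>k. (e (Suc k) - e k) / q) \<longlonglongrightarrow> 0" by simp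
  have "d \<longlonglongrightarrow> 0"
  proof (rule tendsto_sandwich[OF _ _ tendsto_const lim])
    show "\<forall>\<^sub>F k in sequentially. d k \<le> (e (Suc k) - e k) / q"
      using step q by (intro always_eventually) (auto simp: field_simps)
  qed (auto simp: d_def)
  then show ?thesis by (simp add: d_def[abs_def])
qed

text \<open>At level \<open>k\<close> a surviving tree has either fewer than \<open>L\<close>
  squares or at least \<open>L\<close> independent attempts at a good one. Letting \<open>k\<close>
  tend to infinity removes the first case, then \<open>L\<close> the second.\<close>

lemma AE_alive_has_good: "AE \<omega> in M. alive \<omega> \<longrightarrow> has_good \<omega>"
proof -
  note [measurable] = pred_ch_set
  define B where "B = {\<omega> \<in> space M. alive \<omega> \<and> \<not> has_good \<omega>}"
  have B_ev: "B \<in> events" unfolding B_def by measurable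
  have le: "prob B \<le> prob {\<omega> \<in> space M. ch_set \<omega> k \<noteq> {} \<and> card (ch_set \<omega> k) < L} + (1 - bprob) ^ L" for k L
  proof -
    let ?S = "{..<2 ^ k} \<times> {..<2 ^ k} :: (nat \<times> nat) set"
    have [measurable]: "Measurable.pred M (all_fail k L ?S)" by (rule pred_all_fail) auto
    have sub: "B \<subseteq> {\<omega> \<in> space M. ch_set \<omega> k \<noteq> {} \<and> card (ch_set \<omega> k) < L} \<union> {\<omega> \<in> space M. all_fail k L ?S \<omega>}"
    proof
      fix \<omega> assume w: "\<omega> \<in> B"
      show "\<omega> \<in> {\<omega> \<in> space M. ch_set \<omega> k \<noteq> {} \<and> card (ch_set \<omega> k) < L} \<union> {\<omega> \<in> space M. all_fail k L ?S \<omega>}"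
      proof (cases "card (ch_set \<omega> k) < L")
        case False
        then have "all_fail k L UNIV \<omega>" using w by (auto simp: B_def all_fail_def has_good_def)
        then show ?thesis using w by (simp add: B_def all_fail_UNIV)
      qed (use w in \<open>auto simp: B_def alive_def\<close>)
    qed
    have "prob B \<le> prob ({\<omega> \<in> space M. ch_set \<omega> k \<noteq> {} \<and> card (ch_set \<omega> k) < L} \<union> {\<omega> \<in> space M. all_fail k L ?S \<omega>})"
      by (rule finite_measure_mono[OF sub]) measurable
    also have "\<dots> \<le> prob {\<omega> \<in> space M. ch_set \<omega> k \<noteq> {} \<and> card (ch_set \<omega> k) < L} + prob {\<omega> \<in> space M. all_fail k L ?S \<omega>}"
      by (rule measure_Un_le) measurable
    finally show ?thesis using prob_all_fail[of ?S k L] by simp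
  qed
  have "prob B \<le> (1 - bprob) ^ L" for L
    by (rule LIMSEQ_le_const[OF tendsto_add[OF prob_small_tendsto_0[of L] tendsto_const[of "(1 - bprob) ^ L"]], simplified])
      (use le in auto)
  moreover have "(\<lambda>L. (1 - bprob) ^ L) \<longlonglongrightarrow> 0"
    using bprob_pos bprob_le by (intro LIMSEQ_power_zero) auto
  ultimately have "prob B \<le> 0" by (intro LIMSEQ_le_const[of _ 0]) auto
  then have "prob B = 0" using measure_nonneg[of M B] by linarith
  then have "AE \<omega> in M. \<omega> \<notin> B" using B_ev by (simp add: AE_iff_measurable[OF B_ev] emeasure_eq_measure prob_eq_0)
  then show ?thesis by (rule AE_mp) (auto simp: B_def intro!: AE_I2)
qed

text \<open>Needed in every subtree, because the good square used for a given viewpoint has to lie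
  in a prescribed square that avoids it.\<close>

lemma AE_subtrees: "AE \<omega> in M. \<forall>k. \<forall>i<2 ^ k. \<forall>j<2 ^ k. alive (sh k i j \<omega>) \<longrightarrow> has_good (sh k i j \<omega>)"
proof -
  have "AE \<omega> in M. i < 2 ^ k \<longrightarrow> j < 2 ^ k \<longrightarrow> alive (sh k i j \<omega>) \<longrightarrow> has_good (sh k i j \<omega>)" for k i j
  proof (cases "i < 2 ^ k \<and> j < 2 ^ k")
    case True
    have "AE \<omega> in M. alive (sh k i j \<omega>) \<longrightarrow> has_good (sh k i j \<omega>)"
    proof (rule AE_sh[OF _ _ _ _ AE_alive_has_good])
      show "depends_on idx (\<lambda>\<omega>. alive \<omega> \<longrightarrow> has_good \<omega>)"
        by (rule depends_on_comp2[OF depends_alive depends_has_good])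
    qed (use True in auto)
    then show ?thesis by (rule AE_mp) auto
  qed auto
  then show ?thesis by (simp add: AE_all_countable)
qed

end


section \<open>The limit set\<close>

abbreviation dsq :: "nat \<Rightarrow> nat \<Rightarrow> nat \<Rightarrow> (real \<times> real) set" where
  "dsq n i j \<equiv> dyadic_square n (int i) (int j)"

definition cell :: "nat \<Rightarrow> nat \<Rightarrow> real set" where
  "cell n i = {real i / 2 ^ n .. (real i + 1) / 2 ^ n}"

lemma dsq_iff: "(x, y) \<in> dsq n i j \<longleftrightarrow> x \<in> cell n i \<and> y \<in> cell n j"
  by (auto simp: dyadic_square_def cell_def)

lemma cell_iff: "x \<in> cell n i \<longleftrightarrow> real i \<le> 2 ^ n * x \<and> 2 ^ n * x \<le> real i + 1"
  by (auto simp: cell_def field_simps)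

lemma cell_ancestor:
  assumes "x \<in> cell (k + m) a" shows "x \<in> cell k (a div 2 ^ m)"
proof -
  define q r where "q = a div 2 ^ m" and "r = a mod 2 ^ m"
  have a: "a = q * 2 ^ m + r" unfolding q_def r_def by (rule div_mult_mod_eq[symmetric])
  have "r + 1 \<le> 2 ^ m" by (simp add: r_def Suc_le_eq)
  then have "real (r + 1) \<le> real (2 ^ m)" by (simp only: of_nat_le_iff)
  then have r: "real r + 1 \<le> 2 ^ m" by simp
  have 1: "real q * 2 ^ m + real r \<le> (2 ^ k * x) * 2 ^ m" "(2 ^ k * x) * 2 ^ m \<le> real q * 2 ^ m + real r + 1"
    using assms unfolding cell_iff a by (simp_all add: power_add mult.commute mult.left_commute)
  then have "real q * 2 ^ m \<le> (2 ^ k * x) * 2 ^ m" using of_nat_0_le_iff[of r] by linarith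
  moreover have "(2 ^ k * x) * 2 ^ m \<le> (real q + 1) * 2 ^ m" using 1 r by (simp add: algebra_simps)
  ultimately show ?thesis unfolding cell_iff q_def[symmetric] by simp
qed

lemma dsq_ancestor:
  assumes "z \<in> dsq (k + m) a b" shows "z \<in> dsq k (a div 2 ^ m) (b div 2 ^ m)"
  using assms cell_ancestor by (cases z) (auto simp: dsq_iff)

definition ES :: "conf \<Rightarrow> (real \<times> real) set" where
  "ES \<omega> = {z. \<forall>n. \<exists>(i, j)\<in>ch_set \<omega> n. z \<in> dsq n i j}"

lemma ES_D: "z \<in> ES \<omega> \<Longrightarrow> \<exists>i j. (i, j) \<in> ch_set \<omega> n \<and> z \<in> dsq n i j"
  unfolding ES_def by blast

text \<open>Membership at deep levels passes to all ancestors, so a point may be tested from level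
  \<open>k\<close> on.\<close>

lemma ES_I:
  assumes "\<And>m. \<exists>i j. (i, j) \<in> ch_set \<omega> (k + m) \<and> z \<in> dsq (k + m) i j"
  shows "z \<in> ES \<omega>"
proof -
  have "\<exists>i j. (i, j) \<in> ch_set \<omega> n \<and> z \<in> dsq n i j" for n
  proof -
    obtain i j where "(i, j) \<in> ch_set \<omega> (n + k)" "z \<in> dsq (n + k) i j"
      using assms[of n] by (auto simp: add.commute)
    then show ?thesis using ch_set_ancestor dsq_ancestor by blast
  qed
  then show ?thesis unfolding ES_def by fast
qed

lemma cell_unit: "x \<in> cell n i \<Longrightarrow> i < 2 ^ n \<Longrightarrow> 0 \<le> x \<and> x \<le> 1"
  using cell_ancestor[of x 0 n i] by (auto simp: cell_def)

lemma ES_unit: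
  assumes "(a, b) \<in> ES \<omega>" shows "0 \<le> a" "a \<le> 1" "0 \<le> b" "b \<le> 1"
  using ES_D[OF assms, of 0] by (auto simp: ch_set_0 dsq_iff cell_def)

lemma ES_sw: "(a, b) \<in> ES (sw \<omega>) \<longleftrightarrow> (b, a) \<in> ES \<omega>"
proof -
  have "(a, b) \<in> ES (sw \<omega>)" if "(b, a) \<in> ES \<omega>" for a b \<omega>
  proof (rule ES_I[where k=0])
    fix m
    obtain i j where "(i, j) \<in> ch_set \<omega> m" "(b, a) \<in> dsq m i j" using ES_D[OF \<open>(b, a) \<in> ES \<omega>\<close>] by blast
    then show "\<exists>i j. (i, j) \<in> ch_set (sw \<omega>) (0 + m) \<and> (a, b) \<in> dsq (0 + m) i j"
      by (intro exI[of _ j] exI[of _ i]) (simp add: ch_set_sw dsq_iff)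
  qed
  from this[of b a \<omega>] this[of a b "sw \<omega>"] show ?thesis by auto
qed

lemma closed_dsq: "closed (dsq n i j)"
  unfolding dyadic_square_def by (intro closed_Times) auto

lemma closed_ES: "closed (ES \<omega>)"
proof -
  have "ES \<omega> = (\<Inter>n. \<Union>(i, j)\<in>ch_set \<omega> n. dsq n i j)"
    unfolding ES_def by auto
  also have "closed \<dots>"
    by (intro closed_INT ballI closed_UN) (auto intro: closed_dsq)
  finally show ?thesis .
qed

lemma compact_ES: "compact (ES \<omega>)"
proof -
  have "ES \<omega> \<subseteq> {0..1} \<times> {0..1}"
  proof
    fix z assume "z \<in> ES \<omega>"
    then show "z \<in> {0..1} \<times> {0..1}" using ES_unit[of "fst z" "snd z" \<omega>] by (simp add: mem_Times_iff)
  qed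
  moreover have "compact ({0..1::real} \<times> {0..1::real})" by (intro compact_Times) auto
  ultimately show ?thesis
    using compact_Int_closed[of "{0..1} \<times> {0..1}" "ES \<omega>"] closed_ES by (simp add: inf.absorb2)
qed

lemma ES_scale:
  assumes "(i, j) \<in> ch_set \<omega> k" "(v, w) \<in> ES (sh k i j \<omega>)"
  shows "((real i + v) / 2 ^ k, (real j + w) / 2 ^ k) \<in> ES \<omega>"
proof (rule ES_I[where k=k])
  fix m
  obtain a b where ab: "(a, b) \<in> ch_set (sh k i j \<omega>) m" "v \<in> cell m a" "w \<in> cell m b"
    using ES_D[OF assms(2), of m] by (auto simp: dsq_iff)
  have lt: "a < 2 ^ m" "b < 2 ^ m" using ab(1) by (auto simp: ch_set_def)
  have c: "(real i + v) / 2 ^ k \<in> cell (k + m) (i * 2 ^ m + a)" if "v \<in> cell m a" for i a v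
  proof -
    have "2 ^ (k + m) * ((real i + v) / 2 ^ k) = real i * 2 ^ m + 2 ^ m * v"
      by (simp add: power_add field_simps)
    then show ?thesis using that unfolding cell_iff by simp
  qed
  have "(i * 2 ^ m + a, j * 2 ^ m + b) \<in> ch_set \<omega> (k + m)" using ab lt assms(1) by (simp add: ch_set_sh)
  moreover have "((real i + v) / 2 ^ k, (real j + w) / 2 ^ k) \<in> dsq (k + m) (i * 2 ^ m + a) (j * 2 ^ m + b)"
    using ab c by (simp only: dsq_iff)
  ultimately show "\<exists>i' j'. (i', j') \<in> ch_set \<omega> (k + m) \<and> ((real i + v) / 2 ^ k, (real j + w) / 2 ^ k) \<in> dsq (k + m) i' j'"
    by blast
qed

lemma ch_set_nonempty_antimono: "ch_set \<omega> (k + m) \<noteq> {} \<Longrightarrow> ch_set \<omega> k \<noteq> {}"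
  using ch_set_ancestor[of _ _ \<omega> k m] by auto

context percolation_tree
begin

text \<open>The squares are closed, so a point can lie in several of one level, and a chosen one
  among them may die out. If all of them died out, none would have a descendant containing the point
  at a sufficiently deep level.\<close>

lemma ES_alive:
  assumes z: "z \<in> ES \<omega>"
  shows "\<exists>i j. (i, j) \<in> ch_set \<omega> k \<and> z \<in> dsq k i j \<and> alive (sh k i j \<omega>)"
proof (rule ccontr)
  assume contra: "\<not> ?thesis"
  define S where "S = {(i, j) \<in> ch_set \<omega> k. z \<in> dsq k i j}"
  have finS: "finite S" unfolding S_def by (rule finite_subset[OF _ finite_ch_set]) auto
  have "\<exists>m. ch_set (sh k (fst t) (snd t) \<omega>) m = {}" if "t \<in> S" for t
    using contra that by (auto simp: S_def alive_def)
  then obtain f where f: "\<And>t. t \<in> S \<Longrightarrow> ch_set (sh k (fst t) (snd t) \<omega>) (f t) = {}" by metis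
  \<comment> \<open>The sum is a convenient bound for all the extinction times.\<close>
  define m where "m = (\<Sum>t\<in>S. f t)"
  obtain a b where ab: "(a, b) \<in> ch_set \<omega> (k + m)" "z \<in> dsq (k + m) a b"
    using ES_D[OF z] by blast
  define t where "t = (a div 2 ^ m, b div 2 ^ m)"
  have t: "t \<in> S" using ch_set_ancestor[OF ab(1)] dsq_ancestor[OF ab(2)] by (simp add: S_def t_def)
  have "(a mod 2 ^ m, b mod 2 ^ m) \<in> ch_set (sh k (fst t) (snd t) \<omega>) m"
    using ch_set_sh[of "a mod 2 ^ m" m "b mod 2 ^ m" "a div 2 ^ m" "b div 2 ^ m" \<omega> k] ab(1)
    unfolding t_def fst_conv snd_conv div_mult_mod_eq by simp
  moreover have "f t \<le> m" unfolding m_def using t finS by (intro member_le_sum) auto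
  ultimately have "ch_set (sh k (fst t) (snd t) \<omega>) (f t) \<noteq> {}"
    using ch_set_nonempty_antimono[of _ "f t" "m - f t"] by auto
  then show False using f[OF t] by simp
qed

text \<open>The unions of chosen closed squares form a decreasing sequence of nonempty compact
  sets.\<close>

lemma alive_iff_ES: "alive \<omega> \<longleftrightarrow> ES \<omega> \<noteq> {}"
proof
  assume "ES \<omega> \<noteq> {}"
  then show "alive \<omega>" unfolding alive_def using ES_D by fastforce
next
  assume al: "alive \<omega>"
  define C where "C n = (\<Union>(i, j)\<in>ch_set \<omega> n. dsq n i j)" for n
  have "(\<Inter>n. C n) \<noteq> {}"
  proof (rule compact_nest)
    fix n
    have "compact (dsq n i j)" for i j
      unfolding dyadic_square_def by (intro compact_Times) auto
    then show "compact (C n)" unfolding C_def by (intro compact_UN) auto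
    obtain i j where "(i, j) \<in> ch_set \<omega> n" using al unfolding alive_def by fastforce
    moreover have "(real i / 2 ^ n, real j / 2 ^ n) \<in> dsq n i j" by (auto simp: dsq_iff cell_def divide_right_mono)
    ultimately show "C n \<noteq> {}" unfolding C_def by blast
  next
    fix m n :: nat assume "m \<le> n"
    then obtain d where n: "n = m + d" using le_Suc_ex by blast
    show "C n \<subseteq> C m"
      unfolding C_def n using ch_set_ancestor dsq_ancestor by fast
  qed
  then obtain z where "\<And>n. z \<in> C n" by auto
  then have "z \<in> ES \<omega>" unfolding C_def ES_def by blast
  then show "ES \<omega> \<noteq> {}" by auto
qed

section \<open>Good squares block lines\<close>

text \<open>The parameters at which the line lies in chosen squares of level \<open>n\<close> form a
  decreasing sequence of compact sets. They are nonempty because \<open>good_hits\<close> finds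
  chosen squares on the line at arbitrarily deep levels.\<close>

lemma good_blocks_root:
  assumes good: "good \<omega>" and st: "(s, t) \<in> lines" "(0, 0) \<in> hit s t 0"
  shows "\<exists>v\<in>{0..1}. (v, s * v + t) \<in> ES \<omega>"
proof -
  define C where "C n = {v \<in> {0..1}. \<exists>(a, b)\<in>ch_set \<omega> n. (v, s * v + t) \<in> dsq n a b}" for n
  have anti: "C (n + d) \<subseteq> C n" for n d
    unfolding C_def using ch_set_ancestor[of _ _ \<omega> n d] dsq_ancestor[of _ n d] by fast
  have "(\<Inter>n. C n) \<noteq> {}"
  proof (rule compact_nest)
    fix n
    have "C n = (\<Union>(a, b)\<in>ch_set \<omega> n. {0..1} \<inter> (\<lambda>v. (v, s * v + t)) -` dsq n a b)"
      unfolding C_def by auto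
    also have "compact \<dots>"
    proof (intro compact_UN finite_ch_set)
      fix x :: "nat \<times> nat"
      have "closed ((\<lambda>v. (v, s * v + t)) -` dsq n a b)" for a b
        by (intro closed_vimage closed_dsq continuous_intros)
      then show "compact (case x of (a, b) \<Rightarrow> {0..1} \<inter> (\<lambda>v. (v, s * v + t)) -` dsq n a b)"
        by (cases x) (auto intro: compact_Int_closed)
    qed
    finally show "compact (C n)" .
    \<comment> \<open>\<open>good_hits\<close> speaks only of multiples of \<open>r0\<close>; this
      one is at least \<open>n\<close>.\<close>
    define N where "N = r0 * (n + m0)"
    obtain a b q where ab: "(a, b) \<in> ch_set \<omega> N" "q < 4" "row s t N (4 * a + q) = int b"
      using good_hits[OF good st, of n] by (auto simp: N_def hit_def)
    define v where "v = (real a + real q / 4) / 2 ^ N"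
    have v: "2 ^ N * v = real a + real q / 4" by (simp add: v_def)
    have q: "real q / 4 \<le> 1" using ab(2) by simp
    then have va: "v \<in> cell N a" unfolding cell_iff v by simp
    have "s / 4 * real (4 * a + q) + 2 ^ N * t = 2 ^ N * (s * v + t)"
      using v by (simp add: algebra_simps)
    then have "s * v + t \<in> cell N b"
      using ab(3) unfolding cell_iff row_def by (simp add: floor_eq_iff)
    then have "v \<in> C N" using va ab(1) cell_unit[OF va] unfolding C_def
      by (auto simp: dsq_iff ch_set_def intro!: bexI[of _ "(a, b)"])
    moreover have "n \<le> N" unfolding N_def using mult_le_mono[of 1 r0 n "n + m0"] r0(1) by simp
    ultimately show "C n \<noteq> {}" using anti[of n "N - n"] by auto
  next
    fix m n :: nat assume "m \<le> n"
    then show "C n \<subseteq> C m" using anti[of m "n - m"] by simp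
  qed
  then obtain v where v: "\<And>n. v \<in> C n" by auto
  have "(v, s * v + t) \<in> ES \<omega>" using v unfolding C_def ES_def by blast
  moreover have "v \<in> {0..1}" using v[of 0] unfolding C_def by simp
  ultimately show ?thesis by blast
qed

text \<open>Magnifying the square to the unit square keeps the slope and turns the intercept into
  \<open>t'\<close>, which reduces the claim to the root.\<close>

lemma good_blocks:
  assumes good: "good (sh k i j \<omega>)" and ch: "(i, j) \<in> ch_set \<omega> k"
    and st: "\<bar>s\<bar> \<le> 1" "(i, j) \<in> hit s t k"
  shows "\<exists>u\<in>cell k i. (u, s * u + t) \<in> ES \<omega>"
proof -
  define t' where "t' = s * real i + 2 ^ k * t - real j"
  obtain q where q: "q < 4" "row s t k (4 * i + q) = int j" "row s t k (4 * i + q + 1) = int j"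
    using st(2) by (auto simp: hit_def)
  have r: "row s t' 0 q' = row s t k (4 * i + q') - int j" for q'
  proof -
    have "s / 4 * real q' + 2 ^ 0 * t' = (s / 4 * real (4 * i + q') + 2 ^ k * t) - of_int (int j)"
      by (simp add: t'_def algebra_simps)
    then show ?thesis unfolding row_def by (metis floor_diff_of_int)
  qed
  have r0: "row s t' 0 q = 0" "row s t' 0 (q + 1) = 0" using r[of q] r[of "q + 1"] q by (simp_all add: add.assoc)
  then have hit: "(0, 0) \<in> hit s t' 0" using q(1) by (auto simp: hit_def intro!: exI[of _ q])
  have "\<bar>s / 4 * real q\<bar> \<le> 1"
  proof -
    have "\<bar>s\<bar> * real q \<le> 1 * 4" using st(1) q(1) by (intro mult_mono) auto
    then show ?thesis by (simp add: abs_mult)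
  qed
  moreover have "0 \<le> s / 4 * real q + t'" "s / 4 * real q + t' < 1"
    using r0(1) unfolding row_def by (simp_all add: floor_eq_iff)
  ultimately have "(s, t') \<in> lines" using st(1) by (auto simp: lines_def)
  then obtain v where v: "v \<in> {0..1}" "(v, s * v + t') \<in> ES (sh k i j \<omega>)"
    using good_blocks_root[OF good _ hit] by blast
  define u where "u = (real i + v) / 2 ^ k"
  have "(real j + (s * v + t')) / 2 ^ k = s * u + t" by (simp add: u_def t'_def field_simps)
  then have "(u, s * u + t) \<in> ES \<omega>" using ES_scale[OF ch v(2)] by (simp add: u_def)
  moreover have "u \<in> cell k i" using v(1) by (auto simp: u_def cell_def divide_right_mono)
  ultimately show ?thesis by blast
qed

end


section \<open>Counting visible squares\<close>

lemma closed_segment_line: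
  fixes a x :: "real \<times> real"
  assumes ne: "fst a \<noteq> fst x"
    and u: "min (fst x) (fst a) \<le> u" "u \<le> max (fst x) (fst a)"
  defines "s \<equiv> (snd a - snd x) / (fst a - fst x)"
  shows "(u, snd x + s * (u - fst x)) \<in> closed_segment a x"
proof -
  define l where "l = (u - fst a) / (fst x - fst a)"
  have l: "l * (fst x - fst a) = u - fst a" using ne by (simp add: l_def)
  have s: "snd a = snd x + s * (fst a - fst x)" using ne by (simp add: s_def)
  have "0 \<le> l" "l \<le> 1"
  proof -
    show "0 \<le> l" unfolding l_def using u ne by (cases "fst x < fst a") (auto simp: divide_simps min_def max_def split: if_splits)
    show "l \<le> 1" unfolding l_def using u ne by (cases "fst x < fst a") (auto simp: divide_simps min_def max_def split: if_splits)
  qed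
  moreover have "(u, snd x + s * (u - fst x)) = (1 - l) *\<^sub>R a + l *\<^sub>R x"
  proof (rule prod_eqI)
    show "fst (u, snd x + s * (u - fst x)) = fst ((1 - l) *\<^sub>R a + l *\<^sub>R x)"
      using l by (simp add: algebra_simps)
    have "snd ((1 - l) *\<^sub>R a + l *\<^sub>R x) = snd a + l * (snd x - snd a)" by (simp add: algebra_simps)
    also have "\<dots> = snd x + s * (fst a - fst x) + l * (- (s * (fst a - fst x)))" unfolding s by simp
    also have "\<dots> = snd x + s * (fst a - fst x) + s * (l * (fst x - fst a))" by (simp add: algebra_simps)
    also have "\<dots> = snd x + s * (u - fst x)" unfolding l by (simp add: algebra_simps)
    finally show "snd (u, snd x + s * (u - fst x)) = snd ((1 - l) *\<^sub>R a + l *\<^sub>R x)" by simp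
  qed
  ultimately show ?thesis unfolding closed_segment_def by blast
qed

text \<open>Over one quarter column the line moves by at most a quarter of a row, so from the middle
  half of the row it reaches both ends of that quarter column without leaving the row.\<close>

lemma near_middle_hit:
  assumes s: "\<bar>s\<bar> \<le> 1" and u: "u \<in> cell k i" and ij: "i < 2 ^ k" "j < 2 ^ k"
    and v: "real j + 1 / 4 < 2 ^ k * (s * u + t)" "2 ^ k * (s * u + t) < real j + 3 / 4"
  shows "(i, j) \<in> hit s t k"
proof -
  define y where "y = 4 * (2 ^ k * u - real i)"
  have y: "0 \<le> y" "y \<le> 4" using u unfolding cell_iff y_def by auto
  have "\<exists>q<4. real q \<le> y \<and> y \<le> real q + 1"
  proof (cases "y < 4")
    case True
    then have "nat \<lfloor>y\<rfloor> < 4" using y by (simp add: nat_less_iff floor_less_iff)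
    moreover have "real (nat \<lfloor>y\<rfloor>) \<le> y \<and> y \<le> real (nat \<lfloor>y\<rfloor>) + 1" using y by (simp add: of_nat_nat)
    ultimately show ?thesis by blast
  next
    case False
    then show ?thesis using y by (intro exI[of _ 3]) auto
  qed
  then obtain q where q: "q < 4" "real q \<le> y" "y \<le> real q + 1" by blast
  have "row s t k (4 * i + q') = int j" if q': "q' = q \<or> q' = q + 1" for q'
  proof -
    have "s / 4 * real (4 * i + q') + 2 ^ k * t = 2 ^ k * (s * u + t) + s * (real q' - y) / 4"
      by (simp add: y_def field_simps)
    moreover have "\<bar>s * (real q' - y) / 4\<bar> \<le> 1 / 4"
    proof -
      have "\<bar>real q' - y\<bar> \<le> 1" using q q' by auto
      then have "\<bar>s\<bar> * \<bar>real q' - y\<bar> \<le> 1 * 1" using s by (intro mult_mono) auto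
      then show ?thesis by (simp add: abs_mult)
    qed
    ultimately have "real j \<le> s / 4 * real (4 * i + q') + 2 ^ k * t" "s / 4 * real (4 * i + q') + 2 ^ k * t < real j + 1"
      using v by linarith+
    then show ?thesis unfolding row_def by (simp add: floor_eq_iff)
  qed
  from this[of q] this[of "q + 1"] show ?thesis
    unfolding hit_def using q(1) ij by (auto simp: add.assoc intro!: exI[of _ q])
qed

lemma card_hit_column: "card {j. (i, j) \<in> hit s t k} \<le> 4"
proof -
  have "{j. (i, j) \<in> hit s t k} \<subseteq> (\<lambda>q. nat (row s t k (4 * i + q))) ` {..<4}"
    by (force simp: hit_def)
  then have "card {j. (i, j) \<in> hit s t k} \<le> card ((\<lambda>q. nat (row s t k (4 * i + q))) ` {..<4})"
    by (intro card_mono) auto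
  also have "\<dots> \<le> 4" using card_image_le[of "{..<4::nat}"] by force
  finally show ?thesis .
qed

lemma card_cells: "card {i. c \<in> cell k i} \<le> 2" "finite {i. c \<in> cell k i}"
proof -
  have "i \<in> {nat \<lceil>2 ^ k * c\<rceil> - 1, nat \<lfloor>2 ^ k * c\<rfloor>}" if "c \<in> cell k i" for i
  proof -
    have "int i \<le> \<lfloor>2 ^ k * c\<rfloor>" "\<lceil>2 ^ k * c\<rceil> \<le> int i + 1" "\<lfloor>2 ^ k * c\<rfloor> \<le> \<lceil>2 ^ k * c\<rceil>" "\<lceil>2 ^ k * c\<rceil> \<le> \<lfloor>2 ^ k * c\<rfloor> + 1"
      using that unfolding cell_iff by linarith+
    then have "\<lfloor>2 ^ k * c\<rfloor> = int i \<or> \<lceil>2 ^ k * c\<rceil> = int (i + 1)" by linarith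
    then have "nat \<lfloor>2 ^ k * c\<rfloor> = i \<or> nat \<lceil>2 ^ k * c\<rceil> = i + 1" by (elim disjE) (simp_all only: nat_int simp_thms)
    then show ?thesis by auto
  qed
  then have sub: "{i. c \<in> cell k i} \<subseteq> {nat \<lceil>2 ^ k * c\<rceil> - 1, nat \<lfloor>2 ^ k * c\<rfloor>}" by blast
  show "finite {i. c \<in> cell k i}" by (rule finite_subset[OF sub]) simp
  have "card {i. c \<in> cell k i} \<le> card {nat \<lceil>2 ^ k * c\<rceil> - 1, nat \<lfloor>2 ^ k * c\<rfloor>}"
    by (rule card_mono[OF _ sub]) simp
  also have "\<dots> \<le> 2" by (simp add: card_insert_if)
  finally show "card {i. c \<in> cell k i} \<le> 2" .
qed

text \<open>
  A visible point \<open>a\<close> counts towards direction class 1 if the line through \<open>x\<close> and \<open>a\<close> has slope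
  in \<open>[-1,1]\<close>; the other points are dealt with by exchanging the coordinates.
\<close>

definition class1 :: "conf \<Rightarrow> real \<times> real \<Rightarrow> (real \<times> real) set" where
  "class1 \<omega> x = {a \<in> visible_part x (ES \<omega>). \<bar>snd a - snd x\<bar> \<le> \<bar>fst a - fst x\<bar>}"

text \<open>The bounds exceed 1/4 and stay below 3/4 by 1/16, so any line passing within 1/16 of a
  row of such a point still satisfies \<open>near_middle_hit\<close>.\<close>

definition middle :: "nat \<Rightarrow> nat \<Rightarrow> real \<times> real \<Rightarrow> bool" where
  "middle k j a \<longleftrightarrow> real j + 5 / 16 < 2 ^ k * snd a \<and> 2 ^ k * snd a < real j + 11 / 16"

definition mid_vis :: "conf \<Rightarrow> real \<times> real \<Rightarrow> nat \<Rightarrow> (nat \<times> nat) set" where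
  "mid_vis \<omega> x k = {(i, j) \<in> ch_set \<omega> k. \<exists>a\<in>class1 \<omega> x. a \<in> dsq k i j \<and> middle k j a}"

context percolation_tree
begin

text \<open>All points of \<open>W\<close> are seen from \<open>x\<close> in almost the same
  direction. The line to the farthest of them therefore hits every square of \<open>W\<close>, while
  its segment up to that point is free of the set. Good squares in columns strictly inside the
  segment would block it, so there are at most \<open>N\<close> chosen squares on it; the at most
  four end columns contain at most four hit squares each. The number \<open>e\<close> is the
  vertical edge of the unit square on the side of the points, where the rays of the tube have spread
  at least as far as at any of these points.\<close>

lemma tube_count:
  fixes W :: "(nat \<times> nat) set" and a :: "nat \<times> nat \<Rightarrow> real \<times> real" and R :: bool and x :: "real \<times> real"
  defines "e \<equiv> (if R then 1 else 0 :: real)"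
    and "sl \<equiv> \<lambda>P. (snd (a P) - snd x) / (fst (a P) - fst x)"
  assumes x: "x \<notin> ES \<omega>" and unb: "\<not> unblocked k N \<omega>" and W: "W \<subseteq> ch_set \<omega> k"
    and a: "\<And>P. P \<in> W \<Longrightarrow> a P \<in> class1 \<omega> x" "\<And>P. P \<in> W \<Longrightarrow> a P \<in> dsq k (fst P) (snd P)"
      "\<And>P. P \<in> W \<Longrightarrow> middle k (snd P) (a P)"
    and R: "\<And>P. P \<in> W \<Longrightarrow> R \<longleftrightarrow> fst x < fst (a P)"
    and close: "\<And>P P'. P \<in> W \<Longrightarrow> P' \<in> W \<Longrightarrow> \<bar>sl P * (e - fst x) - sl P' * (e - fst x)\<bar> * 2 ^ k \<le> 1 / 16"
  shows "card W \<le> N + 16"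
proof (cases "W = {}")
  case False
  have finW: "finite W" by (rule finite_subset[OF W]) simp
  have vis: "a P \<in> ES \<omega>" "closed_segment (a P) x \<inter> ES \<omega> = {a P}"
    and cl: "\<bar>snd (a P) - snd x\<bar> \<le> \<bar>fst (a P) - fst x\<bar>" if "P \<in> W" for P
    using a(1)[OF that] by (auto simp: class1_def visible_part_def)
  have ne: "fst (a P) \<noteq> fst x" if "P \<in> W" for P
  proof
    assume *: "fst (a P) = fst x"
    then have "a P = x" using cl[OF that] by (simp add: prod_eq_iff)
    then show False using vis(1)[OF that] x by simp
  qed
  have sl1: "\<bar>sl P\<bar> \<le> 1" if "P \<in> W" for P
    unfolding sl_def using cl[OF that] ne[OF that] by (simp add: abs_divide divide_le_eq_1)
  have aline: "snd (a P) = snd x + sl P * (fst (a P) - fst x)" if "P \<in> W" for P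
    unfolding sl_def using ne[OF that] by simp
  have unit: "0 \<le> fst (a P)" "fst (a P) \<le> 1" "0 \<le> snd (a P)" "snd (a P) \<le> 1" if "P \<in> W" for P
    using ES_unit[of "fst (a P)" "snd (a P)" \<omega>] vis(1)[OF that] by simp_all
  \<comment> \<open>With \<open>Q\<close> farthest horizontally and all points on one side, the
    segment from \<open>x\<close> to \<open>a Q\<close> passes over the abscissae of all other
    points.\<close>
  obtain Q where Q: "Q \<in> W" "\<And>P. P \<in> W \<Longrightarrow> \<bar>fst (a P) - fst x\<bar> \<le> \<bar>fst (a Q) - fst x\<bar>"
    using obtains_MAX[OF finW False, of "\<lambda>P. \<bar>fst (a P) - fst x\<bar>"] Max_ge[of "(\<lambda>P. \<bar>fst (a P) - fst x\<bar>) ` W"] finW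
    by (metis finite_imageI imageI)
  define s t where "s = sl Q" and "t = snd x - sl Q * fst x"
  have line: "s * u + t = snd x + sl Q * (u - fst x)" for u
    by (simp add: s_def t_def algebra_simps)
  have st: "(s, t) \<in> lines"
  proof -
    have "t = snd (a Q) - sl Q * fst (a Q)" using aline[OF Q(1)] by (simp add: t_def algebra_simps)
    moreover have "\<bar>sl Q * fst (a Q)\<bar> \<le> 1 * 1"
      unfolding abs_mult using sl1[OF Q(1)] unit[OF Q(1)] by (intro mult_mono) auto
    ultimately show ?thesis using unit[OF Q(1)] sl1[OF Q(1)] by (auto simp: lines_def s_def)
  qed
  define lo hi where "lo = min (fst x) (fst (a Q))" and "hi = max (fst x) (fst (a Q))"
  have between: "lo \<le> fst (a P)" "fst (a P) \<le> hi" if "P \<in> W" for P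
    using Q(2)[OF that] R[OF that] R[OF Q(1)] unfolding lo_def hi_def by (auto simp: min_def max_def)
  have hitW: "P \<in> hit s t k" if P: "P \<in> W" for P
  proof -
    define u where "u = fst (a P)"
    \<comment> \<open>Two lines through \<open>x\<close> diverge linearly, so their gap at
      \<open>u\<close> is at most their gap at the edge \<open>e\<close>.\<close>
    have "\<bar>u - fst x\<bar> \<le> \<bar>e - fst x\<bar>"
      using R[OF P] unit[OF P] ne[OF P] unfolding u_def e_def by (auto split: if_splits)
    then have "\<bar>sl Q - sl P\<bar> * \<bar>u - fst x\<bar> * 2 ^ k \<le> \<bar>sl Q - sl P\<bar> * \<bar>e - fst x\<bar> * 2 ^ k"
      by (intro mult_right_mono mult_left_mono) auto
    also have "\<dots> = \<bar>sl Q * (e - fst x) - sl P * (e - fst x)\<bar> * 2 ^ k"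
      by (simp add: abs_mult[symmetric] left_diff_distrib)
    also have "\<dots> \<le> 1 / 16" by (rule close[OF Q(1) P])
    finally have "\<bar>2 ^ k * ((sl Q - sl P) * (u - fst x))\<bar> \<le> 1 / 16"
      by (simp add: abs_mult mult.commute mult.left_commute)
    moreover have "2 ^ k * (s * u + t) = 2 ^ k * snd (a P) + 2 ^ k * ((sl Q - sl P) * (u - fst x))"
    proof -
      have *: "snd (a P) = snd x + sl P * (u - fst x)" using aline[OF P] by (simp add: u_def)
      show ?thesis unfolding line * by (simp add: algebra_simps)
    qed
    ultimately have "real (snd P) + 1 / 4 < 2 ^ k * (s * u + t)" "2 ^ k * (s * u + t) < real (snd P) + 3 / 4"
      using a(3)[OF P] unfolding middle_def by linarith+
    moreover have "u \<in> cell k (fst P)" using a(2)[OF P] dsq_iff[of "fst (a P)" "snd (a P)"] by (simp add: u_def)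
    moreover have "fst P < 2 ^ k" "snd P < 2 ^ k" using P W by (auto simp: ch_set_def)
    ultimately have "(fst P, snd P) \<in> hit s t k"
      using st by (intro near_middle_hit) (auto simp: lines_def)
    then show ?thesis by simp
  qed
  \<comment> \<open>The columns whose closed cells lie strictly between \<open>lo\<close> and
    \<open>hi\<close>, clipped since \<open>x\<close> may be outside the unit square.\<close>
  define c0 c1 where "c0 = min (2 ^ k) (nat (\<lfloor>2 ^ k * lo\<rfloor> + 1))" and "c1 = min (2 ^ k) (nat (\<lceil>2 ^ k * hi\<rceil> - 1))"
  have cols: "i \<in> {c0..<c1} \<longleftrightarrow> 2 ^ k * lo < real i \<and> real i + 1 < 2 ^ k * hi" if "i < 2 ^ k" for i
  proof -
    have "c0 \<le> i \<longleftrightarrow> \<lfloor>2 ^ k * lo\<rfloor> < int i"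
      unfolding c0_def using that by (auto simp: min_le_iff_disj nat_le_iff)
    moreover have "i < c1 \<longleftrightarrow> int i + 1 < \<lceil>2 ^ k * hi\<rceil>"
      unfolding c1_def using that by (auto simp: zless_nat_eq_int_zless)
    ultimately show ?thesis by (simp add: floor_less_iff less_ceiling_iff)
  qed
  define S where "S = hit s t k \<inter> {c0..<c1} \<times> UNIV"
  have ng: "\<not> good (sh k i j \<omega>)" if ij: "(i, j) \<in> S \<inter> ch_set \<omega> k" for i j
  proof
    assume good: "good (sh k i j \<omega>)"
    have i: "2 ^ k * lo < real i" "real i + 1 < 2 ^ k * hi" "(i, j) \<in> hit s t k" "(i, j) \<in> ch_set \<omega> k"
      using ij cols[of i] by (auto simp: S_def ch_set_def)
    obtain u where u: "u \<in> cell k i" "(u, s * u + t) \<in> ES \<omega>"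
      using good_blocks[OF good i(4) _ i(3)] sl1[OF Q(1)] unfolding s_def by blast
    have "2 ^ k * lo < 2 ^ k * u" "2 ^ k * u < 2 ^ k * hi" using i u(1) unfolding cell_iff by linarith+
    then have lu: "lo < u" "u < hi" by simp_all
    then have "(u, snd x + sl Q * (u - fst x)) \<in> closed_segment (a Q) x"
      \<comment> \<open>The blocking point lies on the segment from \<open>a Q\<close> to
        \<open>x\<close>, so visibility forces it to be \<open>a Q\<close>, contrary to the strict
        column bounds.\<close>
      unfolding sl_def lo_def hi_def by (intro closed_segment_line ne[OF Q(1)]) auto
    then have "(u, s * u + t) = a Q" using vis(2)[OF Q(1)] u(2) unfolding line by blast
    then have "u = fst (a Q)" by (metis fst_conv)
    then show False using lu unfolding lo_def hi_def by (auto simp: min_def max_def split: if_splits)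
  qed
  have "c0 \<le> 2 ^ k" "c1 \<le> 2 ^ k" by (simp_all add: c0_def c1_def)
  then have "\<not> all_fail k N S \<omega>" using unb st unfolding unblocked_def S_def by blast
  then have cS: "card (S \<inter> ch_set \<omega> k) \<le> N" using ng unfolding all_fail_def by auto
  \<comment> \<open>End columns, where a blocking point could lie beyond the segment. A real number
    is in at most two closed cells.\<close>
  define C where "C = {i. lo \<in> cell k i} \<union> {i. hi \<in> cell k i}"
  have finC: "finite C" unfolding C_def using card_cells(2) by simp
  have "card C \<le> 2 + 2" unfolding C_def by (rule order_trans[OF card_Un_le add_mono[OF card_cells(1) card_cells(1)]])
  then have cC: "card C \<le> 4" by simp
  have sub: "W \<subseteq> (S \<inter> ch_set \<omega> k) \<union> (SIGMA i:C. {j. (i, j) \<in> hit s t k})"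
  proof
    fix P assume P: "P \<in> W"
    obtain i j where ij: "P = (i, j)" by (cases P)
    have u: "fst (a P) \<in> cell k i" using a(2)[OF P] dsq_iff[of "fst (a P)" "snd (a P)"] by (simp add: ij)
    have m: "2 ^ k * lo \<le> 2 ^ k * fst (a P)" "2 ^ k * fst (a P) \<le> 2 ^ k * hi" using between[OF P] by simp_all
    have lt: "i < 2 ^ k" using P W ij by (auto simp: ch_set_def)
    show "P \<in> (S \<inter> ch_set \<omega> k) \<union> (SIGMA i:C. {j. (i, j) \<in> hit s t k})"
    proof (cases "i \<in> {c0..<c1}")
      case True
      then show ?thesis using hitW[OF P] W P by (auto simp: S_def ij)
    next
      case False
      then have "real i \<le> 2 ^ k * lo \<or> 2 ^ k * hi \<le> real i + 1" using cols[OF lt] by linarith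
      then have "(real i \<le> 2 ^ k * lo \<and> 2 ^ k * lo \<le> real i + 1) \<or> (real i \<le> 2 ^ k * hi \<and> 2 ^ k * hi \<le> real i + 1)"
        using u m unfolding cell_iff by linarith
      then have "i \<in> C" unfolding C_def cell_iff by blast
      then show ?thesis using hitW[OF P] by (simp add: ij)
    qed
  qed
  have fin2: "finite {j. (i, j) \<in> hit s t k}" for i
    by (rule finite_subset[of _ "{..<2 ^ k}"]) (auto simp: hit_def)
  have "card W \<le> card ((S \<inter> ch_set \<omega> k) \<union> (SIGMA i:C. {j. (i, j) \<in> hit s t k}))"
    using finC fin2 by (intro card_mono[OF _ sub]) auto
  also have "\<dots> \<le> card (S \<inter> ch_set \<omega> k) + card (SIGMA i:C. {j. (i, j) \<in> hit s t k})" by (rule card_Un_le)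
  also have "card (SIGMA i:C. {j. (i, j) \<in> hit s t k}) = (\<Sum>i\<in>C. card {j. (i, j) \<in> hit s t k})"
    using finC fin2 by (intro card_SigmaI) auto
  also have "\<dots> \<le> (\<Sum>i\<in>C. 4)" by (intro sum_mono card_hit_column)
  also have "\<dots> \<le> 16" using cC by simp
  finally show ?thesis using cS by linarith
qed simp

text \<open>Sort the points by their side of \<open>x\<close> and by the height, in steps of
  \<open>1 / (16 * 2 ^ k)\<close>, at which their ray meets the edge line. Each class satisfies
  \<open>tube_count\<close>, and there are at most \<open>2 * (48 * 2 ^ k + 1)\<close>
  classes.\<close>

lemma card_mid_vis:
  assumes x: "x \<notin> ES \<omega>" and unb: "\<not> unblocked k N \<omega>"
  shows "card (mid_vis \<omega> x k) \<le> 100 * 2 ^ k * (N + 16)"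
proof -
  have "\<forall>P. \<exists>a. P \<in> mid_vis \<omega> x k \<longrightarrow> a \<in> class1 \<omega> x \<and> a \<in> dsq k (fst P) (snd P) \<and> middle k (snd P) a"
    unfolding mid_vis_def by fastforce
  then obtain a where a: "\<And>P. P \<in> mid_vis \<omega> x k \<Longrightarrow> a P \<in> class1 \<omega> x \<and> a P \<in> dsq k (fst P) (snd P) \<and> middle k (snd P) (a P)"
    by metis
  define R where "R P \<longleftrightarrow> fst x < fst (a P)" for P
  define e where "e P = (if R P then 1 else 0 :: real)" for P
  define sl where "sl P = (snd (a P) - snd x) / (fst (a P) - fst x)" for P
  define key where "key P = (R P, \<lfloor>16 * 2 ^ k * (snd x + sl P * (e P - fst x))\<rfloor>)" for P
  define K where "K = (UNIV :: bool set) \<times> {-(16 * 2 ^ k)..32 * 2 ^ k :: int}"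
  have finV: "finite (mid_vis \<omega> x k)" unfolding mid_vis_def by (rule finite_subset[OF _ finite_ch_set]) auto
  have keyK: "key P \<in> K" if P: "P \<in> mid_vis \<omega> x k" for P
  proof -
    have cl: "\<bar>snd (a P) - snd x\<bar> \<le> \<bar>fst (a P) - fst x\<bar>" and E: "a P \<in> ES \<omega>"
      using a[OF P] by (auto simp: class1_def visible_part_def)
    have ne: "fst (a P) \<noteq> fst x"
    proof
      assume *: "fst (a P) = fst x"
      then have "a P = x" using cl by (simp add: prod_eq_iff)
      then show False using E x by simp
    qed
    have sl1: "\<bar>sl P\<bar> \<le> 1" unfolding sl_def using cl ne by (simp add: abs_divide divide_le_eq_1)
    have unit: "0 \<le> fst (a P)" "fst (a P) \<le> 1" "0 \<le> snd (a P)" "snd (a P) \<le> 1"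
      using ES_unit[of "fst (a P)" "snd (a P)" \<omega>] E by simp_all
    \<comment> \<open>Measured from the point instead of \<open>x\<close>, which may be far away,
      the ray climbs at most 1 before the edge; so the height is in \<open>[-1, 2]\<close>.\<close>
    have "snd x + sl P * (e P - fst x) = snd (a P) + sl P * (e P - fst (a P))"
      unfolding sl_def using ne by (simp add: field_simps)
    moreover have "\<bar>sl P * (e P - fst (a P))\<bar> \<le> 1 * 1"
      unfolding abs_mult using sl1 unit by (intro mult_mono) (auto simp: e_def)
    ultimately have "-1 \<le> snd x + sl P * (e P - fst x)" "snd x + sl P * (e P - fst x) \<le> 2" using unit by linarith+
    note bounds = this
    define Y where "Y = 16 * 2 ^ k * (snd x + sl P * (e P - fst x))"
    have "16 * 2 ^ k * (-1) \<le> Y" "Y \<le> 16 * 2 ^ k * 2"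
      unfolding Y_def by (intro mult_left_mono bounds; simp)+
    then have "-(16 * 2 ^ k) \<le> \<lfloor>Y\<rfloor>" "\<lfloor>Y\<rfloor> \<le> 32 * 2 ^ k"
      by (simp_all add: le_floor_iff floor_le_iff)
    then have "-(16 * 2 ^ k) \<le> \<lfloor>16 * 2 ^ k * (snd x + sl P * (e P - fst x))\<rfloor>"
      "\<lfloor>16 * 2 ^ k * (snd x + sl P * (e P - fst x))\<rfloor> \<le> 32 * 2 ^ k"
      unfolding Y_def .
    then show ?thesis by (simp add: key_def K_def)
  qed
  have fib: "card {P \<in> mid_vis \<omega> x k. key P = \<kappa>} \<le> N + 16" for \<kappa>
  proof (rule tube_count[where a=a and R="fst \<kappa>" and k=k and \<omega>=\<omega> and x=x])
    fix P P' assume PP: "P \<in> {P \<in> mid_vis \<omega> x k. key P = \<kappa>}" "P' \<in> {P \<in> mid_vis \<omega> x k. key P = \<kappa>}"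
    define y y' where "y = snd x + sl P * ((if fst \<kappa> then 1 else 0) - fst x)"
      and "y' = snd x + sl P' * ((if fst \<kappa> then 1 else 0) - fst x)"
    have "\<lfloor>16 * 2 ^ k * y\<rfloor> = \<lfloor>16 * 2 ^ k * y'\<rfloor>"
      using PP by (auto simp: key_def e_def y_def y'_def)
    then have "\<bar>16 * 2 ^ k * y - 16 * 2 ^ k * y'\<bar> \<le> 1" by linarith
    then have "\<bar>16 * 2 ^ k * (y - y')\<bar> \<le> 1" by (simp add: right_diff_distrib)
    then have "\<bar>y - y'\<bar> * 2 ^ k \<le> 1 / 16" by (simp add: abs_mult mult.commute)
    then show "\<bar>(snd (a P) - snd x) / (fst (a P) - fst x) * ((if fst \<kappa> then 1 else 0) - fst x) -
      (snd (a P') - snd x) / (fst (a P') - fst x) * ((if fst \<kappa> then 1 else 0) - fst x)\<bar> * 2 ^ k \<le> 1 / 16"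
      by (simp add: y_def y'_def sl_def)
  qed (use a x unb in \<open>auto simp: mid_vis_def key_def R_def\<close>)
  have "mid_vis \<omega> x k = (\<Union>\<kappa>\<in>K. {P \<in> mid_vis \<omega> x k. key P = \<kappa>})" using keyK by blast
  then have "card (mid_vis \<omega> x k) = card (\<Union>\<kappa>\<in>K. {P \<in> mid_vis \<omega> x k. key P = \<kappa>})" by simp
  also have "\<dots> \<le> (\<Sum>\<kappa>\<in>K. card {P \<in> mid_vis \<omega> x k. key P = \<kappa>})" by (rule card_UN_le) (simp add: K_def)
  also have "\<dots> \<le> (\<Sum>\<kappa>\<in>K. N + 16)" using fib by (intro sum_mono) auto
  also have "\<dots> = card K * (N + 16)" by simp
  also have "card K = 2 * nat (48 * 2 ^ k + 1)" by (simp add: K_def card_cartesian_product)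
  also have "\<dots> \<le> 100 * 2 ^ k"
  proof -
    have "(1::int) \<le> 2 ^ k" by simp
    then have "48 * 2 ^ k + 1 \<le> (50::int) * 2 ^ k" by linarith
    then have "nat (48 * 2 ^ k + 1) \<le> 50 * 2 ^ k" by (simp add: nat_le_iff)
    then show ?thesis by simp
  qed
  finally show ?thesis by (simp add: mult_right_mono)
qed

end


section \<open>From midlines to all visible squares\<close>

definition vis_squares :: "conf \<Rightarrow> real \<times> real \<Rightarrow> nat \<Rightarrow> (nat \<times> nat) set" where
  "vis_squares \<omega> x n = {(i, j) \<in> ch_set \<omega> n. \<exists>a\<in>class1 \<omega> x. a \<in> dsq n i j}"

lemma odd_part: "0 < j \<Longrightarrow> \<exists>m J. j = 2 ^ m * (2 * J + (1::nat))"
proof (induction j rule: less_induct)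
  case (less j)
  show ?case
  proof (cases "even j")
    case True
    then obtain j' where j': "j = 2 * j'" by blast
    then obtain m J where "j' = 2 ^ m * (2 * J + 1)" using less.IH[of j'] less.prems by auto
    then show ?thesis using j' by (intro exI[of _ "Suc m"] exI[of _ J]) simp
  next
    case False
    then obtain J where "j = 2 * J + 1" by (rule oddE)
    then show ?thesis by (intro exI[of _ 0] exI[of _ J]) simp
  qed
qed

text \<open>
  A point that is not in the middle of its square of level \<open>n\<close> is close to a horizontal grid line,
  which is the midline of a unique larger square, or to the boundary of the unit square.
\<close>

lemma middle_ancestor:
  assumes ij: "(i, j) \<in> ch_set \<omega> n" and a: "a \<in> dsq n i j" and nm: "\<not> middle n j a"
    and edge: "0 < j" "j + 1 < 2 ^ n"
  shows "\<exists>d\<in>{1..n}. middle (n - d) (j div 2 ^ d) a \<and>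
    (j mod 2 ^ d = 2 ^ (d - 1) \<or> j mod 2 ^ d + 1 = 2 ^ (d - 1))"
proof -
  define v where "v = 2 ^ n * snd a - real j"
  have v: "0 \<le> v" "v \<le> 1"
    using a dsq_iff[of "fst a" "snd a" n i j] by (simp_all add: cell_iff v_def)
  have eq: "2 ^ (n - d) * snd a = (real j + v) / 2 ^ d" if "d \<le> n" for d
    using that by (simp add: v_def power_diff)
  have dle: "Suc m \<le> n" if "2 ^ m * (2 * J + 1) < (2::nat) ^ n" for m J
  proof (rule ccontr)
    assume "\<not> Suc m \<le> n"
    then have "(2::nat) ^ n \<le> 2 ^ m" by (intro power_increasing) auto
    also have "\<dots> \<le> 2 ^ m * (2 * J + 1)" by simp
    finally show False using that by simp
  qed
  consider "v \<le> 5 / 16" | "11 / 16 \<le> v" using nm unfolding middle_def v_def by linarith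
  then show ?thesis
  proof cases
    case 1
    \<comment> \<open>The power of 2 in \<open>j\<close> determines the level:
      \<open>j / 2 ^ n\<close> equals \<open>(J + 1 / 2) / 2 ^ (n - m - 1)\<close>.\<close>
    obtain m J where j: "j = 2 ^ m * (2 * J + 1)" using odd_part[OF edge(1)] by blast
    have d: "Suc m \<le> n" using dle[of m J] edge(2) j by simp
    have j2: "j = J * 2 ^ Suc m + 2 ^ m" unfolding j by (simp add: algebra_simps)
    have jd: "j div 2 ^ Suc m = J" and jm: "j mod 2 ^ Suc m = 2 ^ m"
      unfolding j2 by (simp_all add: div_mult_self3)
    have "2 ^ (n - Suc m) * snd a = real J + 1 / 2 + v / 2 ^ Suc m"
      unfolding eq[OF d] j2 by (simp add: field_simps)
    \<comment> \<open>The distance from the midline shrinks to at most 5/32 of a row of the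
      ancestor, less than the 3/16 that \<open>middle\<close> allows.\<close>
    moreover have "v / 2 ^ Suc m \<le> v / 2"
      using v by (intro divide_left_mono) (auto simp: self_le_power)
    moreover have "0 \<le> v / 2 ^ Suc m" using v by simp
    ultimately have "middle (n - Suc m) (j div 2 ^ Suc m) a"
      unfolding middle_def jd using 1 by linarith
    then show ?thesis using d jm by (intro bexI[of _ "Suc m"]) simp_all
  next
    case 2
    \<comment> \<open>The upper edge of the square, at height \<open>j + 1\<close>, takes the role
      of the lower one.\<close>
    obtain m J where j: "j + 1 = 2 ^ m * (2 * J + 1)" using odd_part[of "j + 1"] by auto
    have d: "Suc m \<le> n" using dle[of m J] edge(2) j by simp
    have p1: "(1::nat) \<le> 2 ^ m" by simp
    have j2: "j = J * 2 ^ Suc m + (2 ^ m - 1)" using j p1 by (simp add: algebra_simps)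
    define w where "w = 2 ^ m - (1::nat)"
    have lt: "w < 2 ^ Suc m" unfolding w_def using p1 by (simp add: less_imp_diff_less)
    have jd: "j div 2 ^ Suc m = J" unfolding j2 w_def[symmetric] using lt by simp
    have jm: "j mod 2 ^ Suc m = 2 ^ m - 1" unfolding j2 w_def[symmetric] using lt by simp
    have rj: "real j = real J * 2 ^ Suc m + 2 ^ m - 1"
    proof -
      have "real w = 2 ^ m - 1" unfolding w_def using p1 by (simp add: of_nat_diff)
      then show ?thesis unfolding j2 w_def[symmetric] by simp
    qed
    have "2 ^ (n - Suc m) * snd a = real J + 1 / 2 - (1 - v) / 2 ^ Suc m"
      unfolding eq[OF d] rj by (simp add: field_simps)
    moreover define w' where "w' = (1 - v) / 2 ^ Suc m"
    ultimately have eq': "2 ^ (n - Suc m) * snd a = real J + 1 / 2 - w'" by (simp only:)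
    have "w' \<le> (1 - v) / 2"
      unfolding w'_def using v by (intro divide_left_mono) (auto simp: self_le_power)
    then have 1: "w' \<le> 5 / 32" using 2 by (simp add: field_simps)
    have 0: "0 \<le> w'" unfolding w'_def using v by simp
    have "middle (n - Suc m) (j div 2 ^ Suc m) a" unfolding middle_def jd eq' using 0 1 by linarith
    then show ?thesis using d jm by (intro bexI[of _ "Suc m"]) simp_all
  qed
qed

lemma visible_part_sw:
  assumes a: "a \<in> visible_part x (ES \<omega>)"
  shows "prod.swap a \<in> visible_part (prod.swap x) (ES (sw \<omega>))"
proof -
  have ES: "z \<in> ES (sw \<omega>) \<longleftrightarrow> prod.swap z \<in> ES \<omega>" for z
    using ES_sw[of "fst z" "snd z" \<omega>] by (simp add: prod.swap_def)
  have seg: "z \<in> closed_segment (prod.swap a) (prod.swap x) \<longleftrightarrow> prod.swap z \<in> closed_segment a x" for z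
    unfolding closed_segment_def by (auto simp: prod_eq_iff)
  have "closed_segment (prod.swap a) (prod.swap x) \<inter> ES (sw \<omega>) = {prod.swap a}"
  proof (rule set_eqI)
    fix z
    have "z \<in> closed_segment (prod.swap a) (prod.swap x) \<inter> ES (sw \<omega>) \<longleftrightarrow> prod.swap z \<in> closed_segment a x \<inter> ES \<omega>"
      using ES[of z] seg[of z] by blast
    also have "\<dots> \<longleftrightarrow> prod.swap z = a" using a by (simp add: visible_part_def)
    also have "\<dots> \<longleftrightarrow> z \<in> {prod.swap a}" by (cases z; cases a) auto
    finally show "z \<in> closed_segment (prod.swap a) (prod.swap x) \<inter> ES (sw \<omega>) \<longleftrightarrow> z \<in> {prod.swap a}" .
  qed
  then show ?thesis using a ES by (auto simp: visible_part_def)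
qed

lemma class1_sw:
  assumes "a \<in> visible_part x (ES \<omega>)" "\<bar>fst a - fst x\<bar> \<le> \<bar>snd a - snd x\<bar>"
  shows "prod.swap a \<in> class1 (sw \<omega>) (prod.swap x)"
  using visible_part_sw[OF assms(1)] assms(2) by (simp add: class1_def)

text \<open>A closed dyadic square that meets the visible part may be unchosen or even lie outside
  the unit square, but it shares a point with a counted chosen square and so is one of its 9
  neighbours, itself included. Steep directions are counted after exchanging the
  coordinates.\<close>

lemma dyadic_count_le:
  "dyadic_count n (visible_part x (ES \<omega>)) \<le>
     9 * (card (vis_squares \<omega> x n) + card (vis_squares (sw \<omega>) (prod.swap x) n))"
    and finite_dyadic_vis: "finite {Q \<in> dyadic_squares n. Q \<inter> visible_part x (ES \<omega>) \<noteq> {}}"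
proof -
  define A where "A = vis_squares \<omega> x n \<union> prod.swap ` vis_squares (sw \<omega>) (prod.swap x) n"
  define h where "h = (\<lambda>((i, j), (d, e)). dyadic_square n (int i + d) (int j + e))"
  have finA: "finite A" unfolding A_def vis_squares_def
    by (auto intro: finite_subset[OF _ finite_ch_set])
  have close: "\<exists>d\<in>{-1..1}. l = int i + d" if "y \<in> cell n i" "real_of_int l / 2 ^ n \<le> y" "y \<le> (real_of_int l + 1) / 2 ^ n" for y i l
  proof -
    have "real_of_int l \<le> 2 ^ n * y" "2 ^ n * y \<le> real_of_int l + 1"
      using that by (auto simp: field_simps)
    then have "real_of_int l \<le> real i + 1" "real i \<le> real_of_int l + 1" using that(1) unfolding cell_iff by linarith+
    then have "l \<le> int i + 1" "int i \<le> l + 1" by linarith+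
    then show ?thesis by (intro bexI[of _ "l - int i"]) auto
  qed
  have sub: "{Q \<in> dyadic_squares n. Q \<inter> visible_part x (ES \<omega>) \<noteq> {}} \<subseteq> h ` (A \<times> ({-1..1} \<times> {-1..1}))"
  proof
    fix Q assume "Q \<in> {Q \<in> dyadic_squares n. Q \<inter> visible_part x (ES \<omega>) \<noteq> {}}"
    then obtain l l' a where Q: "Q = dyadic_square n l l'" "a \<in> Q" "a \<in> visible_part x (ES \<omega>)"
      by (auto simp: dyadic_squares_def)
    have "\<exists>i j. (i, j) \<in> A \<and> a \<in> dsq n i j"
    proof (cases "\<bar>snd a - snd x\<bar> \<le> \<bar>fst a - fst x\<bar>")
      case True
      have "a \<in> ES \<omega>" using Q(3) by (simp add: visible_part_def)
      then obtain i j where ij: "(i, j) \<in> ch_set \<omega> n" "a \<in> dsq n i j" using ES_D by blast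
      moreover have "a \<in> class1 \<omega> x" using True Q(3) by (simp add: class1_def)
      ultimately have "(i, j) \<in> vis_squares \<omega> x n"
        unfolding vis_squares_def mem_Collect_eq prod.case by blast
      then show ?thesis using ij unfolding A_def by blast
    next
      case False
      then have c: "prod.swap a \<in> class1 (sw \<omega>) (prod.swap x)" using Q(3) by (intro class1_sw) auto
      have "prod.swap a \<in> ES (sw \<omega>)" using c by (simp add: class1_def visible_part_def)
      then obtain i j where ij: "(i, j) \<in> ch_set (sw \<omega>) n" "prod.swap a \<in> dsq n i j" using ES_D by blast
      then have "(i, j) \<in> vis_squares (sw \<omega>) (prod.swap x) n"
        unfolding vis_squares_def mem_Collect_eq prod.case using c by blast
      then have "(j, i) \<in> A" unfolding A_def by (force simp: image_iff)
      moreover have "a \<in> dsq n j i" using ij(2) dsq_iff[of "fst a" "snd a" n j i] dsq_iff[of "snd a" "fst a" n i j]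
        by (simp add: prod.swap_def)
      ultimately show ?thesis by blast
    qed
    then obtain i j where ij: "(i, j) \<in> A" "a \<in> dsq n i j" by blast
    have c: "fst a \<in> cell n i" "snd a \<in> cell n j" using ij(2) dsq_iff[of "fst a" "snd a" n i j] by simp_all
    have q: "real_of_int l / 2 ^ n \<le> fst a" "fst a \<le> (real_of_int l + 1) / 2 ^ n"
      "real_of_int l' / 2 ^ n \<le> snd a" "snd a \<le> (real_of_int l' + 1) / 2 ^ n"
      using Q(1,2) by (auto simp: dyadic_square_def)
    obtain d e where "d \<in> {-1..1}" "l = int i + d" "e \<in> {-1..1}" "l' = int j + e"
      using close[OF c(1) q(1,2)] close[OF c(2) q(3,4)] by blast
    then show "Q \<in> h ` (A \<times> ({-1..1} \<times> {-1..1}))"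
      using ij(1) Q(1) by (intro rev_image_eqI[of "((i, j), (d, e))"]) (auto simp: h_def)
  qed
  have fin: "finite (A \<times> ({-1..1::int} \<times> {-1..1::int}))" using finA by simp
  show "finite {Q \<in> dyadic_squares n. Q \<inter> visible_part x (ES \<omega>) \<noteq> {}}"
    by (rule finite_subset[OF sub]) (use fin in blast)
  have "dyadic_count n (visible_part x (ES \<omega>)) \<le> card (h ` (A \<times> ({-1..1} \<times> {-1..1})))"
    unfolding dyadic_count_def by (rule card_mono[OF finite_imageI[OF fin] sub])
  also have "\<dots> \<le> card (A \<times> ({-1..1::int} \<times> {-1..1::int}))" by (rule card_image_le[OF fin])
  also have "\<dots> = 9 * card A" by (simp add: card_cartesian_product)
  also have "card A \<le> card (vis_squares \<omega> x n) + card (vis_squares (sw \<omega>) (prod.swap x) n)"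
    unfolding A_def by (rule order_trans[OF card_Un_le]) (simp add: card_image)
  finally show "dyadic_count n (visible_part x (ES \<omega>)) \<le>
     9 * (card (vis_squares \<omega> x n) + card (vis_squares (sw \<omega>) (prod.swap x) n))" by simp
qed

context percolation_tree
begin

text \<open>All levels contribute equally: a square of level \<open>n - d\<close> has
  \<open>2 * 2 ^ d\<close> descendants of level \<open>n\<close> along its midline, and the bound
  for the number of such squares is proportional to \<open>2 ^ (n - d)\<close>.\<close>

lemma card_vis_squares:
  assumes x: "x \<notin> ES \<omega>" and unb: "\<And>k. k \<le> n \<Longrightarrow> \<not> unblocked k N \<omega>"
  shows "card (vis_squares \<omega> x n) \<le> 2 * 2 ^ n + (n + 1) * (200 * 2 ^ n * (N + 16))"
proof -
  define B :: "(nat \<times> nat) set" where "B = {..<2 ^ n} \<times> {0, 2 ^ n - 1}"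
  \<comment> \<open>\<open>e\<close> selects the row of squares just above or just below the
    midline.\<close>
  define D where "D d = (\<lambda>((I, J), (c, e)). (I * 2 ^ d + c, if e then J * 2 ^ d + 2 ^ (d - 1) else J * 2 ^ d + 2 ^ (d - 1) - 1)) `
     (mid_vis \<omega> x (n - d) \<times> ({..<2 ^ d} \<times> (UNIV :: bool set)))" for d
  have finM: "finite (mid_vis \<omega> x k)" for k
    unfolding mid_vis_def by (rule finite_subset[OF _ finite_ch_set]) auto
  have finD: "finite (D d)" for d unfolding D_def using finM by simp
  have finB: "finite B" by (simp add: B_def)
  have cB: "card B \<le> 2 * 2 ^ n" unfolding B_def card_cartesian_product by (simp add: card_insert_if)
  have cD: "card (D d) \<le> 200 * 2 ^ n * (N + 16)" if "d \<le> n" for d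
  proof -
    have "card (D d) \<le> card (mid_vis \<omega> x (n - d) \<times> ({..<2 ^ d :: nat} \<times> (UNIV :: bool set)))"
      unfolding D_def by (rule card_image_le) (use finM in simp)
    also have "\<dots> = card (mid_vis \<omega> x (n - d)) * (2 ^ d * 2)" by (simp add: card_cartesian_product)
    also have "\<dots> \<le> (100 * 2 ^ (n - d) * (N + 16)) * (2 ^ d * 2)"
      using card_mid_vis[OF x unb[of "n - d"]] by (intro mult_right_mono) auto
    also have "\<dots> = 200 * (2 ^ (n - d) * 2 ^ d) * (N + 16)" by (simp only: mult_ac)
    also have "2 ^ (n - d) * 2 ^ d = (2::nat) ^ n" using that by (simp flip: power_add)
    finally show ?thesis .
  qed
  have sub: "vis_squares \<omega> x n \<subseteq> B \<union> (mid_vis \<omega> x n \<union> (\<Union>d\<in>{1..n}. D d))"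
  proof
    fix P assume P: "P \<in> vis_squares \<omega> x n"
    obtain i j where Pij: "P = (i, j)" by (cases P)
    obtain a where a: "(i, j) \<in> ch_set \<omega> n" "a \<in> class1 \<omega> x" "a \<in> dsq n i j"
      using P by (auto simp: vis_squares_def Pij)
    have lt: "i < 2 ^ n" "j < 2 ^ n" using a(1) by (auto simp: ch_set_def)
    consider "middle n j a" | "j = 0 \<or> j + 1 = 2 ^ n" | "\<not> middle n j a" "0 < j" "j + 1 < 2 ^ n"
      using lt by linarith
    then show "P \<in> B \<union> (mid_vis \<omega> x n \<union> (\<Union>d\<in>{1..n}. D d))"
    proof cases
      case 1
      then have "P \<in> mid_vis \<omega> x n" using a by (auto simp: mid_vis_def Pij)
      then show ?thesis by blast
    next
      case 2
      then have "j = 0 \<or> j = 2 ^ n - 1" by linarith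
      then have "P \<in> B" using lt by (auto simp: B_def Pij)
      then show ?thesis by blast
    next
      case 3
      obtain d where d: "d \<in> {1..n}" "middle (n - d) (j div 2 ^ d) a"
        "j mod 2 ^ d = 2 ^ (d - 1) \<or> j mod 2 ^ d + 1 = 2 ^ (d - 1)"
        using middle_ancestor[OF a(1,3) 3] by blast
      have n: "n = (n - d) + d" using d by simp
      define I J where "I = i div 2 ^ d" and "J = j div 2 ^ d"
      have "(I, J) \<in> ch_set \<omega> (n - d)" "a \<in> dsq (n - d) I J"
        unfolding I_def J_def using a n ch_set_ancestor[of i j \<omega> "n - d" d] dsq_ancestor[of a "n - d" d i j] by simp_all
      then have IJ: "(I, J) \<in> mid_vis \<omega> x (n - d)" using d(2) a(2) by (auto simp: mid_vis_def J_def)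
      define e where "e \<longleftrightarrow> j mod 2 ^ d = 2 ^ (d - 1)"
      have "j = J * 2 ^ d + j mod 2 ^ d" unfolding J_def by (rule div_mult_mod_eq[symmetric])
      then have "j = (if e then J * 2 ^ d + 2 ^ (d - 1) else J * 2 ^ d + 2 ^ (d - 1) - 1)"
        using d(3) unfolding e_def by (auto split: if_splits)
      moreover have "i = I * 2 ^ d + i mod 2 ^ d" unfolding I_def by (rule div_mult_mod_eq[symmetric])
      ultimately have "P \<in> D d"
        unfolding D_def Pij using IJ by (intro rev_image_eqI[of "((I, J), (i mod 2 ^ d, e))"]) auto
      then show ?thesis using d(1) by blast
    qed
  qed
  have "card (vis_squares \<omega> x n) \<le> card (B \<union> (mid_vis \<omega> x n \<union> (\<Union>d\<in>{1..n}. D d)))"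
    by (rule card_mono[OF _ sub]) (use finB finM finD in auto)
  also have "\<dots> \<le> card B + (card (mid_vis \<omega> x n) + card (\<Union>d\<in>{1..n}. D d))"
    by (intro order_trans[OF card_Un_le] add_left_mono card_Un_le)
  also have "\<dots> \<le> 2 * 2 ^ n + (200 * 2 ^ n * (N + 16) + n * (200 * 2 ^ n * (N + 16)))"
  proof (intro add_mono cB)
    show "card (mid_vis \<omega> x n) \<le> 200 * 2 ^ n * (N + 16)"
      by (rule order_trans[OF card_mid_vis[OF x unb[OF order_refl]]]) simp
    have "card (\<Union>d\<in>{1..n}. D d) \<le> (\<Sum>d\<in>{1..n}. card (D d))" by (rule card_UN_le) simp
    also have "\<dots> \<le> (\<Sum>d\<in>{1..n}. 200 * 2 ^ n * (N + 16))" using cD by (intro sum_mono) auto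
    finally show "card (\<Union>d\<in>{1..n}. D d) \<le> n * (200 * 2 ^ n * (N + 16))" by simp
  qed
  finally show ?thesis by (simp add: algebra_simps)
qed

text \<open>The null set is the one of \<open>AE_blocked\<close>, where no viewpoint occurs; hence a
  single exception and a single constant serve all \<open>x\<close>.\<close>

lemma AE_dyadic_count:
  "\<exists>C>0. AE \<omega> in M. \<forall>x. x \<notin> ES \<omega> \<longrightarrow> (\<forall>\<^sub>F n in sequentially.
     real (dyadic_count n (visible_part x (ES \<omega>))) \<le> C * (real n)\<^sup>2 * 2 ^ n)"
proof -
  obtain K where K: "AE \<omega> in M. \<forall>\<^sub>F n in sequentially. \<forall>k\<le>n. \<not> unblocked k (K * n) \<omega> \<and> \<not> unblocked k (K * n) (sw \<omega>)"
    using AE_blocked by blast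
  \<comment> \<open>\<open>18 = 2 * 9\<close> stands for two orientations and nine neighbours; the
    rest absorbs the lower-order terms for \<open>n \<ge> 1\<close>.\<close>
  define C where "C = 18 * (2 + 400 * (K + 16))"
  have le: "dyadic_count n (visible_part x (ES \<omega>)) \<le> C * n\<^sup>2 * 2 ^ n"
    if n: "1 \<le> n" and x: "x \<notin> ES \<omega>" and unb: "\<forall>k\<le>n. \<not> unblocked k (K * n) \<omega> \<and> \<not> unblocked k (K * n) (sw \<omega>)" for n x \<omega>
  proof -
    define T where "T = 2 * 2 ^ n + (n + 1) * (200 * 2 ^ n * (K * n + 16))"
    have x': "prod.swap x \<notin> ES (sw \<omega>)" using x ES_sw[of "snd x" "fst x" \<omega>] by (simp add: prod.swap_def)
    have "card (vis_squares \<omega> x n) \<le> T" unfolding T_def by (rule card_vis_squares[OF x]) (use unb in auto)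
    moreover have "card (vis_squares (sw \<omega>) (prod.swap x) n) \<le> T" unfolding T_def by (rule card_vis_squares[OF x']) (use unb in auto)
    ultimately have "dyadic_count n (visible_part x (ES \<omega>)) \<le> 18 * T"
      by (intro order_trans[OF dyadic_count_le]) simp
    also have "T \<le> (2 + 400 * (K + 16)) * n\<^sup>2 * 2 ^ n"
    proof -
      have "(n + 1) * (K * n + 16) \<le> (2 * n) * ((K + 16) * n)"
        using n by (intro mult_mono) (auto simp: algebra_simps)
      then have "200 * ((n + 1) * (K * n + 16)) \<le> 400 * (K + 16) * n\<^sup>2"
        by (simp add: power2_eq_square algebra_simps)
      moreover have "2 \<le> 2 * n\<^sup>2" using n by simp
      ultimately have "2 + 200 * ((n + 1) * (K * n + 16)) \<le> (2 + 400 * (K + 16)) * n\<^sup>2"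
        by (simp add: algebra_simps)
      then have "(2 + 200 * ((n + 1) * (K * n + 16))) * 2 ^ n \<le> (2 + 400 * (K + 16)) * n\<^sup>2 * 2 ^ n"
        by (intro mult_right_mono) auto
      then show ?thesis unfolding T_def by (simp add: algebra_simps)
    qed
    finally show ?thesis unfolding C_def by (simp only: mult.assoc)
  qed
  have "AE \<omega> in M. \<forall>x. x \<notin> ES \<omega> \<longrightarrow> (\<forall>\<^sub>F n in sequentially.
     real (dyadic_count n (visible_part x (ES \<omega>))) \<le> real C * (real n)\<^sup>2 * 2 ^ n)"
    using K
  proof eventually_elim
    case (elim \<omega>)
    show ?case
    proof (intro allI impI)
      fix x assume x: "x \<notin> ES \<omega>"
      show "\<forall>\<^sub>F n in sequentially. real (dyadic_count n (visible_part x (ES \<omega>))) \<le> real C * (real n)\<^sup>2 * 2 ^ n"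
        using elim eventually_ge_at_top[of 1]
      proof eventually_elim
        case (elim n)
        then have "dyadic_count n (visible_part x (ES \<omega>)) \<le> C * n\<^sup>2 * 2 ^ n" using le[OF _ x] by blast
        then have "real (dyadic_count n (visible_part x (ES \<omega>))) \<le> real (C * n\<^sup>2 * 2 ^ n)" by (simp only: of_nat_le_iff)
        then show ?case by simp
      qed
    qed
  qed
  then show ?thesis by (intro exI[of _ "real C"]) (simp add: C_def)
qed

end


section \<open>Dimensions\<close>

text \<open>A lower bound for the one-dimensional Hausdorff content. The diameters are not
  restricted, so it applies to arbitrary covers and to covers by dyadic squares alike, and serves
  both dimensions.\<close>

definition content_ge :: "real \<Rightarrow> (real \<times> real) set \<Rightarrow> bool" where
  "content_ge c V \<longleftrightarrow> (\<forall>U :: nat \<Rightarrow> (real \<times> real) set.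
     V \<subseteq> (\<Union>i. U i) \<longrightarrow> (\<forall>i. bounded (U i)) \<longrightarrow> ennreal c \<le> (\<Sum>i. ennreal (diameter (U i))))"

text \<open>For \<open>s < 1\<close> and sets of diameter at most 1,
  \<open>diameter U \<le> diameter U powr s\<close>; so already the premeasure at scale 1 is at
  least \<open>c\<close>.\<close>

lemma hausdorff_dim_ge_1:
  assumes c: "c > 0" "content_ge c V"
  shows "1 \<le> hausdorff_dim V"
  unfolding hausdorff_dim_def
proof (rule Inf_greatest)
  fix z assume "z \<in> {ereal s |s. 0 \<le> s \<and> hausdorff_outer_measure s V = 0}"
  then obtain s where s: "z = ereal s" "0 \<le> s" "hausdorff_outer_measure s V = 0" by blast
  show "1 \<le> z"
  proof (rule ccontr)
    assume "\<not> 1 \<le> z"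
    then have s1: "s < 1" using s by simp
    have "ennreal c \<le> hausdorff_premeasure s 1 V"
      unfolding hausdorff_premeasure_def
    proof (rule Inf_greatest)
      fix y assume "y \<in> {(\<Sum>i. diam_powr s (U i)) |U :: nat \<Rightarrow> (real \<times> real) set.
          V \<subseteq> (\<Union>i. U i) \<and> (\<forall>i. bounded (U i) \<and> diameter (U i) \<le> 1)}"
      then obtain U :: "nat \<Rightarrow> (real \<times> real) set" where U: "y = (\<Sum>i. diam_powr s (U i))" "V \<subseteq> (\<Union>i. U i)"
        "\<And>i. bounded (U i)" "\<And>i. diameter (U i) \<le> 1" by blast
      have "ennreal c \<le> (\<Sum>i. ennreal (diameter (U i)))"
        using c(2) U unfolding content_ge_def by blast
      also have "\<dots> \<le> y"
        unfolding U(1)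
      proof (rule suminf_le)
        fix i
        have d: "0 \<le> diameter (U i)" "diameter (U i) \<le> 1" using U diameter_ge_0 by auto
        show "ennreal (diameter (U i)) \<le> diam_powr s (U i)"
        \<comment> \<open>The cases that \<open>diam_powr\<close> treats separately; for
          \<open>s = 0\<close> a nonempty set contributes 1.\<close>
        proof (cases "U i = {} \<or> s = 0")
          case True
          then show ?thesis using d by (auto simp: diam_powr_def diameter_empty ennreal_le_1)
        next
          case False
          have "diameter (U i) powr 1 \<le> diameter (U i) powr s"
            using d s1 s(2) powr_mono'[of s 1 "diameter (U i)"] by simp
          then show ?thesis using False d by (auto simp: diam_powr_def intro!: ennreal_leI)
        qed
      qed auto
      finally show "ennreal c \<le> y" .
    qed
    also have "\<dots> \<le> hausdorff_outer_measure s V"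
      unfolding hausdorff_outer_measure_def by (rule SUP_upper) simp
    finally show False using s c by simp
  qed
qed

lemma diameter_dyadic: "diameter (dyadic_square n i j) \<le> 2 / 2 ^ n"
proof (rule diameter_le)
  fix z z' assume "z \<in> dyadic_square n i j" "z' \<in> dyadic_square n i j"
  then have "\<bar>fst z - fst z'\<bar> \<le> 1 / 2 ^ n" "\<bar>snd z - snd z'\<bar> \<le> 1 / 2 ^ n"
    by (auto simp: dyadic_square_def add_divide_distrib)
  moreover have "norm (z - z') \<le> norm (fst z - fst z') + norm (snd z - snd z')"
    using norm_Pair_le[of "fst z - fst z'" "snd z - snd z'"] by (simp add: minus_prod_def)
  ultimately show "norm (z - z') \<le> 2 / 2 ^ n" by simp
qed simp

lemma bounded_dyadic: "bounded (dyadic_square n i j)"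
  unfolding dyadic_square_def by (intro bounded_Times) auto

lemma dyadic_cover:
  assumes fin: "finite {Q \<in> dyadic_squares n. Q \<inter> V \<noteq> {}}"
  shows "\<exists>U :: nat \<Rightarrow> (real \<times> real) set. V \<subseteq> (\<Union>i. U i) \<and> (\<forall>i. bounded (U i) \<and> diameter (U i) \<le> 2 / 2 ^ n)
    \<and> (\<forall>i\<ge>dyadic_count n V. U i = {})"
proof -
  define N where "N = dyadic_count n V"
  obtain e where e: "bij_betw e {..<N} {Q \<in> dyadic_squares n. Q \<inter> V \<noteq> {}}"
    using ex_bij_betw_nat_finite[OF fin] by (auto simp: N_def dyadic_count_def atLeast0LessThan)
  define U where "U i = (if i < N then e i else {})" for i
  have eD: "e i \<in> dyadic_squares n" if "i < N" for i using e that unfolding bij_betw_def by blast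
  have "V \<subseteq> (\<Union>i. U i)"
  proof
    fix z assume z: "z \<in> V"
    define Q where "Q = dyadic_square n \<lfloor>2 ^ n * fst z\<rfloor> \<lfloor>2 ^ n * snd z\<rfloor>"
    have c: "real_of_int \<lfloor>2 ^ n * y\<rfloor> / 2 ^ n \<le> y \<and> y \<le> (real_of_int \<lfloor>2 ^ n * y\<rfloor> + 1) / 2 ^ n" for y :: real
    proof -
      have "real_of_int \<lfloor>2 ^ n * y\<rfloor> \<le> 2 ^ n * y" "2 ^ n * y \<le> real_of_int \<lfloor>2 ^ n * y\<rfloor> + 1" by linarith+
      then show ?thesis by (simp add: field_simps)
    qed
    have "z \<in> Q" unfolding Q_def dyadic_square_def using c[of "fst z"] c[of "snd z"] by (simp add: mem_Times_iff)
    then have "Q \<in> {Q \<in> dyadic_squares n. Q \<inter> V \<noteq> {}}" using z by (auto simp: Q_def dyadic_squares_def)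
    then obtain i where "i < N" "e i = Q" using e unfolding bij_betw_def by (metis (no_types, lifting) imageE lessThan_iff)
    then show "z \<in> (\<Union>i. U i)" using \<open>z \<in> Q\<close> by (auto simp: U_def)
  qed
  moreover have "bounded (U i) \<and> diameter (U i) \<le> 2 / 2 ^ n" for i
    using eD[of i] bounded_dyadic diameter_dyadic by (auto simp: U_def dyadic_squares_def diameter_empty)
  moreover have "\<forall>i\<ge>dyadic_count n V. U i = {}" by (simp add: U_def N_def)
  ultimately show ?thesis by blast
qed

text \<open>The dyadic squares meeting the set are themselves a cover, by sets of diameter at most
  \<open>2 / 2 ^ n\<close>.\<close>

lemma dyadic_count_ge:
  assumes fin: "finite {Q \<in> dyadic_squares n. Q \<inter> V \<noteq> {}}" and c: "content_ge c V" "c > 0"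
  shows "c / 2 * 2 ^ n \<le> real (dyadic_count n V)"
proof -
  define N where "N = dyadic_count n V"
  obtain U :: "nat \<Rightarrow> (real \<times> real) set" where U: "V \<subseteq> (\<Union>i. U i)"
    "\<And>i. bounded (U i)" "\<And>i. diameter (U i) \<le> 2 / 2 ^ n" "\<And>i. N \<le> i \<Longrightarrow> U i = {}"
    using dyadic_cover[OF fin] unfolding N_def by metis
  have "ennreal c \<le> (\<Sum>i. ennreal (diameter (U i)))" using c U unfolding content_ge_def by blast
  also have "\<dots> = (\<Sum>i<N. ennreal (diameter (U i)))"
    by (rule suminf_finite) (auto simp: U(4))
  also have "\<dots> \<le> (\<Sum>i<N. ennreal (2 / 2 ^ n))" using U by (intro sum_mono ennreal_leI) auto
  also have "\<dots> = ennreal (real N * (2 / 2 ^ n))"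
    by (subst ennreal_mult) (simp_all add: ennreal_of_nat_eq_real_of_nat)
  finally have "c \<le> real N * (2 / 2 ^ n)" by (subst (asm) ennreal_le_iff) auto
  then show ?thesis by (simp add: N_def field_simps)
qed

text \<open>Covering by dyadic squares costs \<open>n^2 * 2 ^ (- \<epsilon> * n)\<close> up to a
  constant at exponent \<open>1 + \<epsilon>\<close>, so the polynomial factor does no harm.\<close>

lemma hausdorff_dim_le_1:
  assumes fin: "\<And>n. finite {Q \<in> dyadic_squares n. Q \<inter> V \<noteq> {}}"
    and N: "\<forall>\<^sub>F n in sequentially. real (dyadic_count n V) \<le> C * (real n)\<^sup>2 * 2 ^ n"
  shows "hausdorff_dim V \<le> 1"
proof (rule ereal_le_epsilon2)
  fix \<epsilon> :: real assume \<epsilon>: "0 < \<epsilon>"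
  define s where "s = 1 + \<epsilon>"
  have s: "s > 1" using \<epsilon> by (simp add: s_def)
  have le0: "hausdorff_premeasure s \<delta> V \<le> 0" if "\<delta> > 0" for \<delta>
  proof -
    define f where "f n = C * (real n)\<^sup>2 * 2 ^ n * (2 / 2 ^ n) powr s" for n :: nat
    have ev: "\<forall>\<^sub>F n in sequentially. hausdorff_premeasure s \<delta> V \<le> ennreal (f n)"
    proof -
      have "(\<lambda>n. 2 / 2 ^ n :: real) \<longlonglongrightarrow> 0" by real_asymp
      then have "\<forall>\<^sub>F n in sequentially. 2 / 2 ^ n < \<delta>" using that by (rule order_tendstoD)
      with N show ?thesis
      proof eventually_elim
        case (elim n)
        obtain U :: "nat \<Rightarrow> (real \<times> real) set" where U: "V \<subseteq> (\<Union>i. U i)"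
          "\<And>i. bounded (U i)" "\<And>i. diameter (U i) \<le> 2 / 2 ^ n" "\<And>i. dyadic_count n V \<le> i \<Longrightarrow> U i = {}"
          using dyadic_cover[OF fin[of n]] by metis
        have "diameter (U i) \<le> \<delta>" for i using U(3)[of i] elim by linarith
        then have "hausdorff_premeasure s \<delta> V \<le> (\<Sum>i. diam_powr s (U i))"
          unfolding hausdorff_premeasure_def using U by (intro Inf_lower) blast
        also have "\<dots> = (\<Sum>i<dyadic_count n V. diam_powr s (U i))"
          by (rule suminf_finite) (auto simp: U(4) diam_powr_def)
        also have "\<dots> \<le> (\<Sum>i<dyadic_count n V. ennreal ((2 / 2 ^ n) powr s))"
          using U(3) diameter_ge_0[OF U(2)] s by (intro sum_mono) (auto simp: diam_powr_def intro!: ennreal_leI powr_mono2)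
        also have "\<dots> = ennreal (real (dyadic_count n V) * (2 / 2 ^ n) powr s)"
          by (subst ennreal_mult) (simp_all add: ennreal_of_nat_eq_real_of_nat)
        also have "\<dots> \<le> ennreal (f n)"
          unfolding f_def using elim by (intro ennreal_leI mult_right_mono) auto
        finally show ?case .
      qed
    qed
    have "f \<longlonglongrightarrow> 0"
    proof -
      have eq: "f = (\<lambda>n. C * (real n)\<^sup>2 * (2 powr s * 2 powr (- \<epsilon> * real n)))"
      proof
        fix n
        have A: "(2 / 2 ^ n :: real) powr s = 2 powr s * 2 powr (- s * real n)"
          by (simp add: powr_divide powr_realpow[symmetric] powr_powr powr_minus_divide mult.commute)
        have B: "(2::real) ^ n = 2 powr real n" by (simp add: powr_realpow)
        have "2 ^ n * (2 / 2 ^ n :: real) powr s = 2 powr s * (2 powr real n * 2 powr (- s * real n))"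
          unfolding A unfolding B by (simp only: mult_ac)
        also have "\<dots> = 2 powr s * 2 powr (real n + - s * real n)" by (simp only: powr_add)
        also have "real n + - s * real n = - \<epsilon> * real n" by (simp add: s_def algebra_simps)
        finally show "f n = C * (real n)\<^sup>2 * (2 powr s * 2 powr (- \<epsilon> * real n))"
          by (simp add: f_def mult.assoc)
      qed
      have "(\<lambda>n. (real n)\<^sup>2 * 2 powr (- \<epsilon> * real n)) \<longlonglongrightarrow> 0"
        using \<epsilon> by real_asymp
      then have "(\<lambda>n. C * 2 powr s * ((real n)\<^sup>2 * 2 powr (- \<epsilon> * real n))) \<longlonglongrightarrow> 0"
        by (rule tendsto_mult_right_zero)
      then show ?thesis unfolding eq by (simp add: mult_ac)
    qed
    then have "(\<lambda>n. ennreal (f n)) \<longlonglongrightarrow> ennreal 0" by (rule tendsto_ennrealI)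
    then show ?thesis by (intro tendsto_lowerbound[OF _ ev]) auto
  qed
  have "hausdorff_outer_measure s V = 0"
    unfolding hausdorff_outer_measure_def using le0 by (auto intro!: antisym SUP_least)
  then have "ereal s \<in> {ereal s |s. 0 \<le> s \<and> hausdorff_outer_measure s V = 0}" using s by auto
  then have "hausdorff_dim V \<le> ereal s" unfolding hausdorff_dim_def by (rule Inf_lower)
  then show "hausdorff_dim V \<le> 1 + ereal \<epsilon>" by (simp add: s_def one_ereal_def)
qed

lemma has_box_dim_1:
  assumes fin: "\<And>n. finite {Q \<in> dyadic_squares n. Q \<inter> V \<noteq> {}}"
    and N: "\<forall>\<^sub>F n in sequentially. real (dyadic_count n V) \<le> C * (real n)\<^sup>2 * 2 ^ n"
    and C: "C > 0" and c: "content_ge c V" "c > 0"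
  shows "has_box_dim V 1"
proof -
  define g where "g n = ln (real (dyadic_count n V)) / ln (2 ^ n)" for n :: nat
  define l where "l n = (ln (c / 2) + real n * ln 2) / (real n * ln 2)" for n :: nat
  define u where "u n = (ln C + 2 * ln (real n) + real n * ln 2) / (real n * ln 2)" for n :: nat
  have "g \<longlonglongrightarrow> 1"
  proof (rule tendsto_sandwich)
    show "l \<longlonglongrightarrow> 1" unfolding l_def by real_asymp
    show "u \<longlonglongrightarrow> 1" unfolding u_def by real_asymp
    show "\<forall>\<^sub>F n in sequentially. l n \<le> g n"
      using eventually_gt_at_top[of 0]
    proof eventually_elim
      case (elim n)
      have pos: "0 < c / 2 * 2 ^ n" using c by simp
      have "ln (c / 2 * 2 ^ n) \<le> ln (real (dyadic_count n V))"
        by (rule ln_mono[OF dyadic_count_ge[OF fin c] pos])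
      also have "ln (c / 2 * 2 ^ n) = ln (c / 2) + real n * ln 2"
        using c by (subst ln_mult) (auto simp: ln_realpow)
      finally show ?case unfolding l_def g_def using elim
        by (auto simp: ln_realpow intro!: divide_right_mono)
    qed
    show "\<forall>\<^sub>F n in sequentially. g n \<le> u n"
      using N eventually_gt_at_top[of 0]
    proof eventually_elim
      case (elim n)
      have "0 < c / 2 * 2 ^ n" using c by simp
      also have "\<dots> \<le> real (dyadic_count n V)" by (rule dyadic_count_ge[OF fin c])
      finally have pos: "0 < real (dyadic_count n V)" .
      have "ln (real (dyadic_count n V)) \<le> ln (C * (real n)\<^sup>2 * 2 ^ n)"
        using elim pos by (subst ln_le_cancel_iff) auto
      also have "\<dots> = ln C + 2 * ln (real n) + real n * ln 2"
        using C elim by (simp add: ln_mult ln_realpow)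
      finally show ?case unfolding u_def g_def using elim
        by (auto simp: ln_realpow intro!: divide_right_mono)
    qed
  qed
  then have lim: "(\<lambda>n. ereal (g n)) \<longlonglongrightarrow> ereal 1" by simp
  show ?thesis
    using lim_imp_Liminf[OF _ lim] lim_imp_Limsup[OF _ lim]
    unfolding has_box_dim_def lower_box_dim_def upper_box_dim_def g_def by (simp add: one_ereal_def)
qed

text \<open>
  The slope of the line through \<open>x\<close> is a Lipschitz function on the visible points of class 1, because
  these stay away from \<open>x\<close>. A good square is hit by all lines from \<open>x\<close> with slopes in some interval.
\<close>

lemma slope_lipschitz:
  fixes y z y' z' \<eta> d :: real
  assumes "\<bar>y\<bar> \<le> \<bar>z\<bar>" "z \<noteq> 0" "\<eta> \<le> \<bar>z'\<bar>" "0 < \<eta>" "\<bar>y - y'\<bar> \<le> d" "\<bar>z - z'\<bar> \<le> d"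
  shows "\<bar>y / z - y' / z'\<bar> \<le> 2 * d / \<eta>"
proof -
  have z': "z' \<noteq> 0" using assms by auto
  have "y / z - y' / z' = (y / z * (z' - z) + (y - y')) / z'"
    using assms(2) z' by (simp add: field_simps)
  also have "\<bar>\<dots>\<bar> \<le> (\<bar>y / z\<bar> * \<bar>z' - z\<bar> + \<bar>y - y'\<bar>) / \<bar>z'\<bar>"
  proof -
    have "\<bar>y / z * (z' - z) + (y - y')\<bar> \<le> \<bar>y / z\<bar> * \<bar>z' - z\<bar> + \<bar>y - y'\<bar>"
      unfolding abs_mult[symmetric] by (rule abs_triangle_ineq)
    then show ?thesis unfolding abs_divide[of _ z'] by (intro divide_right_mono) auto
  qed
  also have "\<dots> \<le> (1 * d + d) / \<bar>z'\<bar>"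
    using assms by (intro divide_right_mono add_mono mult_mono) (auto simp: abs_divide divide_le_eq_1)
  also have "\<dots> \<le> (1 * d + d) / \<eta>"
    using assms by (intro divide_left_mono) auto
  finally show ?thesis by simp
qed

lemma abs_diff_scale: "\<bar>2 ^ k * a - 2 ^ k * b\<bar> = 2 ^ k * \<bar>a - b :: real\<bar>"
proof -
  have "2 ^ k * a - 2 ^ k * b = 2 ^ k * (a - b)" by (rule right_diff_distrib[symmetric])
  then show ?thesis by (simp only: abs_mult) simp
qed

text \<open>Take the point of the segment that lies in the compact set and is nearest to
  \<open>x\<close>.\<close>

lemma visible_on_segment:
  assumes E: "compact E" and z: "z \<in> E" and x: "x \<notin> (E :: (real \<times> real) set)"
  shows "\<exists>a\<in>visible_part x E. \<exists>l>0. a - x = l *\<^sub>R (z - x)"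
proof -
  have "compact (closed_segment z x \<inter> E)" by (intro compact_Int compact_segment E)
  moreover have "closed_segment z x \<inter> E \<noteq> {}" using z by auto
  ultimately have "\<exists>a\<in>closed_segment z x \<inter> E. \<forall>b\<in>closed_segment z x \<inter> E. dist x a \<le> dist x b"
    by (rule continuous_attains_inf) (intro continuous_intros)
  then obtain a where a: "a \<in> closed_segment z x \<inter> E" "\<And>b. b \<in> closed_segment z x \<inter> E \<Longrightarrow> dist x a \<le> dist x b"
    by blast
  have "closed_segment a x \<inter> E = {a}"
  proof (intro equalityI subsetI)
    fix b assume b: "b \<in> closed_segment a x \<inter> E"
    have "closed_segment a x \<subseteq> closed_segment z x" using a(1) by (simp add: subset_closed_segment)
    then have d: "dist x a \<le> dist x b" using a(2) b by blast
    obtain m where m: "0 \<le> m" "m \<le> 1" "b = (1 - m) *\<^sub>R a + m *\<^sub>R x"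
      using b unfolding closed_segment_def by blast
    have "x - b = (1 - m) *\<^sub>R (x - a)" unfolding m(3) by (simp add: algebra_simps)
    then have "dist x b = (1 - m) * dist x a" using m by (simp add: dist_norm)
    also have "\<dots> = dist x a - m * dist x a" by (simp add: left_diff_distrib)
    finally have "m * dist x a \<le> 0" using d by linarith
    moreover have "dist x a > 0" using a(1) x by auto
    ultimately have "m = 0" using m(1) by (simp add: mult_le_0_iff)
    then show "b \<in> {a}" using m by simp
  qed (use a in auto)
  then have "a \<in> visible_part x E" using a by (simp add: visible_part_def)
  moreover obtain m where m: "0 \<le> m" "m \<le> 1" "a = (1 - m) *\<^sub>R z + m *\<^sub>R x"
    using a(1) unfolding closed_segment_def by blast
  have "a - x = (1 - m) *\<^sub>R (z - x)" unfolding m(3) by (simp add: algebra_simps)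
  moreover have "1 - m > 0"
  proof (rule ccontr)
    assume "\<not> 1 - m > 0"
    then have "a = x" using m by simp
    then show False using a(1) x by simp
  qed
  ultimately show ?thesis by blast
qed

context percolation_tree
begin

text \<open>The rays from \<open>x\<close> through the heights \<open>c2 + v\<close> above the
  centre's abscissa all hit the good square, so each carries a visible point \<open>a v\<close>.
  Conversely \<open>v\<close> is a Lipschitz function of \<open>a v\<close>, hence a cover of the
  visible points yields a cover of an interval of length \<open>\<delta>\<close> by intervals of
  length \<open>2 * L\<close> times the diameters.\<close>

lemma content_class1:
  assumes good: "good (sh k i j \<omega>)" and ch: "(i, j) \<in> ch_set \<omega> k"
    and xE: "x \<notin> ES \<omega>" and xQ: "x \<notin> dsq k i j"
    and cl: "\<bar>(real j + 1 / 2) / 2 ^ k - snd x\<bar> \<le> \<bar>(real i + 1 / 2) / 2 ^ k - fst x\<bar>"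
  shows "\<exists>c>0. content_ge c (class1 \<omega> x)"
proof -
  define c1 c2 where "c1 = (real i + 1 / 2) / 2 ^ k" and "c2 = (real j + 1 / 2) / 2 ^ k"
  define D where "D = c1 - fst x"
  \<comment> \<open>An eighth of the side keeps the height over the centre within the middle half
    that \<open>near_middle_hit\<close> requires.\<close>
  define \<delta> where "\<delta> = 1 / (8 * 2 ^ k :: real)"
  have \<delta>: "\<delta> > 0" by (simp add: \<delta>_def)
  \<comment> \<open>The vertical offset of the centre is at most the horizontal one, so if the
    latter were at most half a side, \<open>x\<close> would lie in the square.\<close>
  have half: "1 / 2 / 2 ^ k < \<bar>D\<bar>"
  proof (rule ccontr)
    assume "\<not> 1 / 2 / 2 ^ k < \<bar>D\<bar>"
    then have "\<bar>c1 - fst x\<bar> \<le> 1 / 2 / 2 ^ k" "\<bar>c2 - snd x\<bar> \<le> 1 / 2 / 2 ^ k"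
      using cl unfolding D_def c1_def c2_def by linarith+
    then have "2 ^ k * \<bar>c1 - fst x\<bar> \<le> 1 / 2" "2 ^ k * \<bar>c2 - snd x\<bar> \<le> 1 / 2" by (simp_all add: field_simps)
    then have "\<bar>2 ^ k * c1 - 2 ^ k * fst x\<bar> \<le> 1 / 2" "\<bar>2 ^ k * c2 - 2 ^ k * snd x\<bar> \<le> 1 / 2"
      by (simp_all only: abs_diff_scale)
    moreover have "2 ^ k * c1 = real i + 1 / 2" "2 ^ k * c2 = real j + 1 / 2" by (simp_all add: c1_def c2_def)
    ultimately have "(fst x, snd x) \<in> dsq k i j" unfolding dsq_iff cell_iff abs_le_iff by linarith
    then show False using xQ by simp
  qed
  have \<delta>D: "\<delta> \<le> \<bar>D\<bar>"
  proof -
    have "\<delta> \<le> 1 / 2 / 2 ^ k" by (simp add: \<delta>_def field_simps)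
    then show ?thesis using half by linarith
  qed
  have D0: "D \<noteq> 0" using \<delta> \<delta>D by auto
  \<comment> \<open>The interval extends from the centre towards the height of \<open>x\<close>, so
    that the slopes do not exceed 1.\<close>
  define v0 where "v0 = (if snd x \<le> c2 then - \<delta> else 0)"
  have slope: "\<bar>c2 + v - snd x\<bar> \<le> \<bar>D\<bar>" if "v \<in> {v0..v0 + \<delta>}" for v
    using that cl \<delta>D \<delta> unfolding v0_def c1_def[symmetric] c2_def[symmetric] D_def[symmetric]
    by (auto split: if_splits)
  have lt: "i < 2 ^ k" "j < 2 ^ k" using ch by (auto simp: ch_set_def)
  have ex: "\<exists>a\<in>class1 \<omega> x. fst a \<noteq> fst x \<and> (snd a - snd x) / (fst a - fst x) = (c2 + v - snd x) / D"
    if v: "v \<in> {v0..v0 + \<delta>}" for v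
  proof -
    define s t where "s = (c2 + v - snd x) / D" and "t = snd x - s * fst x"
    have s1: "\<bar>s\<bar> \<le> 1" unfolding s_def using slope[OF v] D0 by (simp add: abs_divide divide_le_eq_1)
    have sc: "s * c1 + t = c2 + v"
    proof -
      have "s * c1 + t = s * D + snd x" by (simp add: t_def D_def algebra_simps)
      then show ?thesis using D0 by (simp add: s_def)
    qed
    have cc: "c1 \<in> cell k i" unfolding cell_iff by (simp add: c1_def)
    have \<delta>8: "2 ^ k * \<delta> = 1 / 8" by (simp add: \<delta>_def)
    have "2 ^ k * (-\<delta>) \<le> 2 ^ k * v" "2 ^ k * v \<le> 2 ^ k * \<delta>"
      using v \<delta> by (intro mult_left_mono; auto simp: v0_def split: if_splits)+
    then have "- (1 / 8) \<le> 2 ^ k * v" "2 ^ k * v \<le> 1 / 8" using \<delta>8 by (simp_all only: mult_minus_right)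
    moreover have "2 ^ k * (c2 + v) = real j + 1 / 2 + 2 ^ k * v"
      unfolding c2_def by (simp add: field_simps)
    ultimately have "real j + 1 / 4 < 2 ^ k * (s * c1 + t)" "2 ^ k * (s * c1 + t) < real j + 3 / 4"
      unfolding sc by linarith+
    then have hit: "(i, j) \<in> hit s t k" by (rule near_middle_hit[OF s1 cc lt])
    obtain u where u: "u \<in> cell k i" "(u, s * u + t) \<in> ES \<omega>" using good_blocks[OF good ch s1 hit] by blast
    \<comment> \<open>By \<open>half\<close> the abscissa of \<open>x\<close> lies outside the
      column of the good square.\<close>
    have ux: "u \<noteq> fst x"
    proof
      assume "u = fst x"
      then have "real i \<le> 2 ^ k * fst x \<and> 2 ^ k * fst x \<le> real i + 1" using u(1) by (simp add: cell_iff)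
      moreover have "2 ^ k * c1 = real i + 1 / 2" by (simp add: c1_def)
      ultimately have "\<bar>2 ^ k * c1 - 2 ^ k * fst x\<bar> \<le> 1 / 2" unfolding abs_le_iff by linarith
      then have "2 ^ k * \<bar>D\<bar> \<le> 1 / 2" unfolding D_def by (simp only: abs_diff_scale)
      then show False using half by (simp add: field_simps)
    qed
    obtain a l where a: "a \<in> visible_part x (ES \<omega>)" "l > 0" "a - x = l *\<^sub>R ((u, s * u + t) - x)"
      using visible_on_segment[OF compact_ES u(2) xE] by blast
    have a1: "fst a - fst x = l * (u - fst x)" using arg_cong[OF a(3), of fst] by simp
    have "snd a - snd x = l * (s * u + t - snd x)" using arg_cong[OF a(3), of snd] by simp
    also have "\<dots> = s * (fst a - fst x)" unfolding a1 by (simp add: t_def algebra_simps)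
    finally have a2: "snd a - snd x = s * (fst a - fst x)" .
    have "\<bar>snd a - snd x\<bar> \<le> \<bar>fst a - fst x\<bar>"
      unfolding a2 abs_mult using s1 by (simp add: mult_left_le_one_le)
    then have "a \<in> class1 \<omega> x" using a(1) by (simp add: class1_def)
    moreover have ne: "fst a \<noteq> fst x" using a1 a(2) ux by auto
    moreover have "(snd a - snd x) / (fst a - fst x) = s" unfolding a2 using ne by simp
    ultimately show ?thesis by (auto simp: s_def)
  qed
  then obtain a where a: "\<And>v. v \<in> {v0..v0 + \<delta>} \<Longrightarrow> a v \<in> class1 \<omega> x \<and> fst (a v) \<noteq> fst x \<and>
     (snd (a v) - snd x) / (fst (a v) - fst x) = (c2 + v - snd x) / D"
    by metis
  \<comment> \<open>The distance of \<open>x\<close> from the closed set bounds the denominators of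
    the slopes away from 0.\<close>
  obtain \<eta> where \<eta>: "\<eta> > 0" "\<And>z. z \<in> ES \<omega> \<Longrightarrow> \<eta> \<le> dist x z"
    using separate_point_closed[OF closed_ES xE] by auto
  define L where "L = 4 * \<bar>D\<bar> / \<eta>"
  have L: "L > 0" using \<eta> D0 by (simp add: L_def)
  have far: "\<eta> / 2 \<le> \<bar>fst z - fst x\<bar>" if "z \<in> class1 \<omega> x" for z
  proof -
    have "\<eta> \<le> dist x z" using that \<eta>(2) by (auto simp: class1_def visible_part_def)
    also have "\<dots> \<le> \<bar>fst z - fst x\<bar> + \<bar>snd z - snd x\<bar>"
      using norm_Pair_le[of "fst x - fst z" "snd x - snd z"]
      by (simp add: dist_norm minus_prod_def abs_minus_commute)
    also have "\<dots> \<le> 2 * \<bar>fst z - fst x\<bar>" using that by (simp add: class1_def)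
    finally show ?thesis by simp
  qed
  have lip: "\<bar>v - v'\<bar> \<le> L * dist (a v) (a v')" if v: "v \<in> {v0..v0 + \<delta>}" "v' \<in> {v0..v0 + \<delta>}" for v v'
  proof -
    have "v - v' = D * ((c2 + v - snd x) / D - (c2 + v' - snd x) / D)" using D0 by (simp add: field_simps)
    also have "\<dots> = D * ((snd (a v) - snd x) / (fst (a v) - fst x) - (snd (a v') - snd x) / (fst (a v') - fst x))"
      using a[OF v(1)] a[OF v(2)] by simp
    also have "\<bar>\<dots>\<bar> = \<bar>D\<bar> * \<bar>(snd (a v) - snd x) / (fst (a v) - fst x) - (snd (a v') - snd x) / (fst (a v') - fst x)\<bar>"
      by (rule abs_mult)
    also have "\<dots> \<le> \<bar>D\<bar> * (2 * dist (a v) (a v') / (\<eta> / 2))"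
    proof (intro mult_left_mono slope_lipschitz)
      show "\<bar>snd (a v) - snd x\<bar> \<le> \<bar>fst (a v) - fst x\<bar>" using a[OF v(1)] by (simp add: class1_def)
      show "\<eta> / 2 \<le> \<bar>fst (a v') - fst x\<bar>" using a[OF v(2)] far by blast
      show "\<bar>snd (a v) - snd x - (snd (a v') - snd x)\<bar> \<le> dist (a v) (a v')"
        using dist_snd_le[of "a v" "a v'"] by (simp add: dist_real_def)
      show "\<bar>fst (a v) - fst x - (fst (a v') - fst x)\<bar> \<le> dist (a v) (a v')"
        using dist_fst_le[of "a v" "a v'"] by (simp add: dist_real_def)
    qed (use a[OF v(1)] \<eta> in auto)
    also have "\<dots> = L * dist (a v) (a v')" by (simp add: L_def)
    finally show ?thesis .
  qed
  have "content_ge (\<delta> / (2 * L)) (class1 \<omega> x)"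
    unfolding content_ge_def
  proof (intro allI impI)
    fix U :: "nat \<Rightarrow> (real \<times> real) set"
    assume cov: "class1 \<omega> x \<subseteq> (\<Union>i. U i)" and bd: "\<forall>i. bounded (U i)"
    \<comment> \<open>The parameters served by \<open>U i\<close>; by \<open>lip\<close> they lie
      within \<open>L * diameter (U i)\<close> of any one of them.\<close>
    define H where "H i = {v \<in> {v0..v0 + \<delta>}. a v \<in> U i}" for i
    have "\<exists>w. H i \<subseteq> {w - L * diameter (U i)..w + L * diameter (U i)}" for i
    proof (cases "H i = {}")
      case False
      then obtain w where w: "w \<in> H i" by blast
      have "\<bar>v - w\<bar> \<le> L * diameter (U i)" if "v \<in> H i" for v
      proof -
        have "dist (a v) (a w) \<le> diameter (U i)"
          using that w bd by (intro diameter_bounded_bound) (auto simp: H_def)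
        then have "L * dist (a v) (a w) \<le> L * diameter (U i)" using L by (intro mult_left_mono) auto
        then show ?thesis using lip[of v w] that w by (auto simp: H_def)
      qed
      then show ?thesis by (intro exI[of _ w]) (auto simp: abs_le_iff algebra_simps)
    qed auto
    then obtain w where w: "\<And>i. H i \<subseteq> {w i - L * diameter (U i)..w i + L * diameter (U i)}" by metis
    have "{v0..v0 + \<delta>} \<subseteq> (\<Union>i. {w i - L * diameter (U i)..w i + L * diameter (U i)})"
    proof
      fix v assume v: "v \<in> {v0..v0 + \<delta>}"
      then obtain i where "a v \<in> U i" using a cov by blast
      then have "v \<in> H i" using v by (simp add: H_def)
      then show "v \<in> (\<Union>i. {w i - L * diameter (U i)..w i + L * diameter (U i)})" using w by blast
    qed
    then have "emeasure lborel {v0..v0 + \<delta>} \<le> emeasure lborel (\<Union>i. {w i - L * diameter (U i)..w i + L * diameter (U i)})"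
      by (intro emeasure_mono) auto
    also have "\<dots> \<le> (\<Sum>i. emeasure lborel {w i - L * diameter (U i)..w i + L * diameter (U i)})"
      by (rule emeasure_subadditive_countably) auto
    also have "\<dots> = (\<Sum>i. ennreal (2 * L) * ennreal (diameter (U i)))"
    proof (rule suminf_cong)
      fix i
      have d: "0 \<le> L * diameter (U i)" using L bd diameter_ge_0 by (intro mult_nonneg_nonneg) auto
      then have "emeasure lborel {w i - L * diameter (U i)..w i + L * diameter (U i)} = ennreal (2 * L * diameter (U i))"
        by (simp add: algebra_simps)
      also have "\<dots> = ennreal (2 * L) * ennreal (diameter (U i))"
        using L bd diameter_ge_0 by (intro ennreal_mult) auto
      finally show "emeasure lborel {w i - L * diameter (U i)..w i + L * diameter (U i)} = ennreal (2 * L) * ennreal (diameter (U i))" .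
    qed
    also have "\<dots> = ennreal (2 * L) * (\<Sum>i. ennreal (diameter (U i)))" by (rule ennreal_suminf_cmult)
    finally have le: "ennreal \<delta> \<le> ennreal (2 * L) * (\<Sum>i. ennreal (diameter (U i)))" using \<delta> by simp
    have "ennreal (\<delta> / (2 * L)) = ennreal (1 / (2 * L)) * ennreal \<delta>"
      using \<delta> L by (subst ennreal_mult[symmetric]) auto
    also have "\<dots> \<le> ennreal (1 / (2 * L)) * (ennreal (2 * L) * (\<Sum>i. ennreal (diameter (U i))))"
      by (intro mult_left_mono le) auto
    also have "\<dots> = (\<Sum>i. ennreal (diameter (U i)))"
      using L by (simp add: mult.assoc[symmetric] ennreal_mult[symmetric])
    finally show "ennreal (\<delta> / (2 * L)) \<le> (\<Sum>i. ennreal (diameter (U i)))" .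
  qed
  then show ?thesis using \<delta> L by (intro exI[of _ "\<delta> / (2 * L)"]) simp
qed

end


lemma content_ge_mono: "content_ge c A \<Longrightarrow> A \<subseteq> B \<Longrightarrow> content_ge c B"
  unfolding content_ge_def by (meson order_trans)

lemma content_ge_swap:
  assumes "content_ge c (prod.swap ` V)" shows "content_ge c V"
  unfolding content_ge_def
proof (intro allI impI)
  fix U :: "nat \<Rightarrow> (real \<times> real) set"
  assume U: "V \<subseteq> (\<Union>i. U i)" "\<forall>i. bounded (U i)"
  have iso: "norm (prod.swap z - prod.swap z') = norm (z - z')" for z z' :: "real \<times> real"
    by (simp add: norm_Pair norm_prod_def minus_prod_def add.commute)
  have diam: "diameter (prod.swap ` U i) \<le> diameter (U i)" for i
  proof (rule diameter_le)
    show "prod.swap ` U i \<noteq> {} \<or> 0 \<le> diameter (U i)" using U diameter_ge_0 by blast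
    fix z z' assume "z \<in> prod.swap ` U i" "z' \<in> prod.swap ` U i"
    then obtain y y' where y: "y \<in> U i" "y' \<in> U i" "z = prod.swap y" "z' = prod.swap y'" by blast
    then show "norm (z - z') \<le> diameter (U i)"
      using diameter_bounded_bound[of "U i" y y'] U(2) iso by (simp add: dist_norm)
  qed
  have bd: "bounded (prod.swap ` U i)" for i
  proof -
    obtain B where "\<And>z. z \<in> U i \<Longrightarrow> norm z \<le> B" using U(2) unfolding bounded_iff by blast
    moreover have "norm (prod.swap z) = norm z" for z :: "real \<times> real"
      by (simp add: norm_prod_def add.commute)
    ultimately show ?thesis unfolding bounded_iff by (intro exI[of _ B]) auto
  qed
  have "prod.swap ` V \<subseteq> (\<Union>i. prod.swap ` U i)" using U(1) by blast
  then have "ennreal c \<le> (\<Sum>i. ennreal (diameter (prod.swap ` U i)))"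
    using assms bd unfolding content_ge_def by blast
  also have "\<dots> \<le> (\<Sum>i. ennreal (diameter (U i)))"
    by (intro suminf_le ennreal_leI diam) auto
  finally show "ennreal c \<le> (\<Sum>i. ennreal (diameter (U i)))" .
qed

lemma sh_sh: "sh m a b (sh k i j \<omega>) = sh (k + m) (i * 2 ^ m + a) (j * 2 ^ m + b) \<omega>"
  by (auto simp: sh_def emb_def fun_eq_iff power_add algebra_simps)

context percolation_tree
begin

text \<open>Around any point of the set there is a surviving square small enough to avoid
  \<open>x\<close>. It contains a good square, which avoids \<open>x\<close> as well, and the
  direction of its centre decides the orientation.\<close>

lemma content_visible:
  assumes sub: "\<forall>k. \<forall>i<2 ^ k. \<forall>j<2 ^ k. alive (sh k i j \<omega>) \<longrightarrow> has_good (sh k i j \<omega>)"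
    and ne: "ES \<omega> \<noteq> {}" and x: "x \<notin> ES \<omega>"
  shows "\<exists>c>0. content_ge c (visible_part x (ES \<omega>))"
proof -
  obtain a where a: "a \<in> ES \<omega>" using ne by blast
  define m where "m = max \<bar>fst a - fst x\<bar> \<bar>snd a - snd x\<bar>"
  have "a \<noteq> x" using a x by blast
  then have "m > 0" unfolding m_def by (auto simp: prod_eq_iff less_max_iff_disj)
  \<comment> \<open>Two points of one square of level \<open>k\<close> differ by at most
    \<open>2 ^ (- k)\<close> in each coordinate.\<close>
  then obtain k where k: "(1 / 2) ^ k < m" using real_arch_pow_inv[of m "1 / 2"] by auto
  obtain i j where ij: "(i, j) \<in> ch_set \<omega> k" "a \<in> dsq k i j" "alive (sh k i j \<omega>)"
    using ES_alive[OF a] by blast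
  have xk: "x \<notin> dsq k i j"
  proof
    assume "x \<in> dsq k i j"
    then have "fst a \<in> cell k i" "snd a \<in> cell k j" "fst x \<in> cell k i" "snd x \<in> cell k j"
      using ij(2) dsq_iff[of "fst a" "snd a" k i j] dsq_iff[of "fst x" "snd x" k i j] by simp_all
    then have "\<bar>2 ^ k * fst a - 2 ^ k * fst x\<bar> \<le> 1" "\<bar>2 ^ k * snd a - 2 ^ k * snd x\<bar> \<le> 1"
      unfolding cell_iff by linarith+
    then have "2 ^ k * m \<le> 1" unfolding m_def abs_diff_scale by (simp add: max_def)
    then show False using k by (simp add: power_one_over field_simps)
  qed
  have lt: "i < 2 ^ k" "j < 2 ^ k" using ij(1) by (auto simp: ch_set_def)
  then have "has_good (sh k i j \<omega>)" using sub ij(3) by blast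
  then obtain d i' j' where d: "(i', j') \<in> ch_set (sh k i j \<omega>) d" "good (sh d i' j' (sh k i j \<omega>))"
    unfolding has_good_def by blast
  define K I J where "K = k + d" and "I = i * 2 ^ d + i'" and "J = j * 2 ^ d + j'"
  have lt': "i' < 2 ^ d" "j' < 2 ^ d" using d(1) by (auto simp: ch_set_def)
  have good: "good (sh K I J \<omega>)" using d(2) by (simp add: sh_sh K_def I_def J_def)
  have ch: "(I, J) \<in> ch_set \<omega> K" unfolding K_def I_def J_def using ch_set_sh[OF lt'] ij(1) d(1) by simp
  have xQ: "x \<notin> dsq K I J"
    using xk dsq_ancestor[of x k d I J] lt' unfolding K_def I_def J_def by auto
  show ?thesis
  proof (cases "\<bar>(real J + 1 / 2) / 2 ^ K - snd x\<bar> \<le> \<bar>(real I + 1 / 2) / 2 ^ K - fst x\<bar>")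
    case True
    then obtain c where "c > 0" "content_ge c (class1 \<omega> x)"
      using content_class1[OF good ch x xQ] by blast
    moreover have "class1 \<omega> x \<subseteq> visible_part x (ES \<omega>)" by (auto simp: class1_def)
    ultimately show ?thesis using content_ge_mono by blast
  next
    case False
    \<comment> \<open>A centre seen steeply from \<open>x\<close> becomes one of class 1 after
      exchanging coordinates, and goodness is symmetric.\<close>
    have "good (sh K J I (sw \<omega>))" using good good_sw[of "sh K I J \<omega>"] by (simp add: sw_sh)
    moreover have "(J, I) \<in> ch_set (sw \<omega>) K" using ch by (simp add: ch_set_sw)
    moreover have "prod.swap x \<notin> ES (sw \<omega>)" using x ES_sw[of "snd x" "fst x" \<omega>] by (simp add: prod.swap_def)
    moreover have "prod.swap x \<notin> dsq K J I"
      using xQ dsq_iff[of "fst x" "snd x" K I J] dsq_iff[of "snd x" "fst x" K J I] by (auto simp: prod.swap_def)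
    ultimately obtain c where c: "c > 0" "content_ge c (class1 (sw \<omega>) (prod.swap x))"
      using content_class1[of K J I "sw \<omega>" "prod.swap x"] False by auto
    have "class1 (sw \<omega>) (prod.swap x) \<subseteq> prod.swap ` visible_part x (ES \<omega>)"
    proof
      fix z assume "z \<in> class1 (sw \<omega>) (prod.swap x)"
      then have "prod.swap z \<in> visible_part x (ES \<omega>)"
        using visible_part_sw[of z "prod.swap x" "sw \<omega>"] by (simp add: class1_def)
      then show "z \<in> prod.swap ` visible_part x (ES \<omega>)" by (rule rev_image_eqI) simp
    qed
    then have "content_ge c (visible_part x (ES \<omega>))" using c(2) content_ge_mono content_ge_swap by blast
    then show ?thesis using c(1) by blast
  qed
qed

end

section \<open>Transfer to the percolation measure\<close>

text \<open>The squares are replaced by their indices, so that \<open>ES\<close> becomes \<open>percolation_set\<close>.\<close>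

definition coins_of :: "((real \<times> real) set \<Rightarrow> bool) \<Rightarrow> conf" where
  "coins_of \<omega> = (\<lambda>x\<in>idx. \<omega> ((\<lambda>(n, i, j). dsq n i j) x))"

lemma dyadic_square_subset_iff:
  "dyadic_square n i j \<subseteq> dyadic_square n' i' j' \<longleftrightarrow>
    real_of_int i' / 2 ^ n' \<le> real_of_int i / 2 ^ n \<and> (real_of_int i + 1) / 2 ^ n \<le> (real_of_int i' + 1) / 2 ^ n' \<and>
    real_of_int j' / 2 ^ n' \<le> real_of_int j / 2 ^ n \<and> (real_of_int j + 1) / 2 ^ n \<le> (real_of_int j' + 1) / 2 ^ n'"
proof -
  have ne: "real_of_int i / 2 ^ n \<le> (real_of_int i + 1) / 2 ^ n" for i by (simp add: divide_right_mono)
  show ?thesis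
    unfolding dyadic_square_def times_subset_iff using ne by (auto simp: atLeastatMost_subset_iff)
qed

lemma dyadic_square_inject:
  assumes "dyadic_square n i j = dyadic_square n' i' j'"
  shows "n = n' \<and> i = i' \<and> j = j'"
proof -
  have e: "real_of_int i / 2 ^ n = real_of_int i' / 2 ^ n'" "(real_of_int i + 1) / 2 ^ n = (real_of_int i' + 1) / 2 ^ n'"
    "real_of_int j / 2 ^ n = real_of_int j' / 2 ^ n'"
    using dyadic_square_subset_iff[of n i j n' i' j'] dyadic_square_subset_iff[of n' i' j' n i j] assms by auto
  have "1 / (2::real) ^ n = 1 / 2 ^ n'" using e(1,2) by (simp add: add_divide_distrib)
  then have "(2::real) ^ n = 2 ^ n'" by simp
  then have "n = n'" by (rule power_inject_exp[THEN iffD1, rotated]) simp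
  then show ?thesis using e by simp
qed

lemma inj_dsq: "inj_on (\<lambda>(n, i, j). dsq n i j) idx"
  by (rule inj_onI) (auto dest!: dyadic_square_inject)

lemma dsq_percolation_squares: "(\<lambda>(n, i, j). dsq n i j) \<in> idx \<rightarrow> percolation_squares"
proof
  fix x assume "x \<in> idx"
  then obtain n i j where x: "x = (n, i, j)" "1 \<le> n" "i < 2 ^ n" "j < 2 ^ n" by (auto simp: idx_def)
  have le: "(real i + 1) / 2 ^ n \<le> 1" if "i < 2 ^ n" for i
  proof -
    have "real (i + 1) \<le> real (2 ^ n)" using that by (simp only: of_nat_le_iff)
    then show ?thesis by simp
  qed
  have "dsq n i j \<subseteq> unit_square"
    unfolding dyadic_square_def unit_square_def using le[OF x(3)] le[OF x(4)] by (intro Sigma_mono) (auto intro: order_trans)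
  then show "(\<lambda>(n, i, j). dsq n i j) x \<in> percolation_squares"
    using x by (auto simp: percolation_squares_def dyadic_squares_def)
qed

lemma ch_set_Suc:
  "(i, j) \<in> ch_set \<omega> (Suc n) \<longleftrightarrow> (i div 2, j div 2) \<in> ch_set \<omega> n \<and> i < 2 ^ Suc n \<and> j < 2 ^ Suc n \<and> \<omega> (Suc n, i, j)"
proof -
  have d: "i div 2 ^ (Suc n - m) = i div 2 div 2 ^ (n - m)" if "m \<le> n" for i m :: nat
    using that by (simp add: Suc_diff_le div_mult2_eq)
  have "{1..Suc n} = insert (Suc n) {1..n}" by auto
  then have "(\<forall>m\<in>{1..Suc n}. \<omega> (m, i div 2 ^ (Suc n - m), j div 2 ^ (Suc n - m))) \<longleftrightarrow>
     \<omega> (Suc n, i, j) \<and> (\<forall>m\<in>{1..n}. \<omega> (m, i div 2 div 2 ^ (n - m), j div 2 div 2 ^ (n - m)))"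
    using d by auto
  then show ?thesis unfolding ch_set_def by auto
qed

text \<open>\<open>dyadic_squares\<close> allows all integer positions. Containment in a chosen
  parent leaves only \<open>2 * i\<close> and \<open>2 * i + 1\<close> in each coordinate, so
  natural indices suffice and \<open>div 2\<close> recovers the parent.\<close>

lemma chosen_eq: "chosen \<omega> n = (\<lambda>(i, j). dsq n i j) ` ch_set (coins_of \<omega>) n"
proof (induction n)
  case 0
  show ?case by (simp add: ch_set_0 unit_square_def dyadic_square_def)
next
  case (Suc n)
  show ?case
  proof (intro set_eqI iffI)
    fix Q assume "Q \<in> chosen \<omega> (Suc n)"
    then obtain l l' i j where Q: "Q = dyadic_square (Suc n) l l'" "\<omega> Q" "(i, j) \<in> ch_set (coins_of \<omega>) n" "Q \<subseteq> dsq n i j"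
      unfolding chosen.simps Suc dyadic_squares_def by auto
    have "2 * int i \<le> l" "l \<le> 2 * int i + 1" "2 * int j \<le> l'" "l' \<le> 2 * int j + 1"
    proof -
      have key: "x / 2 ^ Suc n \<le> y / 2 ^ n \<longleftrightarrow> x \<le> 2 * y" "y / 2 ^ n \<le> x / 2 ^ Suc n \<longleftrightarrow> 2 * y \<le> x" for x y :: real
      proof -
        have e: "x / 2 ^ Suc n = (x / 2) / 2 ^ n" by simp
        show "x / 2 ^ Suc n \<le> y / 2 ^ n \<longleftrightarrow> x \<le> 2 * y" "y / 2 ^ n \<le> x / 2 ^ Suc n \<longleftrightarrow> 2 * y \<le> x"
          unfolding e divide_le_cancel by auto
      qed
      have r: "2 * real_of_int (int i) \<le> real_of_int l" "real_of_int l + 1 \<le> 2 * (real_of_int (int i) + 1)"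
        "2 * real_of_int (int j) \<le> real_of_int l'" "real_of_int l' + 1 \<le> 2 * (real_of_int (int j) + 1)"
        using Q(4) unfolding Q(1) dyadic_square_subset_iff key by blast+
      have "real_of_int (2 * int i) \<le> real_of_int l" "real_of_int (l + 1) \<le> real_of_int (2 * (int i + 1))"
        "real_of_int (2 * int j) \<le> real_of_int l'" "real_of_int (l' + 1) \<le> real_of_int (2 * (int j + 1))"
        using r by (simp_all only: of_int_add of_int_mult of_int_numeral of_int_1)
      then show "2 * int i \<le> l" "l \<le> 2 * int i + 1" "2 * int j \<le> l'" "l' \<le> 2 * int j + 1"
        unfolding of_int_le_iff by simp_all
    qed
    define I J where "I = nat l" and "J = nat l'"
    have I: "l = int I" "I div 2 = i" and J: "l' = int J" "J div 2 = j"
      using \<open>2 * int i \<le> l\<close> \<open>l \<le> 2 * int i + 1\<close> \<open>2 * int j \<le> l'\<close> \<open>l' \<le> 2 * int j + 1\<close>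
      by (auto simp: I_def J_def)
    have lt: "I < 2 ^ Suc n" "J < 2 ^ Suc n" using Q(3) I(2) J(2) by (auto simp: ch_set_def)
    have "coins_of \<omega> (Suc n, I, J)" using Q(1,2) I(1) J(1) lt by (simp add: coins_of_def idx_def)
    then have "(I, J) \<in> ch_set (coins_of \<omega>) (Suc n)" using Q(3) lt I J by (simp add: ch_set_Suc)
    then show "Q \<in> (\<lambda>(i, j). dsq (Suc n) i j) ` ch_set (coins_of \<omega>) (Suc n)"
      using Q(1) I(1) J(1) by force
  next
    fix Q assume "Q \<in> (\<lambda>(i, j). dsq (Suc n) i j) ` ch_set (coins_of \<omega>) (Suc n)"
    then obtain i j where Q: "Q = dsq (Suc n) i j" "(i, j) \<in> ch_set (coins_of \<omega>) (Suc n)" by auto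
    then have c: "(i div 2, j div 2) \<in> ch_set (coins_of \<omega>) n" "i < 2 ^ Suc n" "j < 2 ^ Suc n" "coins_of \<omega> (Suc n, i, j)"
      by (simp_all add: ch_set_Suc)
    have "\<omega> Q" using c by (simp add: coins_of_def idx_def Q(1))
    moreover have "Q \<in> dyadic_squares (Suc n)" unfolding Q(1) dyadic_squares_def by blast
    moreover have "Q \<subseteq> dsq n (i div 2) (j div 2)"
      unfolding Q(1) using dsq_ancestor[of _ n 1 i j] by auto
    moreover have "dsq n (i div 2) (j div 2) \<in> chosen \<omega> n" unfolding Suc using c(1) by (rule rev_image_eqI) simp
    ultimately show "Q \<in> chosen \<omega> (Suc n)" by auto
  qed
qed

lemma percolation_set_eq: "percolation_set \<omega> = ES (coins_of \<omega>)"
proof (intro set_eqI iffI)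
  fix z assume z: "z \<in> percolation_set \<omega>"
  show "z \<in> ES (coins_of \<omega>)"
  \<comment> \<open>\<open>percolation_set\<close> intersects from level 1 on; the root is supplied
    as an ancestor.\<close>
  proof (rule ES_I[where k=1])
    fix m
    have "z \<in> \<Union>(chosen \<omega> (1 + m))" by (rule INT_D[OF z[unfolded percolation_set_def]]) simp
    then show "\<exists>i j. (i, j) \<in> ch_set (coins_of \<omega>) (1 + m) \<and> z \<in> dsq (1 + m) i j"
      unfolding chosen_eq by auto
  qed
next
  fix z assume z: "z \<in> ES (coins_of \<omega>)"
  have "z \<in> \<Union>(chosen \<omega> n)" for n
    unfolding chosen_eq using ES_D[OF z, of n] by force
  then show "z \<in> percolation_set \<omega>" unfolding percolation_set_def by simp
qed

context percolation_tree
begin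

lemma coins_of_measurable [measurable]: "coins_of \<in> percolation p \<rightarrow>\<^sub>M M"
  unfolding M_def percolation_def coins_of_def
  by (intro measurable_restrict measurable_component_singleton Pi_mem[OF dsq_percolation_squares])

lemma distr_coins_of: "distr (percolation p) M coins_of = M"
  unfolding M_def percolation_def coins_of_def
  by (rule distr_PiM_reindex[OF measure_pmf.prob_space_axioms inj_dsq dsq_percolation_squares])

lemma AE_percolation:
  assumes "AE \<omega> in M. P \<omega>" shows "AE \<omega> in percolation p. P (coins_of \<omega>)"
proof -
  have "AE \<omega> in distr (percolation p) M coins_of. P \<omega>" using assms by (simp only: distr_coins_of)
  then show ?thesis by (rule AE_distrD[OF coins_of_measurable])
qed

lemma non_extinction_sets: "non_extinction p \<in> sets (percolation p)"
proof -
  have "non_extinction p = {\<omega> \<in> space (percolation p). alive (coins_of \<omega>)}"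
    unfolding non_extinction_def percolation_set_eq alive_iff_ES ..
  then show ?thesis by simp
qed

text \<open>The counting bound gives the upper estimate for both dimensions, the content bound the
  lower one.\<close>

lemma AE_dimensions:
  "AE \<omega> in M. ES \<omega> \<noteq> {} \<longrightarrow> (\<forall>x. x \<notin> ES \<omega> \<longrightarrow>
     hausdorff_dim (visible_part x (ES \<omega>)) = 1 \<and> has_box_dim (visible_part x (ES \<omega>)) 1)"
proof -
  obtain C where C: "C > 0" "AE \<omega> in M. \<forall>x. x \<notin> ES \<omega> \<longrightarrow> (\<forall>\<^sub>F n in sequentially.
     real (dyadic_count n (visible_part x (ES \<omega>))) \<le> C * (real n)\<^sup>2 * 2 ^ n)"
    using AE_dyadic_count by blast
  from C(2) AE_subtrees show ?thesis
  proof eventually_elim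
    case (elim \<omega>)
    show ?case
    proof (intro impI allI)
      fix x assume ne: "ES \<omega> \<noteq> {}" and x: "x \<notin> ES \<omega>"
      define V where "V = visible_part x (ES \<omega>)"
      obtain c where c: "c > 0" "content_ge c V"
        using content_visible[OF elim(2) ne x] unfolding V_def by blast
      have N: "\<forall>\<^sub>F n in sequentially. real (dyadic_count n V) \<le> C * (real n)\<^sup>2 * 2 ^ n"
        using elim(1) x unfolding V_def by blast
      have fin: "finite {Q \<in> dyadic_squares n. Q \<inter> V \<noteq> {}}" for n
        unfolding V_def by (rule finite_dyadic_vis)
      have "hausdorff_dim V = 1"
        by (rule antisym[OF hausdorff_dim_le_1[OF fin N] hausdorff_dim_ge_1[OF c]])
      moreover have "has_box_dim V 1" by (rule has_box_dim_1[OF fin N C(1) c(2,1)])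
      ultimately show "hausdorff_dim (visible_part x (ES \<omega>)) = 1 \<and> has_box_dim (visible_part x (ES \<omega>)) 1"
        unfolding V_def by blast
    qed
  qed
qed

end

theorem theorem4p2:
  fixes p :: real
  assumes "1 / 2 < p" and "p < 1"
  shows "(AE \<omega> in conditioned_percolation p.
            \<forall>x. x \<notin> percolation_set \<omega> \<longrightarrow>
              hausdorff_dim (visible_part x (percolation_set \<omega>)) = 1 \<and>
              has_box_dim (visible_part x (percolation_set \<omega>)) 1)
       \<and> (\<forall>a :: nat \<Rightarrow> real.
            filterlim (\<lambda>n. a n / (real n)\<^sup>2) at_top sequentially \<longrightarrow>
            (AE \<omega> in percolation p.
               \<forall>x. x \<notin> percolation_set \<omega> \<longrightarrow>
                 (\<forall>\<^sub>F n in sequentially.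
                    real (dyadic_count n (visible_part x (percolation_set \<omega>))) \<le> a n * 2 ^ n)))"
proof -
  interpret percolation_tree p using assms by unfold_locales
  show ?thesis
  proof (intro conjI allI impI)
    have "AE \<omega> in percolation p. \<omega> \<in> non_extinction p \<longrightarrow> (\<forall>x. x \<notin> percolation_set \<omega> \<longrightarrow>
        hausdorff_dim (visible_part x (percolation_set \<omega>)) = 1 \<and> has_box_dim (visible_part x (percolation_set \<omega>)) 1)"
      using AE_percolation[OF AE_dimensions]
      by eventually_elim (simp add: percolation_set_eq non_extinction_def)
    then show "AE \<omega> in conditioned_percolation p. \<forall>x. x \<notin> percolation_set \<omega> \<longrightarrow>
        hausdorff_dim (visible_part x (percolation_set \<omega>)) = 1 \<and> has_box_dim (visible_part x (percolation_set \<omega>)) 1"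
      unfolding conditioned_percolation_def by (rule AE_uniform_measureI[OF non_extinction_sets])
  next
    fix a :: "nat \<Rightarrow> real" assume a: "filterlim (\<lambda>n. a n / (real n)\<^sup>2) at_top sequentially"
    obtain C where C: "AE \<omega> in M. \<forall>x. x \<notin> ES \<omega> \<longrightarrow> (\<forall>\<^sub>F n in sequentially.
       real (dyadic_count n (visible_part x (ES \<omega>))) \<le> C * (real n)\<^sup>2 * 2 ^ n)"
      using AE_dyadic_count by blast
    \<comment> \<open>The hypothesis on \<open>a\<close> makes the quotient exceed the deterministic
      constant \<open>C\<close> eventually; \<open>n > 0\<close> allows multiplying by
      \<open>n^2\<close>.\<close>
    have ev: "\<forall>\<^sub>F n in sequentially. C * (real n)\<^sup>2 * 2 ^ n \<le> a n * 2 ^ n"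
      using filterlim_at_top[THEN iffD1, OF a, rule_format, of C] eventually_gt_at_top[of 0]
      by eventually_elim (simp add: field_simps)
    show "AE \<omega> in percolation p. \<forall>x. x \<notin> percolation_set \<omega> \<longrightarrow> (\<forall>\<^sub>F n in sequentially.
        real (dyadic_count n (visible_part x (percolation_set \<omega>))) \<le> a n * 2 ^ n)"
      using AE_percolation[OF C]
    proof eventually_elim
      case (elim \<omega>)
      show ?case
      proof (intro allI impI)
        fix x assume "x \<notin> percolation_set \<omega>"
        then have "\<forall>\<^sub>F n in sequentially. real (dyadic_count n (visible_part x (percolation_set \<omega>))) \<le> C * (real n)\<^sup>2 * 2 ^ n"
          using elim unfolding percolation_set_eq by blast
        from this ev show "\<forall>\<^sub>F n in sequentially. real (dyadic_count n (visible_part x (percolation_set \<omega>))) \<le> a n * 2 ^ n"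
          by eventually_elim linarith
      qed
    qed
  qed
qed

end
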